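(* Let $p\ge 5$ be a prime number, let $G\subset\mathrm{GL}_2(\mathbb{F}_p)$ be the normalizer of a non-split Cartan subgroup $$G=\left\{\begin{pmatrix}\alpha&\Xi\beta\\ \beta&\alpha\end{pmatrix},\begin{pmatrix}\alpha&\Xi\beta\\ -\beta&-\alpha\end{pmatrix}:\alpha,\beta\in\mathbb{F}_p,\ (\alpha,\beta)\ne(0,0)\right\}$$ (with $\Xi$ a fixed quadratic non-residue modulo $p$), let $H$ be a subgroup of $\mathbb{F}_p^\times$ containing $-1$, and let $K=\mathbb{Q}(\zeta_p)^H$. Let $\mathcal{O}$ be an orbit of the right action of $G_H$ on $M_p=\mathbb{F}_p^2\smallsetminus\{(0,0)\}$. Pick a lifting $\mathbf{a}\mapsto\tilde{\mathbf{a}}$ of $\mathcal{O}$ to $p^{-1}\mathbb{Z}^2$ respecting complex conjugation. Put $$m=\begin{cases}2,&\text{if }3\mid(p+1)|H|,\\ 6,&\text{otherwise}.\end{cases}$$ Then the product $$u_{\mathcal{O}}=\prod_{\mathbf{a}\in\mathcal{O}}g_{\tilde{\mathbf{a}}}^m$$ is well-defined (it depends only on the orbit $\mathcal{O}$ but not on the particular lifting respecting complex conjugation) and it defines a function in $K(X_G)$.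
   Context: Modular curves. $\zeta_p$ is a primitive $p$-th root of unity, and $\mathbb{F}_p^\times$ is identified with $\mathrm{Gal}(\mathbb{Q}(\zeta_p)/\mathbb{Q})$ via $\zeta_p\mapsto\zeta_p^d$. The field $\mathbb{Q}(\zeta_p)(X(p))$ consists of the $\Gamma(p)$-automorphic functions of weight $0$ on the Poincaré upper half-plane $\mathcal{H}$ (meromorphic, also at the cusps) whose $q$-expansion in powers of $q^{1/p}$ ($q=e^{2\pi i\tau}$) has coefficients in $\mathbb{Q}(\zeta_p)$. The group $\mathrm{GL}_2(\mathbb{F}_p)$ acts on it on the right (action written $u\mapsto u^\sigma$) so that: for $\sigma\in\mathrm{SL}_2(\mathbb{F}_p)$, $u^\sigma=u\circ\tilde\sigma$ with $\tilde\sigma\in\mathrm{SL}_2(\mathbb{Z})$ any lifting of $\sigma$; for $\sigma=\begin{pmatrix}1&0\\0&d\end{pmatrix}$, $u^\sigma$ is obtained by applying $\zeta_p\mapsto\zeta_p^d$ to the coefficients of the $q$-expansion. $X_G=X_{\mathrm{ns}}^+(p)$ is the modular curve over $\mathbb{Q}$ whose function field is the $G$-invariant subfield. Put $G_H=\{g\in G:\det g\in H\}$; the field $K(X_G)$ is the $G_H$-invariant subfield of $\mathbb{Q}(\zeta_p)(X(p))$. The group $G_H$ acts on $M_p$ (row vectors) from the right by matrix multiplication; its orbits are the sets $\{(x,y):\Xi x^2-y^2\in cH\}$, $c\in\mathbb{F}_p^\times$. Liftings. We identify $(p^{-1}\mathbb{Z}/\mathbb{Z})^2$ with $\mathbb{F}_p^2$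 (via multiplication by $p$). A lifting of a subset $A\subset\mathbb{F}_p^2$ is a map $A\to p^{-1}\mathbb{Z}^2$, $\mathbf{a}\mapsto\tilde{\mathbf{a}}$, such that the class of $\tilde{\mathbf{a}}$ modulo $\mathbb{Z}^2$ corresponds to $\mathbf{a}$. Such a lifting (of a set stable under $(a_1,a_2)\mapsto(a_1,-a_2)$) respects complex conjugation if, whenever $\mathbf{a}=(a_1,a_2)$ is lifted to $(\tilde a_1,\tilde a_2)$, the element $(a_1,-a_2)$ is lifted to $(\tilde a_1,-\tilde a_2)$. Siegel functions. For $\tilde{\mathbf{a}}=(\tilde a_1,\tilde a_2)\in\mathbb{Q}^2\smallsetminus\mathbb{Z}^2$ the Siegel function on $\mathcal{H}$ is $$g_{\tilde{\mathbf{a}}}(\tau)=-q^{B_2(\tilde a_1)/2}e^{\pi i\tilde a_2(\tilde a_1-1)}\prod_{n=0}^\infty\bigl(1-q^{n+\tilde a_1}e^{2\pi i\tilde a_2}\bigr)\bigl(1-q^{n+1-\tilde a_1}e^{-2\pi i\tilde a_2}\bigr),$$ where $q^a=e^{2\pi ia\tau}$ for $a\in\mathbb{Q}$ and $B_2(T)=T^2-T+1/6$. *)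

theory Defs
  imports
    "HOL-Complex_Analysis.Complex_Analysis"
    "Berlekamp_Zassenhaus.Finite_Field"
begin

(* The field F_p is 'p mod_ring with p = CARD('p) and 'p :: prime_card. Vectors are row vectors. *)

section \<open>Cyclotomic fields and their Galois groups\<close>

definition zeta :: "nat \<Rightarrow> complex" where
  "zeta p = exp (2 * of_real pi * \<i> / of_nat p)"

definition is_subfield :: "complex set \<Rightarrow> bool" where
  "is_subfield F \<longleftrightarrow> 1 \<in> F \<and>
     (\<forall>x\<in>F. \<forall>y\<in>F. x - y \<in> F \<and> x * y \<in> F) \<and> (\<forall>x\<in>F. inverse x \<in> F)"

(* Every subfield of the complex numbers contains the rationals, so this is Q(zeta_p). *)
definition cyclotomic_field :: "nat \<Rightarrow> complex set" where
  "cyclotomic_field p = is_subfield hull {zeta p}"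

(* The element of Gal(Q(zeta_p)/Q) with zeta_p |-> zeta_p^d, for d \<noteq> 0 in F_p. *)
definition cyclotomic_galois :: "'p::prime_card mod_ring \<Rightarrow> complex \<Rightarrow> complex" where
  "cyclotomic_galois d = (THE s.
     s \<in> extensional (cyclotomic_field CARD('p)) \<and>
     bij_betw s (cyclotomic_field CARD('p)) (cyclotomic_field CARD('p)) \<and>
     (\<forall>x\<in>cyclotomic_field CARD('p). \<forall>y\<in>cyclotomic_field CARD('p).
        s (x + y) = s x + s y \<and> s (x * y) = s x * s y) \<and>
     s (zeta CARD('p)) = zeta CARD('p) powi to_int_mod_ring d)"


section \<open>The field of modular functions of level p\<close>

definition upper_half_plane :: "complex set" where
  "upper_half_plane = {\<tau>. Im \<tau> > 0}"

definition SL2Z :: "(int^2^2) set" where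
  "SL2Z = {\<gamma>. det \<gamma> = 1}"

definition principal_congruence_subgroup :: "nat \<Rightarrow> (int^2^2) set" where
  "principal_congruence_subgroup p =
     {\<gamma> \<in> SL2Z. \<forall>i j. [\<gamma> $ i $ j = mat 1 $ i $ j] (mod int p)}"

definition moebius :: "int^2^2 \<Rightarrow> complex \<Rightarrow> complex" where
  "moebius \<gamma> \<tau> = (of_int (\<gamma>$1$1) * \<tau> + of_int (\<gamma>$1$2)) / (of_int (\<gamma>$2$1) * \<tau> + of_int (\<gamma>$2$2))"

(* f(tau) equals the Laurent series A in q^(1/p), for tau of large imaginary part. *)
definition has_q_expansion :: "nat \<Rightarrow> (complex \<Rightarrow> complex) \<Rightarrow> complex fls \<Rightarrow> bool" where
  "has_q_expansion p f A \<longleftrightarrow> fls_conv_radius A > 0 \<and>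
     eventually (\<lambda>\<tau>. f \<tau> = eval_fls A (exp (2 * of_real pi * \<i> * \<tau> / of_nat p)))
       (filtercomap Im at_top)"

(* The field Q(zeta_p)(X(p)). A meromorphic function on the upper half-plane is represented by
   the unique HOL function that takes the value 0 at its poles, has no removable singularities,
   and is 0 off the upper half-plane. Meromorphy at the cusps is the existence of a q-expansion
   (a Laurent series, so with finite principal part) of every f o gamma. *)
definition modular_function_field :: "nat \<Rightarrow> (complex \<Rightarrow> complex) set" where
  "modular_function_field p = {f.
     f nicely_meromorphic_on upper_half_plane \<and>
     (\<forall>\<tau>. \<tau> \<notin> upper_half_plane \<longrightarrow> f \<tau> = 0) \<and>
     (\<forall>\<gamma>\<in>principal_congruence_subgroup p. \<forall>\<tau>\<in>upper_half_plane. f (moebius \<gamma> \<tau>) = f \<tau>) \<and>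
     (\<forall>\<gamma>\<in>SL2Z. \<exists>A. has_q_expansion p (f \<circ> moebius \<gamma>) A) \<and>
     (\<exists>A. has_q_expansion p f A \<and> (\<forall>n. fls_nth A n \<in> cyclotomic_field p))}"


section \<open>The right action of GL2(F_p)\<close>

definition diag2 :: "'a::zero \<Rightarrow> 'a \<Rightarrow> 'a^2^2" where
  "diag2 a d = vector [vector [a, 0], vector [0, d]]"

(* The action of diag2 1 d. *)
definition galois_twist ::
  "'p::prime_card mod_ring \<Rightarrow> (complex \<Rightarrow> complex) \<Rightarrow> complex \<Rightarrow> complex" where
  "galois_twist d u = (THE v. v \<in> modular_function_field CARD('p) \<and>
     (\<exists>A B. has_q_expansion CARD('p) u A \<and> has_q_expansion CARD('p) v B \<and>
            (\<forall>n. fls_nth B n = cyclotomic_galois d (fls_nth A n))))"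

definition SL2_lift :: "'p::prime_card mod_ring^2^2 \<Rightarrow> int^2^2" where
  "SL2_lift \<sigma> = (SOME \<gamma>. \<gamma> \<in> SL2Z \<and> map_matrix of_int \<gamma> = \<sigma>)"

(* u^sigma, using sigma = diag(1,d) ** sigma' with d = det sigma and sigma' of determinant 1;
   for a right action, u^sigma = (u^diag(1,d))^sigma'. *)
definition GL2_act ::
  "(complex \<Rightarrow> complex) \<Rightarrow> 'p::prime_card mod_ring^2^2 \<Rightarrow> complex \<Rightarrow> complex" where
  "GL2_act u \<sigma> =
     galois_twist (det \<sigma>) u \<circ> moebius (SL2_lift (diag2 1 (inverse (det \<sigma>)) ** \<sigma>))"


section \<open>The normalizer of a non-split Cartan subgroup\<close>

definition ns_normalizer :: "'p::prime_card mod_ring \<Rightarrow> ('p mod_ring^2^2) set" where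
  "ns_normalizer \<Xi> =
     {vector [vector [\<alpha>, \<Xi> * \<beta>], vector [\<beta>, \<alpha>]] |\<alpha> \<beta>. (\<alpha>, \<beta>) \<noteq> (0, 0)} \<union>
     {vector [vector [\<alpha>, \<Xi> * \<beta>], vector [-\<beta>, -\<alpha>]] |\<alpha> \<beta>. (\<alpha>, \<beta>) \<noteq> (0, 0)}"

definition det_in :: "('p::prime_card mod_ring^2^2) set \<Rightarrow> 'p mod_ring set \<Rightarrow> ('p mod_ring^2^2) set" where
  "det_in G H = {g \<in> G. det g \<in> H}"

(* For K = Q(zeta_p)^H this is the function field K(X_G): the G_H-invariants of Q(zeta_p)(X(p)).
   The field K enters only through H. *)
definition function_field_X ::
  "('p::prime_card mod_ring^2^2) set \<Rightarrow> 'p mod_ring set \<Rightarrow> (complex \<Rightarrow> complex) set" where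
  "function_field_X G H =
     {u \<in> modular_function_field CARD('p). \<forall>\<sigma>\<in>det_in G H. GL2_act u \<sigma> = u}"

definition right_orbit :: "('p::prime_card mod_ring^2^2) set \<Rightarrow> 'p mod_ring^2 \<Rightarrow> ('p mod_ring^2) set" where
  "right_orbit \<Gamma> a = {a v* g |g. g \<in> \<Gamma>}"


section \<open>Liftings and Siegel functions\<close>

definition is_lifting ::
  "('p::prime_card mod_ring^2) set \<Rightarrow> ('p mod_ring^2 \<Rightarrow> rat^2) \<Rightarrow> bool" where
  "is_lifting A L \<longleftrightarrow> (\<forall>a\<in>A. \<exists>n :: int^2.
     L a = (\<chi> i. of_int (n $ i) / of_nat CARD('p)) \<and> a = (\<chi> i. of_int (n $ i)))"

definition conj_vec :: "'a::ab_group_add^2 \<Rightarrow> 'a^2" where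
  "conj_vec a = vector [a $ 1, - (a $ 2)]"

definition respects_conjugation ::
  "('p::prime_card mod_ring^2) set \<Rightarrow> ('p mod_ring^2 \<Rightarrow> rat^2) \<Rightarrow> bool" where
  "respects_conjugation A L \<longleftrightarrow> (\<forall>a\<in>A. L (conj_vec a) = conj_vec (L a))"

definition bernpoly2 :: "rat \<Rightarrow> rat" where
  "bernpoly2 t = t\<^sup>2 - t + 1 / 6"

definition q_pow :: "rat \<Rightarrow> complex \<Rightarrow> complex" where
  "q_pow a \<tau> = exp (2 * of_real pi * \<i> * of_rat a * \<tau>)"

definition e2pi :: "rat \<Rightarrow> complex" where
  "e2pi t = exp (2 * of_real pi * \<i> * of_rat t)"

(* Extended by 0 off the upper half-plane; see modular_function_field. *)
definition siegel :: "rat^2 \<Rightarrow> complex \<Rightarrow> complex" where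
  "siegel a \<tau> = (if \<tau> \<in> upper_half_plane then
     - q_pow (bernpoly2 (a $ 1) / 2) \<tau> * exp (of_real pi * \<i> * of_rat (a $ 2 * (a $ 1 - 1))) *
     (\<Prod>n. (1 - q_pow (of_nat n + a $ 1) \<tau> * e2pi (a $ 2)) *
           (1 - q_pow (of_nat n + 1 - a $ 1) \<tau> * e2pi (- (a $ 2))))
     else 0)"

definition siegel_product ::
  "nat \<Rightarrow> ('p::prime_card mod_ring^2) set \<Rightarrow> ('p mod_ring^2 \<Rightarrow> rat^2) \<Rightarrow> complex \<Rightarrow> complex" where
  "siegel_product m A L \<tau> = (\<Prod>a\<in>A. siegel (L a) \<tau> ^ m)"

end

theory Submission
  imports Defs
begin

text \<open>Write \<open>g\<^sub>a\<close> for the Siegel function with parameter \<open>a = N/p\<close>, where \<open>N\<close> is a vector of integers, and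
\<open>x \<and> y = x\<^sub>1 y\<^sub>2 - x\<^sub>2 y\<^sub>1\<close>
  for the symplectic form (\<open>wedge\<close> below).  Three rules govern these functions.

\<^item> For \<open>\<gamma>\<close> in \<open>SL\<^sub>2(\<int>)\<close> one has \<open>g\<^sub>a \<circ> \<gamma> = C \<cdot> g\<^sub>a\<^sub>\<gamma>\<close> with a twelfth root of unity \<open>C\<close> that does not
  depend on \<open>a\<close> (\<open>csiegel_modular\<close>).
\<^item> If \<open>b\<close> is an integer vector, then \<open>g\<^sub>a\<^sub>+\<^sub>b\<^sup>2 = e(a \<and> b) g\<^sub>a\<^sup>2\<close> with \<open>e(z) = exp(2\<pi>iz)\<close>
  (\<open>csiegel_square_add_int\<close>).
\<^item> Up to an explicit constant, the coefficients of the \<open>q\<close>-expansion of \<open>g\<^sub>a\<close> are values at \<open>\<zeta>\<^sub>p\<close> of integer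
  polynomials, and replacing \<open>\<zeta>\<^sub>p\<close>
    by \<open>\<zeta>\<^sub>p\<^sup>d\<close> multiplies the second coordinate of \<open>a\<close> by \<open>d\<close>.

Take the product of the \<open>g\<^sub>a\<^sup>m\<close> over an orbit.  The choice of \<open>m\<close> makes \<open>m\<close> times the length of the orbit divisible
by 12, because the orbit is stable under \<open>a \<mapsto> -a\<close> and, if 3 divides \<open>(p + 1)|H|\<close>, under a
fixed-point-free permutation of order 3 (\<open>Orb_even\<close>, \<open>Orb_three\<close>).  So the constants \<open>C\<close> disappear.  As \<open>m\<close>
is even, the second rule says that two families of lifts \<open>N\<close>, \<open>N'\<close> of the same vectors give products that differ by
\<open>e((m/2) S/p\<^sup>2)\<close>, where \<open>S\<close> is the sum of the \<open>N(a) \<and> N'(a)\<close>.  Every assertion of the theorem thus becomes a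
congruence \<open>S \<equiv> 0\<close> modulo \<open>p\<^sup>2\<close> (\<open>csiegel_prod_change_lift_eq\<close>).

\<^item> For two lifts that respect complex conjugation the contributions of \<open>a\<close> and its conjugate to \<open>S\<close> cancel, so
  \<open>S = 0\<close> (\<open>lift_sum_conj\<close>).  This is the independence of the lifting.
\<^item> If \<open>\<gamma> \<equiv> 1\<close> modulo \<open>p\<close> and \<open>N' = N\<gamma>\<close>, then \<open>S/p\<close> is modulo \<open>p\<close> the sum over the orbit of a quadratic form.
  Such a sum vanishes, since the Gram matrix \<open>M\<close> of the orbit satisfies \<open>g\<^sup>T M g = M\<close>
    for all \<open>g\<close> in \<open>G\<^sub>H\<close>, which
  forces \<open>M = 0\<close> (\<open>Orb_second_moments\<close>).  This is the invariance under \<open>\<Gamma>(p)\<close>; the same vanishing makes the exponents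
  of the \<open>q\<close>-expansion multiples of \<open>1/p\<close>.
\<^item> Let \<open>\<sigma>\<close> be in \<open>G\<^sub>H\<close> with determinant \<open>d\<close>.  The action of \<open>\<sigma>\<close> replaces the lifts \<open>N(a)\<close> by \<open>N(a)\<Gamma>\<close>, where \<open>\<Gamma>\<close> is an
  integral matrix congruent to \<open>\<sigma>\<close> modulo \<open>p\<close>, and these have to be compared with the lifts \<open>N(a\<sigma>)\<close>.  Now \<open>S/p\<close>
  modulo \<open>p\<close> depends only on \<open>\<sigma>\<close>, and as a function \<open>s\<close> of \<open>\<sigma>\<close> it is a cocycle,
  \<open>s(\<sigma>\<tau>) = s(\<tau>) + det(\<tau>) s(\<sigma>)\<close>, that vanishes at the complex conjugation.  Commutation relations in \<open>G\<^sub>H\<close> then show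
  that it vanishes everywhere (\<open>lift_cocycle_vanishes\<close>).\<close>

no_notation fps_nth (infixl \<open>$\<close> 75)
hide_const (open) up_ring.monom up_ring.coeff Coset.order module.smult

section \<open>Infinite products\<close>

text \<open>The \<open>q\<close>-Pochhammer symbol \<open>(x; y)\<^sub>\<infinity>\<close>.\<close>
definition qpoch :: "complex \<Rightarrow> complex \<Rightarrow> complex" where
  "qpoch x y = (\<Prod>n. 1 - x * y ^ n)"

lemma convergent_qpoch:
  fixes x y :: complex
  assumes "norm y < 1" shows "convergent_prod (\<lambda>n. 1 - x * y ^ n)"
proof -
  have "summable (\<lambda>n. norm x * norm y ^ n)"
    using assms by (intro summable_mult summable_geometric) auto
  then have "abs_convergent_prod (\<lambda>n. 1 - x * y ^ n)"
    by (intro summable_imp_abs_convergent_prod) (simp add: norm_mult norm_power)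
  then show ?thesis by (rule abs_convergent_prod_imp_convergent_prod)
qed

lemma qpoch_eq_0_iff:
  assumes "norm y < 1" shows "qpoch x y = 0 \<longleftrightarrow> (\<exists>n. x * y ^ n = 1)"
proof -
  have "(\<lambda>n. 1 - x * y ^ n) has_prod qpoch x y"
    unfolding qpoch_def by (rule convergent_prod_has_prod[OF convergent_qpoch[OF assms]])
  then show ?thesis using has_prod_eq_0_iff by fastforce
qed

lemma tendsto_qpoch:
  assumes "norm y < 1" shows "(\<lambda>N. \<Prod>n<N. 1 - x * y ^ n) \<longlonglongrightarrow> qpoch x y"
  unfolding qpoch_def
  by (intro has_prod_imp_tendsto' convergent_prod_has_prod convergent_qpoch assms)

text \<open>Both arguments may vary with \<open>t\<close>, so that this single statement yields holomorphy in the elliptic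
variable, in \<open>\<tau>\<close> and in \<open>q\<^sup>1\<^sup>/\<^sup>p\<close>, and also the convergence of Taylor coefficients.\<close>
lemma uniform_limit_qpoch:
  assumes "continuous_on K f" "continuous_on K g" "compact K" "\<And>t. t \<in> K \<Longrightarrow> norm (g t) < 1"
  shows "uniform_limit K (\<lambda>N t. \<Prod>n<N. 1 - f t * g t ^ n) (\<lambda>t. qpoch (f t) (g t)) sequentially"
proof (cases "K = {}")
  case False
  have "continuous_on K (\<lambda>t. norm (g t))" using assms by (intro continuous_intros)
  then obtain t0 where t0: "t0 \<in> K" "\<And>t. t \<in> K \<Longrightarrow> norm (g t) \<le> norm (g t0)"
    using continuous_attains_sup[OF assms(3) False] by blast
  define r where "r = norm (g t0)"
  have r: "r < 1" "0 \<le> r" using assms t0 by (auto simp: r_def)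
  have "compact (f ` K)" by (rule compact_continuous_image) fact+
  then obtain M where M: "\<And>t. t \<in> K \<Longrightarrow> norm (f t) \<le> M"
    by (meson bounded_iff compact_imp_bounded imageI)
  have "uniformly_convergent_on K (\<lambda>N t. \<Sum>n<N. norm (- (f t * g t ^ n)))"
  proof (rule Weierstrass_m_test'[where M = "\<lambda>n. M * r ^ n"])
    fix n t assume t: "t \<in> K"
    have "norm (f t * g t ^ n) \<le> M * r ^ n"
      unfolding norm_mult norm_power using M[OF t] t0(2)[OF t] r
      by (intro mult_mono power_mono) (auto simp: r_def intro: order_trans[OF norm_ge_zero])
    then show "norm (norm (- (f t * g t ^ n))) \<le> M * r ^ n" by simp
  qed (use r in \<open>auto intro!: summable_mult\<close>)
  then have "uniformly_convergent_on K (\<lambda>N t. \<Prod>n<N. 1 + - (f t * g t ^ n))"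
    using assms by (intro uniformly_convergent_on_prod continuous_intros)
  then have lim: "uniform_limit K (\<lambda>N t. \<Prod>n<N. 1 - f t * g t ^ n)
      (\<lambda>t. lim (\<lambda>N. \<Prod>n<N. 1 - f t * g t ^ n)) sequentially"
    by (simp add: uniformly_convergent_uniform_limit_iff)
  show ?thesis
    by (rule uniform_limit_cong'[THEN iffD1, OF _ _ lim])
      (use tendsto_qpoch assms(4) in \<open>auto intro!: limI\<close>)
qed auto

lemma holomorphic_on_qpoch:
  assumes "f holomorphic_on S" "g holomorphic_on S" "open S" "\<And>t. t \<in> S \<Longrightarrow> norm (g t) < 1"
  shows "(\<lambda>t. qpoch (f t) (g t)) holomorphic_on S"
proof (rule holomorphic_uniform_sequence[OF \<open>open S\<close>])
  fix n show "(\<lambda>t. \<Prod>k<n. 1 - f t * g t ^ k) holomorphic_on S"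
    using assms by (intro holomorphic_intros)
next
  fix t assume "t \<in> S"
  then obtain d where d: "0 < d" "cball t d \<subseteq> S"
    using \<open>open S\<close> open_contains_cball by blast
  have "uniform_limit (cball t d) (\<lambda>N t. \<Prod>n<N. 1 - f t * g t ^ n) (\<lambda>t. qpoch (f t) (g t)) sequentially"
    using d assms by (intro uniform_limit_qpoch)
      (auto intro!: holomorphic_on_imp_continuous_on elim!: holomorphic_on_subset)
  with d show "\<exists>d>0. cball t d \<subseteq> S \<and> uniform_limit (cball t d) (\<lambda>N t. \<Prod>n<N. 1 - f t * g t ^ n) (\<lambda>t. qpoch (f t) (g t)) sequentially"
    by blast
qed

lemma qpoch_rec:
  assumes "norm y < 1" shows "qpoch x y = (1 - x) * qpoch (x * y) y"
proof -
  have "(\<lambda>N. (1 - x) * (\<Prod>n<N. 1 - (x * y) * y ^ n)) \<longlonglongrightarrow> (1 - x) * qpoch (x * y) y"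
    by (intro tendsto_intros tendsto_qpoch assms)
  also have "(\<lambda>N. (1 - x) * (\<Prod>n<N. 1 - (x * y) * y ^ n)) = (\<lambda>N. \<Prod>n<Suc N. 1 - x * y ^ n)"
    by (subst prod.lessThan_Suc_shift) (simp add: mult.assoc)
  finally have "(\<lambda>N. \<Prod>n<N. 1 - x * y ^ n) \<longlonglongrightarrow> (1 - x) * qpoch (x * y) y"
    by (rule LIMSEQ_imp_Suc)
  then show ?thesis using LIMSEQ_unique tendsto_qpoch[OF assms] by blast
qed

lemma qpoch_square_split:
  assumes "norm y < 1" shows "qpoch x y = qpoch x (y\<^sup>2) * qpoch (x * y) (y\<^sup>2)"
proof -
  have y2: "norm (y\<^sup>2) < 1" using assms by (simp add: norm_power power_less_one_iff)
  have eq: "(\<Prod>n<2*N. 1 - x * y ^ n) = (\<Prod>n<N. 1 - x * (y\<^sup>2) ^ n) * (\<Prod>n<N. 1 - x * y * (y\<^sup>2) ^ n)" for N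
    by (induction N) (simp_all add: power_mult[symmetric] mult_ac)
  have "(\<lambda>N. \<Prod>n<2*N. 1 - x * y ^ n) \<longlonglongrightarrow> qpoch x y"
    by (rule filterlim_compose[OF tendsto_qpoch[OF assms]]) 
      (auto intro!: filterlim_subseq strict_monoI)
  moreover have "(\<lambda>N. \<Prod>n<2*N. 1 - x * y ^ n) \<longlonglongrightarrow> qpoch x (y\<^sup>2) * qpoch (x * y) (y\<^sup>2)"
    unfolding eq by (intro tendsto_intros tendsto_qpoch y2)
  ultimately show ?thesis by (rule LIMSEQ_unique)
qed

lemma qpoch_mult_uminus:
  assumes "norm y < 1" shows "qpoch x y * qpoch (- x) y = qpoch (x\<^sup>2) (y\<^sup>2)"
proof -
  have y2: "norm (y\<^sup>2) < 1" using assms by (simp add: norm_power power_less_one_iff)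
  have eq: "(\<Prod>n<N. 1 - x * y ^ n) * (\<Prod>n<N. 1 - (- x) * y ^ n) = (\<Prod>n<N. 1 - x\<^sup>2 * (y\<^sup>2) ^ n)"
    for N
    unfolding prod.distrib[symmetric]
    by (intro prod.cong) (simp_all add: algebra_simps power2_eq_square power_mult_distrib)
  have "(\<lambda>N. (\<Prod>n<N. 1 - x * y ^ n) * (\<Prod>n<N. 1 - (- x) * y ^ n)) \<longlonglongrightarrow> qpoch x y * qpoch (- x) y"
    by (intro tendsto_intros tendsto_qpoch assms)
  then show ?thesis unfolding eq using LIMSEQ_unique tendsto_qpoch[OF y2] by blast
qed

lemma qpoch_self_nonzero:
  assumes "norm y < 1" shows "qpoch y y \<noteq> 0"
proof
  assume "qpoch y y = 0"
  then obtain n where "y * y ^ n = 1" using qpoch_eq_0_iff[OF assms] by blast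
  then have "norm y ^ Suc n = 1" by (metis norm_one norm_power power_Suc)
  moreover have "norm y ^ Suc n < 1" if "y \<noteq> 0" using assms that by (intro power_Suc_less_one) auto
  ultimately show False by (cases "y = 0") auto
qed

text \<open>Euler's identity.  Splitting \<open>(y; y)\<^sub>\<infinity>\<close> by the parity of the exponent gives \<open>(y; y\<^sup>2)\<^sub>\<infinity> (y\<^sup>2; y\<^sup>2)\<^sub>\<infinity>\<close>, while
\<open>(y; y)\<^sub>\<infinity> (-y; y)\<^sub>\<infinity> = (y\<^sup>2; y\<^sup>2)\<^sub>\<infinity>\<close>; the factor \<open>(y\<^sup>2; y\<^sup>2)\<^sub>\<infinity>\<close> cancels.\<close>
lemma euler_qpoch:
  assumes "norm y < 1" shows "qpoch y (y\<^sup>2) * qpoch (- y) y = 1"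
proof -
  have y2: "norm (y\<^sup>2) < 1" using assms by (simp add: norm_power power_less_one_iff)
  have "qpoch y y \<noteq> 0" by (rule qpoch_self_nonzero[OF assms])
  moreover have "qpoch y y = qpoch y (y\<^sup>2) * qpoch (y\<^sup>2) (y\<^sup>2)"
    using qpoch_square_split[OF assms, of y] by (simp add: power2_eq_square)
  moreover have "qpoch y y * qpoch (- y) y = qpoch (y\<^sup>2) (y\<^sup>2)" by (rule qpoch_mult_uminus[OF assms])
  ultimately have "qpoch (y\<^sup>2) (y\<^sup>2) \<noteq> 0"
      "qpoch (y\<^sup>2) (y\<^sup>2) * (qpoch y (y\<^sup>2) * qpoch (- y) y) = qpoch (y\<^sup>2) (y\<^sup>2) * 1"
    by (simp_all add: mult_ac)
  then show ?thesis by (simp only: mult_cancel_left simp_thms)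
qed

section \<open>The theta function and its inversion formula\<close>

definition exp2pi :: "complex \<Rightarrow> complex" where "exp2pi z = exp (2 * of_real pi * \<i> * z)"

lemma exp2pi_add: "exp2pi (x + y) = exp2pi x * exp2pi y" by (simp add: exp2pi_def algebra_simps exp_add)
lemma exp2pi_minus: "exp2pi (- x) = inverse (exp2pi x)" by (simp add: exp2pi_def exp_minus)
lemma exp2pi_diff: "exp2pi (x - y) = exp2pi x / exp2pi y" by (simp add: exp2pi_def algebra_simps exp_diff)
lemma exp2pi_nonzero [simp]: "exp2pi x \<noteq> 0" by (simp add: exp2pi_def)
lemma exp2pi_of_int [simp]: "exp2pi (of_int n) = 1"
proof -
  have "2 * of_real pi * \<i> * of_int n = of_int n * (complex_of_real (2 * pi) * \<i>)" by simp
  then show ?thesis unfolding exp2pi_def exp_eq_1 by simp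
qed
lemma exp2pi_1 [simp]: "exp2pi 1 = 1" and exp2pi_0 [simp]: "exp2pi 0 = 1"
  using exp2pi_of_int[of 1] exp2pi_of_int[of 0] by auto
lemma exp2pi_eq_1_iff: "exp2pi z = 1 \<longleftrightarrow> (\<exists>n. z = of_int n)"
proof
  assume "exp2pi z = 1"
  then obtain n where "Re (2 * of_real pi * \<i> * z) = 0" "Im (2 * of_real pi * \<i> * z) = of_int (2 * n) * pi"
    unfolding exp2pi_def exp_eq_1 by blast
  then have "z = of_int n" by (auto simp: complex_eq_iff)
  then show "\<exists>n. z = of_int n" by blast
qed auto
lemma exp2pi_power: "exp2pi x ^ n = exp2pi (of_nat n * x)" by (simp add: exp2pi_def exp_of_nat_mult[symmetric] mult_ac)
lemma norm_exp2pi: "norm (exp2pi z) = exp (- 2 * pi * Im z)" by (simp add: exp2pi_def)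
lemma norm_exp2pi_less_1: "Im z > 0 \<Longrightarrow> norm (exp2pi z) < 1" by (simp add: norm_exp2pi)
lemma exp2pi_holomorphic [holomorphic_intros]: "f holomorphic_on S \<Longrightarrow> (\<lambda>z. exp2pi (f z)) holomorphic_on S"
  unfolding exp2pi_def by (intro holomorphic_intros)

text \<open>Jacobi's theta function in its product form, divided by \<open>(q; q)\<^sub>\<infinity>\<close> and an elementary factor.\<close>
definition theta :: "complex \<Rightarrow> complex \<Rightarrow> complex" where
  "theta z \<tau> = qpoch (exp2pi z) (exp2pi \<tau>) * qpoch (exp2pi \<tau> / exp2pi z) (exp2pi \<tau>)"

lemma theta_add_1: "theta (z + 1) \<tau> = theta z \<tau>"
  by (simp add: theta_def exp2pi_add)

lemma theta_add_tau:
  assumes "Im \<tau> > 0" shows "theta (z + \<tau>) \<tau> = - theta z \<tau> / exp2pi z"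
proof -
  let ?q = "exp2pi \<tau>" and ?w = "exp2pi z"
  have q: "norm ?q < 1" using norm_exp2pi_less_1[OF assms] .
  have "theta (z + \<tau>) \<tau> = qpoch (?w * ?q) ?q * ((1 - 1 / ?w) * qpoch (?q / ?w) ?q)"
    using qpoch_rec[OF q, of "1 / ?w"] by (simp add: theta_def exp2pi_add)
  also have "\<dots> = - (((1 - ?w) * qpoch (?w * ?q) ?q) * qpoch (?q / ?w) ?q) / ?w"
    by (simp add: field_simps)
  also have "(1 - ?w) * qpoch (?w * ?q) ?q = qpoch ?w ?q" using qpoch_rec[OF q, of ?w] by simp
  finally show ?thesis by (simp add: theta_def)
qed

lemma theta_eq_0D:
  assumes "Im \<tau> > 0" "theta z \<tau> = 0" shows "\<exists>m n. z = of_int m + of_int n * \<tau>"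
proof -
  have q: "norm (exp2pi \<tau>) < 1" using norm_exp2pi_less_1[OF assms(1)] .
  consider n where "exp2pi (z + of_nat n * \<tau>) = 1" | n where "exp2pi (\<tau> - z + of_nat n * \<tau>) = 1"
  proof -
    have "qpoch (exp2pi z) (exp2pi \<tau>) = 0 \<or> qpoch (exp2pi \<tau> / exp2pi z) (exp2pi \<tau>) = 0"
      using assms(2) by (simp add: theta_def)
    then have "(\<exists>n. exp2pi z * exp2pi \<tau> ^ n = 1) \<or> (\<exists>n. exp2pi \<tau> / exp2pi z * exp2pi \<tau> ^ n = 1)"
      by (simp add: qpoch_eq_0_iff q)
    then show ?thesis using that by (metis exp2pi_add exp2pi_diff exp2pi_power)
  qed
  then show ?thesis
  proof cases
    case 1
    then obtain m where "z + of_nat n * \<tau> = of_int m" using exp2pi_eq_1_iff by blast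
    then have "z = of_int m + of_int (- int n) * \<tau>" by (simp add: algebra_simps)
    then show ?thesis by blast
  next
    case 2
    then obtain m where "\<tau> - z + of_nat n * \<tau> = of_int m" using exp2pi_eq_1_iff by blast
    then have "z = of_int (- m) + of_int (int n + 1) * \<tau>" by (simp add: algebra_simps)
    then show ?thesis by blast
  qed
qed

lemma theta_holomorphic:
  assumes "f holomorphic_on S" "g holomorphic_on S" "open S" "\<And>t. t \<in> S \<Longrightarrow> Im (g t) > 0"
  shows "(\<lambda>t. theta (f t) (g t)) holomorphic_on S"
  unfolding theta_def
  using assms by (intro holomorphic_intros holomorphic_on_qpoch norm_exp2pi_less_1) auto

lemma theta_0 [simp]: "Im \<tau> > 0 \<Longrightarrow> theta 0 \<tau> = 0"
  using qpoch_rec[of "exp2pi \<tau>" 1] by (simp add: theta_def norm_exp2pi_less_1)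

text \<open>The factor \<open>1 - exp2pi z\<close> splits off, and the remaining product does not vanish at 0.\<close>
lemma theta_deriv_0:
  assumes "Im \<tau> > 0"
    shows "\<exists>c. c \<noteq> 0 \<and> ((\<lambda>z. theta z \<tau>) has_field_derivative c) (at 0)"
proof -
  let ?q = "exp2pi \<tau>"
  have q: "norm ?q < 1" using norm_exp2pi_less_1[OF assms] .
  define f where "f z = qpoch (exp2pi z * ?q) ?q * qpoch (?q / exp2pi z) ?q" for z
  have f: "f holomorphic_on UNIV"
    unfolding f_def using q by (intro holomorphic_intros holomorphic_on_qpoch) auto
  have f0: "f 0 \<noteq> 0" using qpoch_self_nonzero[OF q] by (simp add: f_def)
  have eq: "(\<lambda>z. theta z \<tau>) = (\<lambda>z. (1 - exp2pi z) * f z)"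
  proof
    show "theta z \<tau> = (1 - exp2pi z) * f z" for z
      using qpoch_rec[OF q, of "exp2pi z"] by (simp add: theta_def f_def)
  qed
  have "(f has_field_derivative deriv f 0) (at 0)"
    using f holomorphic_derivI open_UNIV by blast
  then have "((\<lambda>z. (1 - exp2pi z) * f z) has_field_derivative (- (2 * of_real pi * \<i>) * f 0)) (at 0)"
    unfolding exp2pi_def by (auto intro!: derivative_eq_intros)
  then show ?thesis using f0 unfolding eq by (intro exI[of _ "- (2 * of_real pi * \<i>) * f 0"]) auto
qed

lemma lattice_coordinates:
  assumes "Im \<tau> > 0" shows "\<exists>s t :: real. z = of_real s + of_real t * \<tau>"
proof -
  define t where "t = Im z / Im \<tau>"
  have "z = of_real (Re z - t * Re \<tau>) + of_real t * \<tau>"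
    using assms by (auto simp: complex_eq_iff t_def)
  then show ?thesis by blast
qed

lemma periodic_int:
  fixes f :: "complex \<Rightarrow> complex"
  assumes "\<And>z. f (z + w) = f z" shows "f (z + of_int n * w) = f z"
proof -
  have nat: "f (z + of_nat k * w) = f z" for k z
  proof (induction k)
    case (Suc k)
    have "f (z + of_nat (Suc k) * w) = f ((z + of_nat k * w) + w)" by (simp add: algebra_simps)
    also have "\<dots> = f z" by (simp only: assms Suc)
    finally show ?case .
  qed simp
  show ?thesis
  proof (cases "n \<ge> 0")
    case True
    then show ?thesis using nat[of z "nat n"] by simp
  next
    case False
    then show ?thesis using nat[of "z + of_int n * w" "nat (- n)"] by (simp add: algebra_simps)
  qed
qed

lemma doubly_periodic_continuous_bounded:
  fixes f :: "complex \<Rightarrow> complex"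
  assumes "Im \<tau> > 0" "continuous_on UNIV f" "\<And>z. f (z + 1) = f z" "\<And>z. f (z + \<tau>) = f z"
  shows "bounded (range f)"
proof -
  let ?Q = "(\<lambda>(s, t). of_real s + of_real t * \<tau>) ` ({0..1} \<times> {0..1})"
  have "compact ?Q"
    by (intro compact_continuous_image compact_Times compact_Icc)
      (auto simp: case_prod_unfold intro!: continuous_intros)
  then have "compact (f ` ?Q)"
    by (rule compact_continuous_image[OF continuous_on_subset[OF assms(2) subset_UNIV]])
  moreover have "range f \<subseteq> f ` ?Q"
  proof safe
    fix z
    obtain s t where z: "z = of_real s + of_real t * \<tau>" using lattice_coordinates[OF assms(1)] by blast
    define z' where "z' = of_real (frac s) + of_real (frac t) * \<tau>"
    have "z = (z' + of_int \<lfloor>s\<rfloor> * 1) + of_int \<lfloor>t\<rfloor> * \<tau>"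
      by (simp add: z z'_def frac_def algebra_simps)
    then have "f z = f z'" using periodic_int[of f, OF assms(3)] periodic_int[of f, OF assms(4)] by metis
    moreover have "z' \<in> ?Q" unfolding z'_def
      by (rule image_eqI[of _ _ "(frac s, frac t)"]) (auto simp: frac_ge_0 less_imp_le frac_lt_1)
    ultimately show "f z \<in> f ` ?Q" by blast
  qed
  ultimately show ?thesis using bounded_subset compact_imp_bounded by blast
qed

text \<open>The quotient \<open>F/G\<close> is doubly periodic.  It can be singular only at lattice points,
where it behaves as at 0; there \<open>F\<close> vanishes and \<open>G\<close> has a simple zero.  So \<open>F/G\<close> extends to a bounded
entire function, and Liouville's theorem applies.\<close>
lemma quasi_periodic_proportional:
  fixes F G m :: "complex \<Rightarrow> complex"
  assumes \<tau>: "Im \<tau> > 0"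
    and F: "F holomorphic_on UNIV" "\<And>z. F (z + 1) = F z" "\<And>z. F (z + \<tau>) = m z * F z" "F 0 = 0"
    and G: "G holomorphic_on UNIV" "\<And>z. G (z + 1) = G z" "\<And>z. G (z + \<tau>) = m z * G z" "G 0 = 0"
    and m: "\<And>z. m z \<noteq> 0"
    and zeros: "\<And>z. G z = 0 \<Longrightarrow> \<exists>k n. z = of_int k + of_int n * \<tau>"
    and deriv: "(G has_field_derivative c) (at 0)" "c \<noteq> 0"
  shows "\<exists>C. \<forall>z. F z = C * G z"
proof -
  define l where "l = deriv F 0 / c"
  \<comment> \<open>The value \<open>l\<close> is the limit at 0 of the quotient, by the quotient of the derivatives.\<close>
  define f where "f z = (if G z = 0 then l else F z / G z)" for z
  have per1: "f (z + 1) = f z" for z by (simp add: f_def F G)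
  have per\<tau>: "f (z + \<tau>) = f z" for z using m[of z] by (simp add: f_def F G)
  have opn: "open {z. G z \<noteq> 0}"
    using holomorphic_on_imp_continuous_on[OF G(1)] by (simp add: continuous_on_open_vimage open_Collect_neq)
  have hol_off: "f holomorphic_on {z. G z \<noteq> 0}"
  proof -
    have "(\<lambda>z. F z / G z) holomorphic_on {z. G z \<noteq> 0}"
      by (intro holomorphic_intros holomorphic_on_subset[OF F(1)] holomorphic_on_subset[OF G(1)]) auto
    then show ?thesis by (rule holomorphic_transform) (auto simp: f_def)
  qed
  have isol: "\<forall>\<^sub>F z in at z0. G z \<noteq> 0" for z0
  proof -
    have "\<exists>z. G z \<noteq> 0"
    proof (rule ccontr)
      assume "\<nexists>z. G z \<noteq> 0"
      then have "G = (\<lambda>_. 0)" by auto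
      then have "((\<lambda>_. 0) has_field_derivative c) (at 0)" using deriv(1) by simp
      then have "c = 0" by (rule DERIV_unique) (rule DERIV_const)
      with deriv(2) show False by simp
    qed
    then obtain z1 where z1: "G z1 \<noteq> 0" by blast
    show ?thesis
      using non_zero_neighbour_alt[OF G(1) open_UNIV connected_UNIV UNIV_I UNIV_I z1]
      by (rule eventually_mono) simp
  qed
  have lim0: "f \<midarrow>0\<rightarrow> l"
  proof -
    have "(F has_field_derivative deriv F 0) (at 0)" using F(1) holomorphic_derivI open_UNIV by blast
    then have "(\<lambda>z. F z / z) \<midarrow>0\<rightarrow> deriv F 0" using F(4) by (simp add: has_field_derivative_iff)
    moreover have "(\<lambda>z. G z / z) \<midarrow>0\<rightarrow> c" using deriv(1) G(4)
      by (simp add: has_field_derivative_iff)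
    ultimately have "(\<lambda>z. (F z / z) / (G z / z)) \<midarrow>0\<rightarrow> l"
      unfolding l_def using deriv(2) by (intro tendsto_intros)
    moreover have "\<forall>\<^sub>F z in at 0. (F z / z) / (G z / z) = f z"
      using isol[of 0] eventually_neq_at_within[of 0 0] 
      by eventually_elim (simp add: f_def)
    ultimately show ?thesis using Lim_transform_eventually by blast
  qed
  have cont: "isCont f z0" for z0
  proof (cases "G z0 = 0")
    case False
    then show ?thesis 
      using continuous_on_eq_continuous_at[OF opn, of f] holomorphic_on_imp_continuous_on[OF hol_off] by blast
  next
    case True
    obtain k n where z0: "z0 = of_int k + of_int n * \<tau>" using zeros[OF True] by blast
    have "(\<lambda>h. f (z0 + h)) = f"
    proof
      fix h
      have "z0 + h = (h + of_int k * 1) + of_int n * \<tau>" by (simp add: z0)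
      then show "f (z0 + h) = f h" using periodic_int[of f, OF per1] periodic_int[of f, OF per\<tau>] by metis
    qed
    then have "(\<lambda>h. f (z0 + h)) \<midarrow>0\<rightarrow> f z0" using lim0 True by (simp add: f_def)
    then show ?thesis by (simp add: isCont_iff)
  qed
  have "f holomorphic_on UNIV"
  proof -
    have "f analytic_on {z0}" for z0
    proof -
      obtain r where r: "r > 0" "\<And>z. z \<noteq> z0 \<Longrightarrow> dist z z0 < r \<Longrightarrow> G z \<noteq> 0"
        using isol[of z0] unfolding eventually_at by auto
      have "f holomorphic_on ball z0 r"
      proof (rule no_isolated_singularity)
        show "continuous_on (ball z0 r) f" using cont continuous_at_imp_continuous_on by blast
        show "f holomorphic_on ball z0 r - {z0}"
          by (rule holomorphic_on_subset[OF hol_off]) (use r in \<open>auto simp: dist_commute\<close>)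
      qed auto
      then show ?thesis using r(1) analytic_at_ball by blast
    qed
    then show ?thesis by (meson analytic_imp_holomorphic analytic_on_analytic_at)
  qed
  moreover have "bounded (range f)"
    using cont continuous_at_imp_continuous_on
    by (intro doubly_periodic_continuous_bounded[OF \<tau> _ per1 per\<tau>]) blast
  ultimately obtain C where C: "\<And>z. f z = C" using Liouville_theorem unfolding constant_on_def by blast
  have F0: "F z = 0" if G0: "G z = 0" for z
  proof -
    obtain k n where z: "z = of_int k + of_int n * \<tau>" using zeros[OF G0] by blast
    \<comment> \<open>The zero set of \<open>F\<close> is invariant under the lattice; this is periodicity of its indicator function.\<close>
    define g where "g z = (if F z = 0 then 1 else (0::complex))" for z
    have "g (z + 1) = g z" "g (z + \<tau>) = g z" for z using m[of z] by (simp_all add: g_def F)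
    then have "g ((0 + of_int k * 1) + of_int n * \<tau>) = g 0" using periodic_int[of g] by metis
    then show ?thesis by (simp add: z g_def F split: if_splits)
  qed
  have "F z = C * G z" for z
    using C[of z] F0[of z] by (cases "G z = 0") (auto simp: f_def)
  then show ?thesis by blast
qed

text \<open>The quadratic exponential turns the quasi-periods of \<open>\<lambda>z. theta (z / \<tau>) (- 1 / \<tau>)\<close> with respect to
1 and \<open>\<tau>\<close> into those of \<open>\<lambda>z. theta z \<tau>\<close>.\<close>
lemma theta_inversion:
  assumes \<tau>: "Im \<tau> > 0"
  shows "\<exists>C. \<forall>z. theta (z / \<tau>) (- 1 / \<tau>)
    = C * exp (of_real pi * \<i> * (z\<^sup>2 / \<tau> + z / \<tau> - z)) * theta z \<tau>"
proof -
  define \<tau>' where "\<tau>' = - 1 / \<tau>"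
  have [simp]: "\<tau> \<noteq> 0" using \<tau> by auto
  have \<tau>': "Im \<tau>' > 0" unfolding \<tau>'_def using \<tau>
    by (simp add: Im_divide) (auto intro!: divide_pos_pos add_nonneg_pos)
  define e where "e z = exp (of_real pi * \<i> * (z\<^sup>2 / \<tau> + z / \<tau> - z))" for z
  have [simp]: "e z \<noteq> 0" for z by (simp add: e_def)
  define R where "R z = theta (z / \<tau>) \<tau>' / e z" for z
  have hol: "R holomorphic_on UNIV" unfolding R_def e_def
    using \<tau>' by (intro holomorphic_intros theta_holomorphic) auto
  have e1: "e (z + 1) = - exp2pi ((z + 1) / \<tau>) * e z" for z
  proof -
    have "(z + 1)\<^sup>2 / \<tau> + (z + 1) / \<tau> - (z + 1) = 2 * ((z + 1) / \<tau>) + (z\<^sup>2 / \<tau> + z / \<tau> - z) - 1"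
      by (simp add: power2_sum add_divide_distrib)
    then have "e (z + 1) = exp (2 * of_real pi * \<i> * ((z + 1) / \<tau>) + of_real pi * \<i> * (z\<^sup>2 / \<tau> + z / \<tau> - z) - of_real pi * \<i>)"
      unfolding e_def by (simp only: ring_distribs mult.assoc mult.left_commute mult_1_right)
    then show ?thesis by (simp add: e_def exp_add exp_diff exp2pi_def)
  qed
  have e\<tau>: "e (z + \<tau>) = - exp2pi z * e z" for z
  proof -
    have "(z + \<tau>)\<^sup>2 / \<tau> + (z + \<tau>) / \<tau> - (z + \<tau>) = 2 * z + (z\<^sup>2 / \<tau> + z / \<tau> - z) + 1"
      unfolding power2_sum add_divide_distrib by (simp add: power2_eq_square[of \<tau>])
    then have "e (z + \<tau>) = exp (2 * of_real pi * \<i> * z + of_real pi * \<i> * (z\<^sup>2 / \<tau> + z / \<tau> - z) + of_real pi * \<i>)"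
      unfolding e_def by (simp only: ring_distribs mult.assoc mult.left_commute mult_1_right)
    then show ?thesis by (simp add: e_def exp_add exp2pi_def)
  qed
  have per1: "R (z + 1) = R z" for z
  proof -
    have "theta ((z + 1) / \<tau> + \<tau>') \<tau>' = - theta ((z + 1) / \<tau>) \<tau>' / exp2pi ((z + 1) / \<tau>)"
      by (rule theta_add_tau[OF \<tau>'])
    moreover have "(z + 1) / \<tau> + \<tau>' = z / \<tau>" by (simp add: \<tau>'_def field_simps)
    ultimately have "theta (z / \<tau>) \<tau>' = - theta ((z + 1) / \<tau>) \<tau>' / exp2pi ((z + 1) / \<tau>)"
      by simp
    then show ?thesis by (simp add: R_def e1)
  qed
  have per\<tau>: "R (z + \<tau>) = - inverse (exp2pi z) * R z" for z
  proof -
    have "(z + \<tau>) / \<tau> = z / \<tau> + 1" by (simp add: add_divide_distrib)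
    then show ?thesis by (simp add: R_def e\<tau> theta_add_1 divide_inverse)
  qed
  obtain c where c: "c \<noteq> 0" "((\<lambda>z. theta z \<tau>) has_field_derivative c) (at 0)"
    using theta_deriv_0[OF \<tau>] by blast
  have "\<exists>C. \<forall>z. R z = C * theta z \<tau>"
  proof (rule quasi_periodic_proportional[OF \<tau> hol per1 per\<tau>])
    show "R 0 = 0" using \<tau>' by (simp add: R_def)
    show "(\<lambda>z. theta z \<tau>) holomorphic_on UNIV" using \<tau> by (intro theta_holomorphic holomorphic_intros) auto
    show "theta (z + \<tau>) \<tau> = - inverse (exp2pi z) * theta z \<tau>" for z
      by (simp add: theta_add_tau[OF \<tau>] divide_inverse)
    show "theta z \<tau> = 0 \<Longrightarrow> \<exists>k n. z = of_int k + of_int n * \<tau>" for z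
      by (rule theta_eq_0D[OF \<tau>])
    show "((\<lambda>z. theta z \<tau>) has_field_derivative c) (at 0)" "c \<noteq> 0" by fact+
  qed (simp_all add: \<tau> theta_add_1)
  then obtain C where C: "\<And>z. R z = C * theta z \<tau>" by blast
  have "theta (z / \<tau>) \<tau>' = C * e z * theta z \<tau>" for z
    using C[of z] by (simp add: R_def field_simps)
  then show ?thesis unfolding \<tau>'_def e_def by blast
qed

lemma theta_minus:
  assumes "Im \<tau> > 0" shows "theta (- z) \<tau> = - theta z \<tau> / exp2pi z"
proof -
  let ?q = "exp2pi \<tau>" and ?w = "exp2pi z"
  have q: "norm ?q < 1" using norm_exp2pi_less_1[OF assms] .
  have "theta (- z) \<tau> = ((1 - 1 / ?w) * qpoch (?q / ?w) ?q) * qpoch (?w * ?q) ?q"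
    using qpoch_rec[OF q, of "1 / ?w"] by (simp add: theta_def exp2pi_minus divide_inverse mult.commute)
  also have "\<dots> = - (((1 - ?w) * qpoch (?w * ?q) ?q) * qpoch (?q / ?w) ?q) / ?w"
    by (simp add: field_simps)
  also have "(1 - ?w) * qpoch (?w * ?q) ?q = qpoch ?w ?q" using qpoch_rec[OF q, of ?w] by simp
  finally show ?thesis by (simp add: theta_def)
qed

section \<open>Siegel functions with complex parameters\<close>

text \<open>The Siegel function with complex instead of rational parameters.  In this generality the
transformation rules are identities between entire functions of the parameters.\<close>
definition csiegel :: "complex \<Rightarrow> complex \<Rightarrow> complex \<Rightarrow> complex" where
  "csiegel a b \<tau> = - exp2pi ((\<tau> * (a\<^sup>2 - a + 1 / 6) + b * (a - 1)) / 2) * theta (a * \<tau> + b) \<tau>"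

lemma siegel_eq_csiegel:
  assumes "Im \<tau> > 0" shows "siegel a \<tau> = csiegel (of_rat (a $ 1)) (of_rat (a $ 2)) \<tau>"
proof -
  define x y where "x = complex_of_rat (a $ 1)" and "y = complex_of_rat (a $ 2)"
  have q: "norm (exp2pi \<tau>) < 1" using norm_exp2pi_less_1[OF assms] .
  have f1: "q_pow (of_nat n + a $ 1) \<tau> * e2pi (a $ 2) = exp2pi (x * \<tau> + y) * exp2pi \<tau> ^ n" for n
    unfolding q_pow_def e2pi_def exp2pi_power exp2pi_add[symmetric] mult_exp_exp
    by (simp add: exp2pi_def x_def y_def of_rat_add algebra_simps)
  have f2: "q_pow (of_nat n + 1 - a $ 1) \<tau> * e2pi (- (a $ 2)) = exp2pi \<tau> / exp2pi (x * \<tau> + y) * exp2pi \<tau> ^ n" for n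
    unfolding q_pow_def e2pi_def exp2pi_power exp2pi_add[symmetric] exp2pi_diff[symmetric] mult_exp_exp
    by (simp add: exp2pi_def x_def y_def of_rat_add of_rat_diff of_rat_minus algebra_simps)
  have "siegel a \<tau> = - (q_pow (bernpoly2 (a $ 1) / 2) \<tau> * exp (of_real pi * \<i> * of_rat (a $ 2 * (a $ 1 - 1)))) *
     (\<Prod>n. (1 - exp2pi (x * \<tau> + y) * exp2pi \<tau> ^ n) * (1 - exp2pi \<tau> / exp2pi (x * \<tau> + y) * exp2pi \<tau> ^ n))"
    using assms by (simp add: siegel_def upper_half_plane_def f1 f2)
  also have "(\<Prod>n. (1 - exp2pi (x * \<tau> + y) * exp2pi \<tau> ^ n) * (1 - exp2pi \<tau> / exp2pi (x * \<tau> + y) * exp2pi \<tau> ^ n)) = theta (x * \<tau> + y) \<tau>"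
    unfolding theta_def qpoch_def
    by (rule prodinf_mult[symmetric]) (rule convergent_qpoch[OF q])+
  also have "q_pow (bernpoly2 (a $ 1) / 2) \<tau> * exp (of_real pi * \<i> * of_rat (a $ 2 * (a $ 1 - 1)))
      = exp2pi ((\<tau> * (x\<^sup>2 - x + 1 / 6) + y * (x - 1)) / 2)"
    unfolding q_pow_def mult_exp_exp exp2pi_def
    by (rule arg_cong[of _ _ exp]) (simp add: x_def y_def bernpoly2_def of_rat_add of_rat_diff of_rat_mult of_rat_power of_rat_divide field_simps)
  finally show ?thesis by (simp add: csiegel_def x_def y_def)
qed

lemma exp2pi_half: "exp2pi (1 / 2) = - 1"
  by (simp add: exp2pi_def)

lemma csiegel_minus:
  assumes "Im \<tau> > 0" shows "csiegel (- a) (- b) \<tau> = - csiegel a b \<tau>"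
proof -
  have "exp2pi ((\<tau> * ((- a)\<^sup>2 - - a + 1 / 6) + - b * (- a - 1)) / 2)
     = exp2pi ((\<tau> * (a\<^sup>2 - a + 1 / 6) + b * (a - 1)) / 2) * exp2pi (a * \<tau> + b)"
    unfolding exp2pi_add[symmetric] by (rule arg_cong[of _ _ exp2pi]) (simp add: field_simps)
  then show ?thesis using theta_minus[OF assms, of "a * \<tau> + b"] by (simp add: csiegel_def)
qed

lemma csiegel_translate:
  "csiegel a b (\<tau> + of_int k) = exp2pi (of_int k / 12) * csiegel a (of_int k * a + b) \<tau>"
proof -
  have "theta z (\<tau> + of_int k) = theta z \<tau>" for z by (simp add: theta_def exp2pi_add)
  moreover have "exp2pi (((\<tau> + of_int k) * (a\<^sup>2 - a + 1 / 6) + b * (a - 1)) / 2)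
     = exp2pi (of_int k / 12) * exp2pi ((\<tau> * (a\<^sup>2 - a + 1 / 6) + (of_int k * a + b) * (a - 1)) / 2)"
    unfolding exp2pi_add[symmetric] by (rule arg_cong[of _ _ exp2pi]) (simp add: field_simps power2_eq_square)
  ultimately show ?thesis by (simp add: csiegel_def algebra_simps)
qed

lemma csiegel_add_1_right: "csiegel a (b + 1) \<tau> = - exp2pi (a / 2) * csiegel a b \<tau>"
proof -
  have "exp2pi ((\<tau> * (a\<^sup>2 - a + 1 / 6) + (b + 1) * (a - 1)) / 2)
     = exp2pi ((\<tau> * (a\<^sup>2 - a + 1 / 6) + b * (a - 1)) / 2) * exp2pi (a / 2) / exp2pi (1 / 2)"
    unfolding exp2pi_add[symmetric] exp2pi_diff[symmetric] by (rule arg_cong[of _ _ exp2pi]) (simp add: field_simps)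
  then show ?thesis using theta_add_1[of "a * \<tau> + b" \<tau>] by (simp add: csiegel_def exp2pi_half add_ac)
qed

lemma csiegel_add_1_left:
  assumes "Im \<tau> > 0" shows "csiegel (a + 1) b \<tau> = - exp2pi (- b / 2) * csiegel a b \<tau>"
proof -
  have "exp2pi ((\<tau> * ((a + 1)\<^sup>2 - (a + 1) + 1 / 6) + b * (a + 1 - 1)) / 2)
     = exp2pi ((\<tau> * (a\<^sup>2 - a + 1 / 6) + b * (a - 1)) / 2) * exp2pi (- b / 2) * exp2pi (a * \<tau> + b)"
    unfolding exp2pi_add[symmetric] by (rule arg_cong[of _ _ exp2pi]) (simp add: field_simps power2_eq_square)
  then show ?thesis using theta_add_tau[OF assms, of "a * \<tau> + b"] by (simp add: csiegel_def algebra_simps)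
qed

text \<open>The parameters are the nonzero points of order 2.  By Euler's identity the product is constant in
\<open>\<tau>\<close>; this takes the place of the transformation formula of \<open>\<eta>\<close> when the constant in the inversion formula is
determined.\<close>
lemma csiegel_torsion_product:
  assumes "Im \<tau> > 0"
  shows "csiegel (1/2) 0 \<tau> * csiegel 0 (1/2) \<tau> * csiegel (1/2) (1/2) \<tau> = 2 * exp2pi (1 / 8)"
proof -
  define y where "y = exp2pi (\<tau> / 2)"
  have q: "exp2pi \<tau> = y\<^sup>2" by (simp add: y_def exp2pi_power)
  have q1: "norm (y\<^sup>2) < 1" using norm_exp2pi_less_1[OF assms] by (simp add: q)
  have [simp]: "y \<noteq> 0" by (simp add: y_def)
  have "theta (\<tau> / 2) \<tau> = (qpoch y (y\<^sup>2))\<^sup>2"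
    by (simp add: theta_def q flip: y_def) (simp add: power2_eq_square)
  moreover have "theta (1/2) \<tau> = 2 * (qpoch (- (y\<^sup>2)) (y\<^sup>2))\<^sup>2"
    using qpoch_rec[OF q1, of "-1"] by (simp add: theta_def q exp2pi_half power2_eq_square)
  moreover have "theta (\<tau> / 2 + 1/2) \<tau> = (qpoch (- y) (y\<^sup>2))\<^sup>2"
    by (simp add: theta_def q exp2pi_add exp2pi_half flip: y_def) (simp add: power2_eq_square)
  moreover have "qpoch y (y\<^sup>2) * qpoch (- (y\<^sup>2)) (y\<^sup>2) * qpoch (- y) (y\<^sup>2) = 1"
  proof -
    have "qpoch y (y\<^sup>2) * qpoch (- y) (y\<^sup>2) * qpoch (- (y\<^sup>2)) (y\<^sup>2) = 1"
      unfolding qpoch_mult_uminus[OF q1, of y] by (rule euler_qpoch[OF q1])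
    then show ?thesis by (simp only: mult_ac)
  qed
  ultimately have th: "theta (\<tau> / 2) \<tau> * theta (1/2) \<tau> * theta (\<tau> / 2 + 1/2) \<tau> = 2"
  proof -
    assume th: "theta (\<tau> / 2) \<tau> = (qpoch y (y\<^sup>2))\<^sup>2" "theta (1/2) \<tau> = 2 * (qpoch (- (y\<^sup>2)) (y\<^sup>2))\<^sup>2"
      "theta (\<tau> / 2 + 1/2) \<tau> = (qpoch (- y) (y\<^sup>2))\<^sup>2"
      and one: "qpoch y (y\<^sup>2) * qpoch (- (y\<^sup>2)) (y\<^sup>2) * qpoch (- y) (y\<^sup>2) = 1"
    have "theta (\<tau> / 2) \<tau> * theta (1/2) \<tau> * theta (\<tau> / 2 + 1/2) \<tau>
        = 2 * (qpoch y (y\<^sup>2) * qpoch (- (y\<^sup>2)) (y\<^sup>2) * qpoch (- y) (y\<^sup>2))\<^sup>2"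
      unfolding th power_mult_distrib by (simp only: mult_ac)
    then show ?thesis by (simp only: one power_one mult_1_right)
  qed
  define e where "e a b = exp2pi ((\<tau> * (a\<^sup>2 - a + 1 / 6) + b * (a - 1)) / 2)" for a b :: complex
  have "- (e (1/2) 0 * e 0 (1/2) * e (1/2) (1/2)) = exp2pi (1/8)"
  proof -
    have "- (e (1/2) 0 * e 0 (1/2) * e (1/2) (1/2)) = exp2pi (1/2) * (e (1/2) 0 * e 0 (1/2) * e (1/2) (1/2))"
      by (simp add: exp2pi_half)
    also have "\<dots> = exp2pi (1/8)" unfolding e_def exp2pi_add[symmetric]
      by (rule arg_cong[of _ _ exp2pi]) (simp add: field_simps power2_eq_square)
    finally show ?thesis .
  qed
  moreover have "csiegel (1/2) 0 \<tau> * csiegel 0 (1/2) \<tau> * csiegel (1/2) (1/2) \<tau> = 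
     - (e (1/2) 0 * e 0 (1/2) * e (1/2) (1/2)) * (theta (\<tau> / 2) \<tau> * theta (1/2) \<tau> * theta (\<tau> / 2 + 1/2) \<tau>)"
    by (simp add: csiegel_def e_def)
  ultimately show ?thesis by (simp add: th)
qed

lemma Im_neg_inverse_pos: "Im \<tau> > 0 \<Longrightarrow> Im (- 1 / \<tau>) > 0"
  by (simp add: Im_divide) (auto intro!: divide_pos_pos add_nonneg_pos)

text \<open>Completing the square in \<open>theta_inversion\<close> leaves a factor \<open>C\<close> that depends on \<open>\<tau>\<close> but not on the
parameters.  The inversion permutes the three points of order 2 up to integers, so comparing the two
values of \<open>csiegel_torsion_product\<close> gives \<open>C ^ 3 = \<i>\<close>.\<close>
lemma csiegel_inversion:
  assumes \<tau>: "Im \<tau> > 0"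
  shows "\<exists>C. C ^ 12 = 1 \<and> (\<forall>a b. csiegel a b (- 1 / \<tau>) = C * csiegel b (- a) \<tau>)"
proof -
  have [simp]: "\<tau> \<noteq> 0" using \<tau> by auto
  obtain C1 where C1: "\<And>z. theta (z / \<tau>) (- 1 / \<tau>) = C1 * exp (of_real pi * \<i> * (z\<^sup>2 / \<tau> + z / \<tau> - z)) * theta z \<tau>"
    using theta_inversion[OF \<tau>] by blast
  define C where "C = C1 * exp2pi ((- 1 / (6 * \<tau>) - \<tau> / 6) / 2)"
  have inv: "csiegel a b (- 1 / \<tau>) = C * csiegel b (- a) \<tau>" for a b
  proof -
    define z where "z = b * \<tau> - a"
    have z: "a * (- 1 / \<tau>) + b = z / \<tau>" by (simp add: z_def field_simps)
    have "exp2pi ((- 1 / \<tau> * (a\<^sup>2 - a + 1 / 6) + b * (a - 1)) / 2) * exp (of_real pi * \<i> * (z\<^sup>2 / \<tau> + z / \<tau> - z))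
       = exp2pi ((- 1 / \<tau> * (a\<^sup>2 - a + 1 / 6) + b * (a - 1)) / 2) * exp2pi ((z\<^sup>2 / \<tau> + z / \<tau> - z) / 2)"
      by (simp add: exp2pi_def mult.assoc)
    also have "\<dots> = exp2pi ((- 1 / (6 * \<tau>) - \<tau> / 6) / 2) * exp2pi ((\<tau> * (b\<^sup>2 - b + 1 / 6) + - a * (b - 1)) / 2)"
    proof -
      have eq: "z\<^sup>2 / \<tau> + z / \<tau> - z = b\<^sup>2 * \<tau> - 2 * a * b + a\<^sup>2 / \<tau> + b - a / \<tau> - b * \<tau> + a"
        by (simp add: z_def field_simps power2_eq_square)
      show ?thesis unfolding exp2pi_add[symmetric] eq
        by (intro arg_cong[of _ _ exp2pi]) (simp add: field_simps)
    qed
    finally show ?thesis using C1[of z] unfolding csiegel_def z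
      by (simp add: C_def z_def)
  qed
  have \<tau>': "Im (- 1 / \<tau>) > 0" using Im_neg_inverse_pos[OF \<tau>] .
  have "2 * exp2pi (1 / 8) = csiegel (1/2) 0 (- 1 / \<tau>) * csiegel 0 (1/2) (- 1 / \<tau>) * csiegel (1/2) (1/2) (- 1 / \<tau>)"
    by (rule csiegel_torsion_product[OF \<tau>', symmetric])
  also have "\<dots> = C ^ 3 * (csiegel 0 (- 1/2) \<tau> * csiegel (1/2) 0 \<tau> * csiegel (1/2) (- 1/2) \<tau>)"
    unfolding inv by (simp add: power3_eq_cube)
  also have "csiegel 0 (- 1/2) \<tau> = - csiegel 0 (1/2) \<tau>" using csiegel_add_1_right[of 0 "- 1/2" \<tau>] by simp
  also have "csiegel (1/2) (- 1/2) \<tau> = - inverse (exp2pi (1/4)) * csiegel (1/2) (1/2) \<tau>"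
    using csiegel_add_1_right[of "1/2" "- 1/2" \<tau>] by (simp add: field_simps)
  also have "C ^ 3 * (- csiegel 0 (1/2) \<tau> * csiegel (1/2) 0 \<tau> * (- inverse (exp2pi (1/4)) * csiegel (1/2) (1/2) \<tau>))
    = C ^ 3 * inverse (exp2pi (1/4)) * (csiegel (1/2) 0 \<tau> * csiegel 0 (1/2) \<tau> * csiegel (1/2) (1/2) \<tau>)"
    by simp
  also note csiegel_torsion_product[OF \<tau>]
  finally have "C ^ 3 = exp2pi (1/4)" by (simp add: field_simps)
  then have "(C ^ 3) ^ 4 = 1" by (simp add: exp2pi_power)
  then have "C ^ 12 = 1" by (simp add: power_mult[symmetric])
  with inv show ?thesis by blast
qed

lemma moebius_entries_Im:
  fixes a b c d :: int
  assumes \<tau>: "Im \<tau> > 0" and det: "a * d - b * c = 1"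
  shows "of_int c * \<tau> + of_int d \<noteq> 0" "Im ((of_int a * \<tau> + of_int b) / (of_int c * \<tau> + of_int d)) > 0"
proof -
  show nz: "of_int c * \<tau> + of_int d \<noteq> 0"
  proof
    assume 0: "of_int c * \<tau> + of_int d = 0"
    then have "of_int c * Im \<tau> = 0" by (auto simp: complex_eq_iff)
    then have "c = 0" using \<tau> by simp
    then show False using 0 det by auto
  qed
  have "Im ((of_int a * \<tau> + of_int b) / (of_int c * \<tau> + of_int d))
      = of_int (a * d - b * c) * Im \<tau> / (norm (of_int c * \<tau> + of_int d))\<^sup>2"
    unfolding cmod_power2 Im_divide by (simp add: algebra_simps)
  also have "\<dots> > 0" using \<tau> nz by (simp add: det)
  finally show "Im ((of_int a * \<tau> + of_int b) / (of_int c * \<tau> + of_int d)) > 0" .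
qed

text \<open>Euclid's algorithm on the first column writes the matrix as a word in translations and inversions.  The
constant is chosen for one \<open>\<tau>\<close> at a time; what matters is that it serves all parameters at once.\<close>
lemma csiegel_modular:
  fixes a b c d :: int
  assumes \<tau>: "Im \<tau> > 0" and det: "a * d - b * c = 1"
  shows "\<exists>C. C ^ 12 = 1 \<and> (\<forall>x y. csiegel x y ((of_int a * \<tau> + of_int b) / (of_int c * \<tau> + of_int d))
     = C * csiegel (x * of_int a + y * of_int c) (x * of_int b + y * of_int d) \<tau>)"
  using det
proof (induction "nat \<bar>c\<bar>" arbitrary: a b c d rule: less_induct)
  case less
  show ?case
  proof (cases "c = 0")
    case True
    then have "a = 1 \<and> d = 1 \<or> a = - 1 \<and> d = - 1" using less.prems by (simp add: zmult_eq_1_iff)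
    then show ?thesis
    proof
      assume ad: "a = 1 \<and> d = 1"
      have "(exp2pi (of_int b / 12)) ^ 12 = 1" by (simp add: exp2pi_power)
      moreover have "csiegel x y (\<tau> + of_int b) = exp2pi (of_int b / 12) * csiegel x (x * of_int b + y) \<tau>" for x y
        using csiegel_translate[of x y \<tau> b] by (simp only: mult.commute)
      ultimately show ?thesis using ad True by (intro exI[of _ "exp2pi (of_int b / 12)"]) simp
    next
      assume ad: "a = - 1 \<and> d = - 1"
      have m: "(of_int a * \<tau> + of_int b) / (of_int c * \<tau> + of_int d) = \<tau> + of_int (- b)"
        using ad True by simp
      define C where "C = exp2pi (of_int (- b) / 12)"
      have "C ^ 12 = 1" unfolding C_def exp2pi_power by (simp del: of_int_minus)
      then have "(- C) ^ 12 = 1" by simp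
      moreover have "csiegel x y (\<tau> + of_int (- b)) = (- C) * csiegel (x * of_int a + y * of_int c) (x * of_int b + y * of_int d) \<tau>" for x y
      proof -
        have "csiegel x y (\<tau> + of_int (- b)) = C * csiegel x (of_int (- b) * x + y) \<tau>"
          unfolding C_def by (rule csiegel_translate)
        also have "csiegel x (of_int (- b) * x + y) \<tau> = - csiegel (- x) (- (of_int (- b) * x + y)) \<tau>"
          by (simp only: csiegel_minus[OF \<tau>] minus_minus)
        also have "- (of_int (- b) * x + y) = x * of_int b + y * of_int d"
          using ad by (simp add: algebra_simps)
        also have "- x = x * of_int a + y * of_int c" using ad True by simp
        finally show ?thesis by simp
      qed
      ultimately show ?thesis unfolding m by blast
    qed
  next
    case False
    \<comment> \<open>A translation by \<open>k\<close> reduces \<open>a\<close> modulo \<open>c\<close>; the inversion then moves the remainder to the lower left corner.\<close>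
    define k where "k = a div c"
    define a' b' where "a' = a mod c" and "b' = b - k * d"
    have a': "a = a' + k * c" by (simp add: a'_def k_def)
    have b: "b = b' + k * d" by (simp add: b'_def)
    have det': "(- c) * b' - (- d) * a' = 1" using less.prems unfolding a' b by (simp add: algebra_simps)
    have "nat \<bar>a'\<bar> < nat \<bar>c\<bar>" using False by (simp add: a'_def abs_mod_less)
    note IH = less.hyps[OF this det']
    define w where "w = (of_int (- c) * \<tau> + of_int (- d)) / (of_int a' * \<tau> + of_int b')"
    have w: "Im w > 0" "of_int a' * \<tau> + of_int b' \<noteq> 0"
      unfolding w_def using moebius_entries_Im[OF \<tau> det'] by auto
    have nz: "of_int c * \<tau> + of_int d \<noteq> 0" using moebius_entries_Im[OF \<tau> less.prems] by simp
    have eq: "(of_int a * \<tau> + of_int b) / (of_int c * \<tau> + of_int d) = - 1 / w + of_int k"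
    proof -
      define D N where "D = of_int c * \<tau> + of_int d" and "N = of_int a' * \<tau> + of_int b'"
      have "w = - D / N" by (simp add: w_def D_def N_def)
      then have "- 1 / w = N / D" by simp
      moreover have "of_int a * \<tau> + of_int b = N + of_int k * D"
        by (simp add: a' b algebra_simps D_def N_def)
      ultimately show ?thesis using nz unfolding D_def[symmetric]
        by (simp add: add_divide_distrib)
    qed
    obtain C1 where C1: "C1 ^ 12 = 1" "\<And>x y. csiegel x y (- 1 / w) = C1 * csiegel y (- x) w"
      using csiegel_inversion[OF w(1)] by blast
    obtain C2 where C2: "C2 ^ 12 = 1"
      "\<And>x y. csiegel x y w = C2 * csiegel (x * of_int (- c) + y * of_int a') (x * of_int (- d) + y * of_int b') \<tau>"
      using IH unfolding w_def by blast
    define C where "C = - (exp2pi (of_int k / 12) * C1 * C2)"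
    have "C ^ 12 = 1" unfolding C_def by (simp add: power_mult_distrib C1 C2 exp2pi_power)
    moreover have "csiegel x y (- 1 / w + of_int k) = C * csiegel (x * of_int a + y * of_int c) (x * of_int b + y * of_int d) \<tau>" for x y
    proof -
      define y' where "y' = of_int k * x + y"
      have "csiegel x y (- 1 / w + of_int k) = exp2pi (of_int k / 12) * C1 * C2 *
         csiegel (y' * of_int (- c) + (- x) * of_int a') (y' * of_int (- d) + (- x) * of_int b') \<tau>"
        unfolding csiegel_translate C1 C2 y'_def by simp
      also have "y' * of_int (- c) + (- x) * of_int a' = - (x * of_int a + y * of_int c)"
        by (simp add: y'_def a' algebra_simps)
      also have "y' * of_int (- d) + (- x) * of_int b' = - (x * of_int b + y * of_int d)"
        by (simp add: y'_def b algebra_simps)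
      finally show ?thesis unfolding csiegel_minus[OF \<tau>] C_def by simp
    qed
    ultimately show ?thesis unfolding eq by blast
  qed
qed

text \<open>Squaring removes the sign \<open>(-1)\<close> to the power \<open>mn + m + n\<close>.\<close>
lemma csiegel_square_add_int:
  assumes "Im \<tau> > 0"
  shows "(csiegel (a + of_int m) (b + of_int n) \<tau>)\<^sup>2 = exp2pi (a * of_int n - b * of_int m) * (csiegel a b \<tau>)\<^sup>2"
proof -
  have r: "(csiegel a (b + of_int n) \<tau>)\<^sup>2 = exp2pi (of_int n * a) * (csiegel a b \<tau>)\<^sup>2" for a b
  proof -
    have "csiegel a (z + 1) \<tau> ^ 2 / exp2pi (a * (z + 1)) = csiegel a z \<tau> ^ 2 / exp2pi (a * z)" for z
      by (simp add: csiegel_add_1_right power_mult_distrib exp2pi_power exp2pi_add ring_distribs)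
    from periodic_int[of "\<lambda>z. csiegel a z \<tau> ^ 2 / exp2pi (a * z)" 1, OF this, of b n]
    show ?thesis by (simp add: ring_distribs exp2pi_add field_simps)
  qed
  have l: "(csiegel (a + of_int m) b \<tau>)\<^sup>2 = exp2pi (- of_int m * b) * (csiegel a b \<tau>)\<^sup>2" for a b
  proof -
    have "csiegel (z + 1) b \<tau> ^ 2 * exp2pi (b * (z + 1)) = csiegel z b \<tau> ^ 2 * exp2pi (b * z)" for z
    proof -
      have "(- exp2pi (- b / 2))\<^sup>2 = inverse (exp2pi b)" by (simp add: exp2pi_power exp2pi_minus[symmetric])
      then show ?thesis
        unfolding csiegel_add_1_left[OF assms] power_mult_distrib by (simp add: exp2pi_add ring_distribs)
    qed
    from periodic_int[of "\<lambda>z. csiegel z b \<tau> ^ 2 * exp2pi (b * z)" 1, OF this, of a m]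
    show ?thesis by (simp add: ring_distribs exp2pi_add exp2pi_minus field_simps)
  qed
  have "exp2pi (of_int n * (a + of_int m)) = exp2pi (of_int n * a)"
    using exp2pi_of_int[of "n * m"] by (simp add: ring_distribs exp2pi_add)
  then show ?thesis unfolding r l by (simp add: exp2pi_diff exp2pi_minus field_simps)
qed

section \<open>Two-dimensional linear algebra over the prime field\<close>

definition mat2 :: "'a::zero \<Rightarrow> 'a \<Rightarrow> 'a \<Rightarrow> 'a \<Rightarrow> 'a^2^2" where
  "mat2 a b c d = vector [vector [a, b], vector [c, d]]"

lemma mat2_nth [simp]: "mat2 a b c d $ 1 $ 1 = a" "mat2 a b c d $ 1 $ 2 = b"
   "mat2 a b c d $ 2 $ 1 = c" "mat2 a b c d $ 2 $ 2 = d"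
  by (simp_all add: mat2_def)

lemma mat2_eqI: 
  fixes A B :: "'a^2^2"
  assumes "A $ 1 $ 1 = B $ 1 $ 1" "A $ 1 $ 2 = B $ 1 $ 2" "A $ 2 $ 1 = B $ 2 $ 1" "A $ 2 $ 2 = B $ 2 $ 2" shows "A = B"
  using assms unfolding vec_eq_iff forall_2 by blast
lemma vec2_eqI: 
  fixes x y :: "'a^2"
  assumes "x $ 1 = y $ 1" "x $ 2 = y $ 2" shows "x = y"
  using assms unfolding vec_eq_iff forall_2 by blast

lemma vmult2 [simp]:
  fixes x :: "'a::comm_ring_1^2"
  shows "(x v* A) $ j = x $ 1 * A $ 1 $ j + x $ 2 * A $ 2 $ j"
  by (simp add: vector_matrix_mult_def sum_2 mult.commute)

lemma mmult2 [simp]: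
  fixes A B :: "'a::comm_ring_1^2^2"
  shows "(A ** B) $ i $ j = A $ i $ 1 * B $ 1 $ j + A $ i $ 2 * B $ 2 $ j"
  by (simp add: matrix_matrix_mult_def sum_2)

lemma conj_vec_nth [simp]: "conj_vec a $ 1 = a $ 1" "conj_vec a $ 2 = - (a $ 2)"
  by (simp_all add: conj_vec_def)

lemma conj_vec_conj_vec [simp]: "conj_vec (conj_vec a) = a"
  by (rule vec2_eqI) simp_all

lemma conj_vec_eq_vmult: "conj_vec a = a v* mat2 1 0 0 (- 1 :: 'a::comm_ring_1)"
  by (rule vec2_eqI) simp_all

definition wedge :: "'a::comm_ring_1^2 \<Rightarrow> 'a^2 \<Rightarrow> 'a" where
  "wedge x y = x $ 1 * y $ 2 - x $ 2 * y $ 1"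

lemma wedge_vmult: "wedge (x v* A) (y v* A) = det A * wedge x y"
  by (simp add: wedge_def det_2 algebra_simps)

lemma wedge_add_right: "wedge x (y + z) = wedge x y + wedge x z"
  by (simp add: wedge_def algebra_simps)

text \<open>Reduction modulo \<open>p\<close>, when the target is \<open>'p mod_ring\<close>.\<close>
definition red :: "int^2 \<Rightarrow> 'a::ring_1^2" where "red n = (\<chi> i. of_int (n $ i))"

lemma red_nth [simp]: "red n $ i = of_int (n $ i)" by (simp add: red_def)

lemma red_vmult: "red (n v* A) = red n v* (map_matrix of_int A :: 'a::comm_ring_1^2^2)"
  by (rule vec2_eqI) simp_all

lemma red_add: "red (m + n) = red m + red n"
  by (rule vec2_eqI) simp_all

lemma map_matrix_mult2:
  fixes A B :: "int^2^2"
  shows "map_matrix of_int (A ** B) = (map_matrix of_int A ** map_matrix of_int B :: 'a::comm_ring_1^2^2)"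
  by (rule mat2_eqI) simp_all

lemma det_map_matrix2: "det (map_matrix of_int A :: 'a::comm_ring_1^2^2) = of_int (det A)" 
  by (simp add: det_2)

lemma of_int_mod_ring_eq_0_iff: "of_int k = (0 :: 'p::prime_card mod_ring) \<longleftrightarrow> int CARD('p) dvd k"
  by (simp add: of_int_eq_0_iff_char_dvd)

lemma of_int_mod_ring_eq_iff: "of_int k = (of_int l :: 'p::prime_card mod_ring) \<longleftrightarrow> int CARD('p) dvd k - l"
  using of_int_mod_ring_eq_0_iff[of "k - l", where 'p='p] by simp

lemma of_int_to_int_mod_ring [simp]: "of_int (to_int_mod_ring x) = (x :: 'p::prime_card mod_ring)"
  by (metis of_int_mod_ring_to_int_mod_ring of_int_of_int_mod_ring)

definition lift_matrix :: "'p::prime_card mod_ring^2^2 \<Rightarrow> int^2^2" where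
  "lift_matrix \<sigma> = map_matrix to_int_mod_ring \<sigma>"

lemma map_matrix_lift_matrix [simp]: "map_matrix of_int (lift_matrix \<sigma>) = \<sigma>"
  by (rule mat2_eqI) (simp_all add: lift_matrix_def)

section \<open>Second moments and the lifting cocycle\<close>

text \<open>Equivalently, every quadratic form sums to zero over \<open>A\<close>.\<close>
definition second_moments_vanish :: "('p::prime_card mod_ring^2) set \<Rightarrow> bool" where
  "second_moments_vanish A \<longleftrightarrow> (\<forall>i j. (\<Sum>a\<in>A. a $ i * a $ j) = 0)"

text \<open>The summand is a quadratic form in \<open>a\<close>.\<close>
lemma second_moments_wedge:
  fixes A :: "('p::prime_card mod_ring^2) set" and X Y :: "'p mod_ring^2^2"
  assumes "second_moments_vanish A"
  shows "(\<Sum>a\<in>A. wedge (a v* X) (a v* Y)) = 0"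
proof -
  have m: "(\<Sum>a\<in>A. a $ i * a $ j) = 0" for i j using assms by (simp add: second_moments_vanish_def)
  have "(\<Sum>a\<in>A. wedge (a v* X) (a v* Y)) =
     (\<Sum>a\<in>A. (X$1$1 * Y$1$2 - X$1$2 * Y$1$1) * (a$1 * a$1) + (X$2$1 * Y$2$2 - X$2$2 * Y$2$1) * (a$2 * a$2)
       + (X$1$1 * Y$2$2 + X$2$1 * Y$1$2 - X$1$2 * Y$2$1 - X$2$2 * Y$1$1) * (a$1 * a$2))"
    by (intro sum.cong) (simp_all add: wedge_def algebra_simps)
  also have "\<dots> = 0" by (simp only: sum.distrib sum_distrib_left[symmetric] m mult_zero_right add_0)
  finally show ?thesis .
qed

lemma second_moments_vmult:
  fixes A :: "('p::prime_card mod_ring^2) set" and X :: "'p mod_ring^2^2"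
  assumes "second_moments_vanish A"
  shows "(\<Sum>a\<in>A. (a v* X) $ i * (a v* X) $ j) = 0"
proof -
  have m: "(\<Sum>a\<in>A. a $ i * a $ j) = 0" for i j using assms by (simp add: second_moments_vanish_def)
  have "(\<Sum>a\<in>A. (a v* X) $ i * (a v* X) $ j) = (\<Sum>a\<in>A. (X$1$i * X$1$j) * (a$1 * a$1) + (X$2$i * X$2$j) * (a$2 * a$2)
     + (X$1$i * X$2$j + X$2$i * X$1$j) * (a$1 * a$2))"
    by (intro sum.cong) (simp_all add: algebra_simps)
  also have "\<dots> = 0" by (simp only: sum.distrib sum_distrib_left[symmetric] m mult_zero_right add_0)
  finally show ?thesis .
qed

lemma second_moments_vanish_vmult:
  fixes A :: "('p::prime_card mod_ring^2) set" and X :: "'p mod_ring^2^2"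
  assumes "second_moments_vanish A" "inj_on (\<lambda>a. a v* X) A"
  shows "second_moments_vanish ((\<lambda>a. a v* X) ` A)"
proof -
  have "(\<Sum>a\<in>(\<lambda>a. a v* X) ` A. a $ i * a $ j) = (\<Sum>a\<in>A. (a v* X) $ i * (a v* X) $ j)" for i j
    by (subst sum.reindex[OF assms(2)]) (simp add: o_def)
  then show ?thesis using second_moments_vmult[OF assms(1), of X]
    unfolding second_moments_vanish_def by (simp only:) simp
qed

definition lifts_on :: "('p::prime_card mod_ring^2) set \<Rightarrow> ('p mod_ring^2 \<Rightarrow> int^2) \<Rightarrow> bool" where
  "lifts_on A N \<longleftrightarrow> (\<forall>a\<in>A. red (N a) = a)"

definition conj_symmetric :: "('p::prime_card mod_ring^2) set \<Rightarrow> ('p mod_ring^2 \<Rightarrow> int^2) \<Rightarrow> bool" where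
  "conj_symmetric A N \<longleftrightarrow> (\<forall>a\<in>A. conj_vec a \<in> A \<and> N (conj_vec a) = conj_vec (N a))"

text \<open>The defect of \<open>N\<close> from commuting with the matrices \<open>\<Gamma>\<close> and \<open>\<Gamma> mod p\<close>, divided by \<open>p\<close>.\<close>
definition lift_error :: "('p::prime_card mod_ring^2 \<Rightarrow> int^2) \<Rightarrow> int^2^2 \<Rightarrow> 'p mod_ring^2 \<Rightarrow> int^2" where
  "lift_error N \<Gamma> a = (\<chi> i. ((N a v* \<Gamma>) $ i - N (a v* map_matrix of_int \<Gamma>) $ i) div int CARD('p))"

text \<open>The obstruction to the congruence modulo \<open>p\<^sup>2\<close> of
\<open>p2_dvd_iff_lift_cocycle\<close>.\<close>
definition lift_cocycle :: "('p::prime_card mod_ring^2) set \<Rightarrow> ('p mod_ring^2 \<Rightarrow> int^2) \<Rightarrow> int^2^2 \<Rightarrow> 'p mod_ring" where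
  "lift_cocycle A N \<Gamma> = (\<Sum>a\<in>A. wedge (a v* map_matrix of_int \<Gamma>) (red (lift_error N \<Gamma> a)))"

abbreviation preserves :: "'p::prime_card mod_ring^2^2 \<Rightarrow> ('p mod_ring^2) set \<Rightarrow> bool" where
  "preserves \<sigma> A \<equiv> bij_betw (\<lambda>a. a v* \<sigma>) A A"

lemma lift_error:
  fixes N :: "'p::prime_card mod_ring^2 \<Rightarrow> int^2"
  assumes "red (N a) = a" "red (N (a v* map_matrix of_int \<Gamma>)) = a v* map_matrix of_int \<Gamma>"
  shows "(N a v* \<Gamma>) $ i = N (a v* map_matrix of_int \<Gamma>) $ i + int CARD('p) * lift_error N \<Gamma> a $ i"
proof -
  have "red (N a v* \<Gamma>) = a v* map_matrix of_int \<Gamma>" by (simp add: red_vmult assms)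
  then have "red (N a v* \<Gamma>) $ i = (red (N (a v* map_matrix of_int \<Gamma>)) :: 'p mod_ring^2) $ i"
    by (simp only: assms)
  then have "int CARD('p) dvd (N a v* \<Gamma>) $ i - N (a v* map_matrix of_int \<Gamma>) $ i"
    by (simp only: red_nth of_int_mod_ring_eq_iff)
  then show ?thesis by (simp add: lift_error_def del: vmult2)
qed

text \<open>Since \<open>wedge x x = 0\<close>, only the error term of \<open>N a v* \<Gamma>\<close> contributes to the sum, with a factor \<open>p\<close>.\<close>
lemma p2_dvd_iff_lift_cocycle:
  fixes N :: "'p::prime_card mod_ring^2 \<Rightarrow> int^2"
  assumes N: "lifts_on A N" and p: "preserves (map_matrix of_int \<Gamma>) A"
  shows "int CARD('p) ^ 2 dvd (\<Sum>a\<in>A. wedge (N (a v* map_matrix of_int \<Gamma>)) (N a v* \<Gamma>))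
     \<longleftrightarrow> lift_cocycle A N \<Gamma> = 0"
proof -
  let ?\<sigma> = "map_matrix of_int \<Gamma> :: 'p mod_ring^2^2" and ?p = "int CARD('p)"
  have s: "a v* ?\<sigma> \<in> A" if "a \<in> A" for a using p that by (auto simp: bij_betw_def)
  have "(\<Sum>a\<in>A. wedge (N (a v* ?\<sigma>)) (N a v* \<Gamma>)) = (\<Sum>a\<in>A. ?p * wedge (N (a v* ?\<sigma>)) (lift_error N \<Gamma> a))"
  proof (rule sum.cong)
    fix a assume a: "a \<in> A"
    have e: "(N a v* \<Gamma>) $ i = N (a v* ?\<sigma>) $ i + ?p * lift_error N \<Gamma> a $ i" for i
      using N s[OF a] a by (intro lift_error) (auto simp: lifts_on_def)
    show "wedge (N (a v* ?\<sigma>)) (N a v* \<Gamma>) = ?p * wedge (N (a v* ?\<sigma>)) (lift_error N \<Gamma> a)"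
      unfolding wedge_def e by (simp add: algebra_simps)
  qed simp
  also have "\<dots> = ?p * (\<Sum>a\<in>A. wedge (N (a v* ?\<sigma>)) (lift_error N \<Gamma> a))"
    by (simp add: sum_distrib_left)
  finally have "?p ^ 2 dvd (\<Sum>a\<in>A. wedge (N (a v* ?\<sigma>)) (N a v* \<Gamma>)) \<longleftrightarrow>
     ?p dvd (\<Sum>a\<in>A. wedge (N (a v* ?\<sigma>)) (lift_error N \<Gamma> a))"
    by (simp add: power2_eq_square)
  also have "\<dots> \<longleftrightarrow> of_int (\<Sum>a\<in>A. wedge (N (a v* ?\<sigma>)) (lift_error N \<Gamma> a)) = (0 :: 'p mod_ring)"
    by (simp only: of_int_mod_ring_eq_0_iff)
  also have "of_int (\<Sum>a\<in>A. wedge (N (a v* ?\<sigma>)) (lift_error N \<Gamma> a)) = lift_cocycle A N \<Gamma>"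
    unfolding lift_cocycle_def of_int_sum
  proof (rule sum.cong)
    fix a assume a: "a \<in> A"
    have "red (N (a v* ?\<sigma>)) = a v* ?\<sigma>" using N s[OF a] by (auto simp: lifts_on_def)
    then have "a v* ?\<sigma> = red (N (a v* ?\<sigma>))" by simp
    then show "of_int (wedge (N (a v* ?\<sigma>)) (lift_error N \<Gamma> a)) = wedge (a v* ?\<sigma>) (red (lift_error N \<Gamma> a))"
      by (metis (no_types, lifting) of_int_diff of_int_mult red_nth wedge_def)
  qed simp
  finally show ?thesis .
qed

text \<open>The error of \<open>\<Gamma> ** \<Delta>\<close> at \<open>a\<close> is the error of \<open>\<Delta>\<close> at \<open>a\<Gamma>\<close> plus the error of \<open>\<Gamma>\<close> at \<open>a\<close> multiplied by \<open>\<Delta>\<close>, and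
multiplication by \<open>\<Delta>\<close> scales \<open>wedge\<close> by the determinant.\<close>
lemma lift_cocycle_mult:
  fixes N :: "'p::prime_card mod_ring^2 \<Rightarrow> int^2"
  assumes N: "lifts_on A N" and p: "preserves (map_matrix of_int \<Gamma>) A" "preserves (map_matrix of_int \<Delta>) A"
  shows "lift_cocycle A N (\<Gamma> ** \<Delta>) = lift_cocycle A N \<Delta> + of_int (det \<Delta>) * lift_cocycle A N \<Gamma>"
proof -
  let ?\<sigma> = "map_matrix of_int \<Gamma> :: 'p mod_ring^2^2" and ?\<tau> = "map_matrix of_int \<Delta> :: 'p mod_ring^2^2"
  have s: "a v* ?\<sigma> \<in> A" "a v* ?\<tau> \<in> A" if "a \<in> A" for a using p that by (auto simp: bij_betw_def)
  have \<sigma>\<tau>: "a v* map_matrix of_int (\<Gamma> ** \<Delta>) = a v* ?\<sigma> v* ?\<tau>" for a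
    by (simp only: map_matrix_mult2 vector_matrix_mul_assoc)
  have err: "lift_error N (\<Gamma> ** \<Delta>) a = lift_error N \<Delta> (a v* ?\<sigma>) + lift_error N \<Gamma> a v* \<Delta>" if a: "a \<in> A" for a
  proof -
    have 1: "N a v* \<Gamma> = (\<chi> i. N (a v* ?\<sigma>) $ i + int CARD('p) * lift_error N \<Gamma> a $ i)"
      unfolding vec_eq_iff vec_lambda_beta
      using N s a by (intro allI lift_error) (auto simp: lifts_on_def)
    have 2: "(N (a v* ?\<sigma>) v* \<Delta>) $ i = N (a v* ?\<sigma> v* ?\<tau>) $ i + int CARD('p) * lift_error N \<Delta> (a v* ?\<sigma>) $ i" for i
      using N s a by (intro lift_error) (auto simp: lifts_on_def)
    have "(N a v* (\<Gamma> ** \<Delta>)) $ i - N (a v* ?\<sigma> v* ?\<tau>) $ i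
        = int CARD('p) * (lift_error N \<Delta> (a v* ?\<sigma>) + lift_error N \<Gamma> a v* \<Delta>) $ i" for i
      unfolding vector_matrix_mul_assoc[symmetric] 1 using 2[of i] by (simp add: algebra_simps)
    then show ?thesis unfolding vec_eq_iff
      by (simp only: lift_error_def[of N "\<Gamma> ** \<Delta>"] \<sigma>\<tau> vec_lambda_beta) simp
  qed
  have "lift_cocycle A N (\<Gamma> ** \<Delta>) = (\<Sum>a\<in>A. wedge (a v* ?\<sigma> v* ?\<tau>) (red (lift_error N \<Delta> (a v* ?\<sigma>)))
      + det ?\<tau> * wedge (a v* ?\<sigma>) (red (lift_error N \<Gamma> a)))"
    unfolding lift_cocycle_def \<sigma>\<tau>
    by (intro sum.cong) (simp_all only: err red_add red_vmult wedge_add_right wedge_vmult)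
  also have "\<dots> = (\<Sum>a\<in>A. wedge (a v* ?\<sigma> v* ?\<tau>) (red (lift_error N \<Delta> (a v* ?\<sigma>)))) + det ?\<tau> * lift_cocycle A N \<Gamma>"
    by (simp only: sum.distrib sum_distrib_left lift_cocycle_def)
  also have "(\<Sum>a\<in>A. wedge (a v* ?\<sigma> v* ?\<tau>) (red (lift_error N \<Delta> (a v* ?\<sigma>)))) = lift_cocycle A N \<Delta>"
    unfolding lift_cocycle_def by (rule sum.reindex_bij_betw[OF p(1)])
  finally show ?thesis by (simp add: det_map_matrix2)
qed

text \<open>Adding \<open>p X\<close> to \<open>\<Gamma>\<close> changes the cocycle by the sum over \<open>A\<close> of a quadratic form.\<close>
lemma lift_cocycle_cong:
  fixes N :: "'p::prime_card mod_ring^2 \<Rightarrow> int^2"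
  assumes N: "lifts_on A N" and p: "preserves (map_matrix of_int \<Gamma>) A" 
    and eq: "map_matrix of_int \<Gamma> = (map_matrix of_int \<Delta> :: 'p mod_ring^2^2)"
    and mom: "second_moments_vanish A"
  shows "lift_cocycle A N \<Gamma> = lift_cocycle A N \<Delta>"
proof -
  let ?\<sigma> = "map_matrix of_int \<Gamma> :: 'p mod_ring^2^2"
  have s: "a v* ?\<sigma> \<in> A" if "a \<in> A" for a using p that by (auto simp: bij_betw_def)
  define X :: "int^2^2" where "X = (\<chi> i j. (\<Gamma> $ i $ j - \<Delta> $ i $ j) div int CARD('p))"
  have X: "\<Gamma> $ i $ j = \<Delta> $ i $ j + int CARD('p) * X $ i $ j" for i j
  proof -
    have "map_matrix of_int \<Gamma> $ i $ j = (map_matrix of_int \<Delta> :: 'p mod_ring^2^2) $ i $ j" by (simp only: eq)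
    then have "int CARD('p) dvd \<Gamma> $ i $ j - \<Delta> $ i $ j" by (simp add: of_int_mod_ring_eq_iff)
    then show ?thesis by (simp add: X_def)
  qed
  have err: "lift_error N \<Gamma> a = lift_error N \<Delta> a + N a v* X" if a: "a \<in> A" for a
  proof (rule vec_eq_iff[THEN iffD2], rule allI)
    fix i
    have "(N a v* \<Delta>) $ i = N (a v* ?\<sigma>) $ i + int CARD('p) * lift_error N \<Delta> a $ i"
      unfolding eq using N s a by (intro lift_error) (auto simp: lifts_on_def eq)
    then have "(N a v* \<Gamma>) $ i - N (a v* ?\<sigma>) $ i = int CARD('p) * (lift_error N \<Delta> a + N a v* X) $ i"
      by (simp add: X algebra_simps)
    then show "lift_error N \<Gamma> a $ i = (lift_error N \<Delta> a + N a v* X) $ i"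
      by (simp only: lift_error_def[of N \<Gamma>] vec_lambda_beta) simp
  qed
  have "lift_cocycle A N \<Gamma> = (\<Sum>a\<in>A. wedge (a v* ?\<sigma>) (red (lift_error N \<Delta> a)) + wedge (a v* ?\<sigma>) (a v* map_matrix of_int X))"
    unfolding lift_cocycle_def
    using N by (intro sum.cong) (auto simp: err red_add red_vmult wedge_add_right lifts_on_def simp del: vmult2)
  also have "\<dots> = lift_cocycle A N \<Delta>"
    by (simp only: sum.distrib second_moments_wedge[OF mom] lift_cocycle_def eq add_0_right)
  finally show ?thesis .
qed

text \<open>A lift that respects conjugation commutes with the matrix exactly, so that there is no error.\<close>
lemma lift_cocycle_conj:
  fixes N :: "'p::prime_card mod_ring^2 \<Rightarrow> int^2"
  assumes "conj_symmetric A N"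
  shows "lift_cocycle A N (mat2 1 0 0 (- 1)) = 0"
proof -
  have "lift_error N (mat2 1 0 0 (- 1)) a = 0" if "a \<in> A" for a
  proof -
    have "map_matrix of_int (mat2 1 0 0 (- 1)) = (mat2 1 0 0 (- 1) :: 'p mod_ring^2^2)"
      by (rule mat2_eqI) simp_all
    then have "N (a v* map_matrix of_int (mat2 1 0 0 (- 1))) = N a v* mat2 1 0 0 (- 1)"
      using assms that by (simp only: conj_vec_eq_vmult[symmetric] conj_symmetric_def)
    then show ?thesis by (simp add: lift_error_def vec_eq_iff)
  qed
  then show ?thesis by (simp add: lift_cocycle_def wedge_def)
qed

text \<open>Conjugation changes the sign of \<open>wedge\<close>, so the terms of \<open>a\<close> and of its conjugate cancel.\<close>
lemma lift_sum_conj: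
  assumes "conj_symmetric A N" "conj_symmetric A N'"
  shows "(\<Sum>a\<in>A. wedge (N a) (N' a)) = 0"
proof -
  have "bij_betw conj_vec A A"
    by (rule bij_betw_byWitness[where f' = conj_vec]) (use assms in \<open>auto simp: conj_symmetric_def\<close>)
  then have "(\<Sum>a\<in>A. wedge (N a) (N' a)) = (\<Sum>a\<in>A. wedge (N (conj_vec a)) (N' (conj_vec a)))"
    by (rule sum.reindex_bij_betw[symmetric])
  also have "\<dots> = (\<Sum>a\<in>A. - wedge (N a) (N' a))"
    using assms by (intro sum.cong) (auto simp: conj_symmetric_def wedge_def)
  finally show ?thesis by (simp add: sum_negf)
qed

section \<open>Squares, norms and elements of order three\<close>

lemma mod_ring_of_nat_eq_0_iff: "of_nat n = (0 :: 'p::prime_card mod_ring) \<longleftrightarrow> CARD('p) dvd n"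
  by (simp add: of_nat_eq_0_iff_char_dvd)

lemma mod_ring_numeral_nonzero:
  assumes "CARD('p) \<ge> 5"
  shows "(2 :: 'p::prime_card mod_ring) \<noteq> 0" "(3 :: 'p mod_ring) \<noteq> 0"
proof -
  have "\<not> CARD('p) dvd 2" "\<not> CARD('p) dvd 3" using assms by (auto dest: dvd_imp_le)
  then have "of_nat 2 \<noteq> (0 :: 'p mod_ring)" "of_nat 3 \<noteq> (0 :: 'p mod_ring)"
    unfolding mod_ring_of_nat_eq_0_iff by auto
  then show "(2 :: 'p::prime_card mod_ring) \<noteq> 0" "(3 :: 'p mod_ring) \<noteq> 0" by simp_all
qed

text \<open>At least half of the units are squares, so the squares and their multiples by the nonsquare \<open>x\<close> exhaust
the units.\<close>
lemma nonsquare_mult: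
  fixes x y :: "'p::prime_card mod_ring"
  assumes x: "\<nexists>z. z\<^sup>2 = x" and y: "\<nexists>z. z\<^sup>2 = y"
  shows "\<exists>z. z\<^sup>2 = x * y"
proof -
  let ?U = "- {0 :: 'p mod_ring}" 
  let ?S = "(\<lambda>z. z\<^sup>2) ` ?U"
  have x0: "x \<noteq> 0" and y0: "y \<noteq> 0" using x y by auto
  have le: "card ?U \<le> 2 * card ?S"
  proof -
    have "card ?U = (\<Sum>s\<in>?S. card {z \<in> ?U. z\<^sup>2 = s})"
      by (subst card_eq_sum, subst sum.image_gen[of ?U _ "\<lambda>z. z\<^sup>2"]) simp_all
    also have "\<dots> \<le> (\<Sum>s\<in>?S. 2)"
    proof (rule sum_mono)
      fix s assume "s \<in> ?S"
      then obtain z where "s = z\<^sup>2" by auto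
      then have "{z' \<in> ?U. z'\<^sup>2 = s} \<subseteq> {z, - z}" by (auto simp: power2_eq_iff)
      then have "card {z' \<in> ?U. z'\<^sup>2 = s} \<le> card {z, - z}" by (intro card_mono) auto
      also have "\<dots> \<le> 2" by (simp add: card_insert_if)
      finally show "card {z' \<in> ?U. z'\<^sup>2 = s} \<le> 2" .
    qed
    finally show ?thesis by simp
  qed
  have disj: "?S \<inter> (\<lambda>s. x * s) ` ?S = {}"
  proof -
    have "z\<^sup>2 \<noteq> x * w\<^sup>2" if "w \<noteq> 0" for z w
    proof
      assume "z\<^sup>2 = x * w\<^sup>2"
      then have "(z / w)\<^sup>2 = x" using that by (simp add: power_divide)
      with x show False by blast
    qed
    then show ?thesis by auto
  qed
  have "card (?S \<union> (\<lambda>s. x * s) ` ?S) = 2 * card ?S"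
    using disj x0 by (subst card_Un_disjoint) (auto simp: card_image inj_on_def)
  moreover have "?S \<union> (\<lambda>s. x * s) ` ?S \<subseteq> ?U" using x0 by auto
  ultimately have "?S \<union> (\<lambda>s. x * s) ` ?S = ?U"
    using le by (intro card_seteq) auto
  with y0 have "y \<in> ?S \<union> (\<lambda>s. x * s) ` ?S" by simp
  with y obtain w where "y = x * w\<^sup>2" by auto
  then have "(x * w)\<^sup>2 = x * y" by (simp add: power2_eq_square)
  then show ?thesis by blast
qed

lemma norm_form_nonzero:
  fixes \<Xi> :: "'p::prime_card mod_ring"
  assumes \<Xi>: "\<nexists>z. z\<^sup>2 = \<Xi>" and "\<alpha>\<^sup>2 - \<Xi> * \<beta>\<^sup>2 = 0"
  shows "\<alpha> = 0 \<and> \<beta> = 0"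
proof -
  have "\<beta> = 0"
  proof (rule ccontr)
    assume "\<beta> \<noteq> 0"
    then have "(\<alpha> / \<beta>)\<^sup>2 = \<Xi>" using assms(2) by (simp add: power_divide)
    with \<Xi> show False by blast
  qed
  with assms(2) show ?thesis by simp
qed

text \<open>In the sequence 0, 1, 2, ... some square \<open>\<alpha>\<^sup>2\<close> is followed by a nonsquare, since otherwise every element
would be a square; and a nonsquare is \<open>\<Xi>\<close> times a square.\<close>
lemma norm_minus_one:
  fixes \<Xi> :: "'p::prime_card mod_ring"
  assumes \<Xi>: "\<nexists>z. z\<^sup>2 = \<Xi>"
  shows "\<exists>\<alpha> \<beta>. \<alpha>\<^sup>2 - \<Xi> * \<beta>\<^sup>2 = - 1"
proof -
  have "\<exists>n :: 'p mod_ring. (\<exists>z. z\<^sup>2 = n) \<and> (\<nexists>z. z\<^sup>2 = n + 1)"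
  proof (rule ccontr)
    assume no: "\<not> ?thesis"
    have "\<exists>z. z\<^sup>2 = (of_nat k :: 'p mod_ring)" for k
    proof (induction k)
      case 0
      show ?case by (rule exI[of _ 0]) simp
    next
      case (Suc k)
      then have "\<exists>z. z\<^sup>2 = of_nat k + (1 :: 'p mod_ring)" using no by blast
      then show ?case by (simp add: add.commute)
    qed
    moreover obtain k where "\<Xi> = of_nat k" using surj_of_nat_mod_ring by blast
    ultimately show False using \<Xi> by blast
  qed
  then obtain \<alpha> :: "'p mod_ring" where \<alpha>: "\<nexists>z. z\<^sup>2 = \<alpha>\<^sup>2 + 1" by blast
  obtain z where z: "z\<^sup>2 = (\<alpha>\<^sup>2 + 1) * \<Xi>" using nonsquare_mult[OF \<alpha> \<Xi>] by blast
  have "\<Xi> \<noteq> 0" using \<Xi> by auto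
  then have "\<Xi> * (z / \<Xi>)\<^sup>2 = \<alpha>\<^sup>2 + 1" unfolding power_divide z by (simp add: power2_eq_square)
  then have "\<alpha>\<^sup>2 - \<Xi> * (z / \<Xi>)\<^sup>2 = - 1" by simp
  then show ?thesis by blast
qed

text \<open>The quotient of \<open>1 + y\<surd>\<Xi>\<close> by its conjugate has norm 1.  Its first coordinate can vanish for at most one
of \<open>y = 1\<close> and \<open>y = 2\<close>.\<close>
lemma norm_one_generic:
  fixes \<Xi> :: "'p::prime_card mod_ring"
  assumes p: "CARD('p) \<ge> 5" and \<Xi>: "\<nexists>z. z\<^sup>2 = \<Xi>"
  shows "\<exists>\<alpha> \<beta>. \<alpha>\<^sup>2 - \<Xi> * \<beta>\<^sup>2 = 1 \<and> \<alpha> \<noteq> 0 \<and> \<beta> \<noteq> 0"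
proof -
  note nz = mod_ring_numeral_nonzero[OF p]
  have "\<exists>y. y \<noteq> 0 \<and> 1 + \<Xi> * y\<^sup>2 \<noteq> 0"
  proof (cases "1 + \<Xi> = 0")
    case True
    then have "\<Xi> = - 1" by (simp add: add_eq_0_iff)
    then have "1 + \<Xi> * 2\<^sup>2 \<noteq> 0" using nz by simp
    with nz show ?thesis by blast
  qed (intro exI[of _ 1], simp)
  then obtain y where y: "y \<noteq> 0" "1 + \<Xi> * y\<^sup>2 \<noteq> 0" by blast
  have d: "1 - \<Xi> * y\<^sup>2 \<noteq> 0" using norm_form_nonzero[OF \<Xi>, of 1 y] by auto
  define D where "D = 1 - \<Xi> * y\<^sup>2"
  have "((1 + \<Xi> * y\<^sup>2) / D)\<^sup>2 - \<Xi> * (2 * y / D)\<^sup>2 = ((1 + \<Xi> * y\<^sup>2)\<^sup>2 - \<Xi> * (2 * y)\<^sup>2) / D\<^sup>2"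
    by (simp add: power_divide diff_divide_distrib)
  also have "(1 + \<Xi> * y\<^sup>2)\<^sup>2 - \<Xi> * (2 * y)\<^sup>2 = D\<^sup>2"
    by (simp add: D_def power2_eq_square algebra_simps)
  finally have "((1 + \<Xi> * y\<^sup>2) / D)\<^sup>2 - \<Xi> * (2 * y / D)\<^sup>2 = 1" using d by (simp add: D_def)
  moreover have "(1 + \<Xi> * y\<^sup>2) / D \<noteq> 0" "2 * y / D \<noteq> 0" using y d nz by (auto simp: D_def)
  ultimately show ?thesis by blast
qed

lemma three_dvd_card:
  assumes "finite A" "\<And>x. x \<in> A \<Longrightarrow> f x \<in> A" "\<And>x. x \<in> A \<Longrightarrow> f (f (f x)) = x" "\<And>x. x \<in> A \<Longrightarrow> f x \<noteq> x"
  shows "3 dvd card A"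
proof -
  define B where "B x = {x, f x, f (f x)}" for x
  have B3: "3 dvd card (B x)" if "x \<in> A" for x
  proof -
    have "f (f x) \<noteq> x" using assms(2,3,4)[OF that] by metis
    moreover have "f (f x) \<noteq> f x" using assms(2,4) that by metis
    moreover have "f x \<noteq> x" using assms(4) that .
    ultimately have "card (B x) = 3" by (auto simp: B_def card_insert_if)
    then show ?thesis by simp
  qed
  have Beq: "B y = B x" if "x \<in> A" "y \<in> B x" for x y
    using that assms(3)[OF that(1)] assms(3)[OF assms(2)[OF that(1)]] by (auto simp: B_def)
  have "3 dvd card (\<Union> (B ` A))"
  proof (rule dvd_partition)
    show "finite (\<Union> (B ` A))" using assms(1) by (auto simp: B_def)
    show "\<forall>c\<in>B ` A. 3 dvd card c" using B3 by blast
    show "\<forall>c1\<in>B ` A. \<forall>c2\<in>B ` A. c1 \<noteq> c2 \<longrightarrow> c1 \<inter> c2 = {}" using Beq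
      by blast
  qed
  moreover have "\<Union> (B ` A) = A" using assms(2) by (auto simp: B_def)
  ultimately show ?thesis by simp
qed

lemma two_dvd_card:
  assumes "finite A" "\<And>x. x \<in> A \<Longrightarrow> f x \<in> A" "\<And>x. x \<in> A \<Longrightarrow> f (f x) = x" "\<And>x. x \<in> A \<Longrightarrow> f x \<noteq> x"
  shows "2 dvd card A"
proof -
  define B where "B x = {x, f x}" for x
  have Beq: "B y = B x" if "x \<in> A" "y \<in> B x" for x y
    using that assms(3)[OF that(1)] by (auto simp: B_def)
  have "2 dvd card (\<Union> (B ` A))"
  proof (rule dvd_partition)
    show "finite (\<Union> (B ` A))" using assms(1) by (auto simp: B_def)
    show "\<forall>c\<in>B ` A. 2 dvd card c" using assms(4)[symmetric] by (auto simp: B_def)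
    show "\<forall>c1\<in>B ` A. \<forall>c2\<in>B ` A. c1 \<noteq> c2 \<longrightarrow> c1 \<inter> c2 = {}" using Beq
      by blast
  qed
  moreover have "\<Union> (B ` A) = A" using assms(2) by (auto simp: B_def)
  ultimately show ?thesis by simp
qed

text \<open>A square root of \<open>-3\<close> yields a primitive cube root of unity.  Multiplication by it has no fixed points
on the units, so 3 would divide \<open>p - 1\<close> as well as \<open>p + 1\<close>.\<close>
lemma minus_three_nonsquare:
  assumes p: "CARD('p) \<ge> 5" and 3: "3 dvd CARD('p) + 1"
  shows "\<nexists>x :: 'p::prime_card mod_ring. x\<^sup>2 = - 3"
proof
  note nz = mod_ring_numeral_nonzero[OF p]
  assume "\<exists>x :: 'p mod_ring. x\<^sup>2 = - 3"
  then obtain x :: "'p mod_ring" where x: "x\<^sup>2 = - 3" by blast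
  define y where "y = (x - 1) / 2"
  have "4 * (y\<^sup>2 + y + 1) = (2 * y + 1)\<^sup>2 + 3" by (simp add: power2_eq_square algebra_simps)
  also have "2 * y + 1 = x" using nz by (simp add: y_def)
  finally have "2 * 2 * (y\<^sup>2 + y + 1) = 0" by (simp add: x)
  then have y: "y\<^sup>2 + y + 1 = 0" using nz(1) by (simp only: mult_eq_0_iff simp_thms)
  have "y ^ 3 - 1 = (y - 1) * (y\<^sup>2 + y + 1)" by (simp add: power2_eq_square power3_eq_cube algebra_simps)
  then have y3: "y ^ 3 = 1" by (simp add: y)
  have "y \<noteq> 1" using y nz(2) by auto
  have "3 dvd card (- {0 :: 'p mod_ring})"
  proof (rule three_dvd_card[where f = "\<lambda>z. y * z"])
    show "y * (y * (y * z)) = z" for z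
      using y3 by (simp add: power3_eq_cube mult.assoc[symmetric])
  qed (use y3 \<open>y \<noteq> 1\<close> in auto)
  also have "card (- {0 :: 'p mod_ring}) = CARD('p) - 1"
    by (simp add: Compl_eq_Diff_UNIV card_Diff_singleton)
  finally show False using 3 p by presburger
qed

lemma subgroup_power_card:
  fixes H :: "'p::prime_card mod_ring set"
  assumes "0 \<notin> H" "\<And>x y. x \<in> H \<Longrightarrow> y \<in> H \<Longrightarrow> x * y \<in> H" "h \<in> H"
  shows "h ^ card H = 1"
proof -
  have fin: "finite H" by (rule finite_subset[of _ UNIV]) auto
  have "h \<noteq> 0" using assms by auto
  then have inj: "inj_on ((*) h) H" by (auto simp: inj_on_def)
  have "(*) h ` H = H" using assms by (intro endo_inj_surj fin inj) auto
  then have "(\<Prod>x\<in>H. x) = (\<Prod>x\<in>(*) h ` H. x)" by simp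
  also have "\<dots> = (\<Prod>x\<in>H. h * x)" by (subst prod.reindex[OF inj]) simp
  also have "\<dots> = h ^ card H * (\<Prod>x\<in>H. x)" by (simp add: prod.distrib)
  finally have "h ^ card H * (\<Prod>x\<in>H. x) = 1 * (\<Prod>x\<in>H. x)" by simp
  moreover have "(\<Prod>x\<in>H. x) \<noteq> 0" using assms fin by (auto simp: prod_zero_iff)
  ultimately show ?thesis by (simp only: mult_cancel_right simp_thms)
qed

text \<open>Cauchy's theorem for the prime 3: if \<open>k = |H|/3\<close> and no element had order 3, then all \<open>3k\<close> elements of
\<open>H\<close> would be roots of \<open>X\<^sup>k - 1\<close>.\<close>
lemma subgroup_order_three:
  fixes H :: "'p::prime_card mod_ring set"
  assumes H: "0 \<notin> H" "1 \<in> H" "\<And>x y. x \<in> H \<Longrightarrow> y \<in> H \<Longrightarrow> x * y \<in> H" and 3: "3 dvd card H"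
  shows "\<exists>h\<in>H. h ^ 3 = 1 \<and> h \<noteq> 1"
proof (rule ccontr)
  assume no: "\<not> ?thesis"
  have fin: "finite H" by (rule finite_subset[of _ UNIV]) auto
  have pos: "card H > 0" using H fin by (auto simp: card_gt_0_iff)
  obtain k where k: "card H = 3 * k" using 3 by blast
  with pos have k0: "k > 0" by simp
  have "x ^ k = 1" if "x \<in> H" for x
  proof -
    have "x ^ n \<in> H" for n by (induction n) (use H that in auto)
    moreover have "(x ^ k) ^ 3 = 1"
      using subgroup_power_card[OF H(1,3) that] by (simp add: power_mult[symmetric] k mult.commute)
    ultimately show ?thesis using no by blast
  qed
  define P :: "'p mod_ring poly" where "P = Polynomial.monom 1 k - 1"
  have P0: "P \<noteq> 0"
  proof
    assume "P = 0"
    then have "Polynomial.coeff P k = 0" by simp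
    then show False using k0 by (simp add: P_def)
  qed
  have "degree P \<le> k" unfolding P_def by (intro degree_diff_le) (auto simp: degree_monom_le)
  have "H \<subseteq> {x. poly P x = 0}" using \<open>\<And>x. x \<in> H \<Longrightarrow> x ^ k = 1\<close>
    by (auto simp: P_def poly_monom)
  then have "card H \<le> card {x. poly P x = 0}" by (intro card_mono) auto
  also have "\<dots> \<le> degree P" by (rule card_poly_roots_bound[OF P0])
  also have "\<dots> \<le> k" by fact
  finally show False using k k0 by simp
qed

section \<open>Orbits of the normalizer of a non-split Cartan subgroup\<close>

text \<open>For \<open>\<epsilon> = 1\<close> these are the elements of the Cartan subgroup, that is, the multiplications by \<open>\<alpha> + \<beta>\<surd>\<Xi>\<close>; for
\<open>\<epsilon> = - 1\<close> they form the other coset in its normalizer.\<close>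
definition ns_elt :: "'p::prime_card mod_ring \<Rightarrow> 'p mod_ring \<Rightarrow> 'p mod_ring \<Rightarrow> 'p mod_ring \<Rightarrow> 'p mod_ring^2^2" where
  "ns_elt \<Xi> \<epsilon> \<alpha> \<beta> = mat2 \<alpha> (\<Xi> * \<beta>) (\<epsilon> * \<beta>) (\<epsilon> * \<alpha>)"

lemma ns_elt_nth [simp]:
  "ns_elt \<Xi> \<epsilon> \<alpha> \<beta> $ 1 $ 1 = \<alpha>" "ns_elt \<Xi> \<epsilon> \<alpha> \<beta> $ 1 $ 2 = \<Xi> * \<beta>"
  "ns_elt \<Xi> \<epsilon> \<alpha> \<beta> $ 2 $ 1 = \<epsilon> * \<beta>" "ns_elt \<Xi> \<epsilon> \<alpha> \<beta> $ 2 $ 2 = \<epsilon> * \<alpha>"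
  by (simp_all add: ns_elt_def)

lemma det_ns_elt: "det (ns_elt \<Xi> \<epsilon> \<alpha> \<beta>) = \<epsilon> * (\<alpha>\<^sup>2 - \<Xi> * \<beta>\<^sup>2)"
  by (simp add: det_2 power2_eq_square algebra_simps)

lemma ns_elt_mult:
  assumes "\<epsilon>' * \<epsilon>' = 1"
  shows "ns_elt \<Xi> \<epsilon> \<alpha> \<beta> ** ns_elt \<Xi> \<epsilon>' \<alpha>' \<beta>'
    = ns_elt \<Xi> (\<epsilon> * \<epsilon>') (\<alpha> * \<alpha>' + \<epsilon>' * \<Xi> * \<beta> * \<beta>') (\<alpha> * \<beta>' + \<epsilon>' * \<beta> * \<alpha>')"
proof -
  have [simp]: "\<epsilon>' * (\<epsilon>' * x) = x" for x using assms by (simp add: mult.assoc[symmetric])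
  show ?thesis by (rule mat2_eqI) (simp_all add: algebra_simps assms)
qed

lemma ns_normalizer_iff:
  "g \<in> ns_normalizer \<Xi> \<longleftrightarrow> (\<exists>\<epsilon> \<alpha> \<beta>. (\<epsilon> = 1 \<or> \<epsilon> = - 1) \<and> (\<alpha>, \<beta>) \<noteq> (0, 0) \<and> g = ns_elt \<Xi> \<epsilon> \<alpha> \<beta>)"
proof -
  have "vector [vector [\<alpha>, \<Xi> * \<beta>], vector [\<beta>, \<alpha>]] = ns_elt \<Xi> 1 \<alpha> \<beta>"
       "vector [vector [\<alpha>, \<Xi> * \<beta>], vector [- \<beta>, - \<alpha>]] = ns_elt \<Xi> (- 1) \<alpha> \<beta>"
         for \<alpha> \<beta>
    by (simp_all add: ns_elt_def mat2_def)
  then show ?thesis unfolding ns_normalizer_def by auto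
qed

locale ns_orbit =
  fixes \<Xi> :: "'p::prime_card mod_ring" and H :: "'p mod_ring set" and Orb :: "('p mod_ring^2) set"
  assumes p_ge_5: "CARD('p) \<ge> 5"
    and nonresidue: "\<nexists>x. x\<^sup>2 = \<Xi>"
    and H: "0 \<notin> H" "1 \<in> H" "\<And>x y. x \<in> H \<Longrightarrow> y \<in> H \<Longrightarrow> x * y \<in> H" "- 1 \<in> H"
    and orbit: "\<exists>a. a \<noteq> 0 \<and> Orb = right_orbit (det_in (ns_normalizer \<Xi>) H) a"
begin

abbreviation "GH \<equiv> det_in (ns_normalizer \<Xi>) H"

lemma two_nz: "(2 :: 'p mod_ring) \<noteq> 0" and three_nz: "(3 :: 'p mod_ring) \<noteq> 0"
  using mod_ring_numeral_nonzero[OF p_ge_5] by auto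

lemma eq_minus_imp_0: "x = - x \<Longrightarrow> x = 0" for x :: "'p mod_ring"
proof -
  assume "x = - x"
  then have "2 * x = 0" by (metis add.right_inverse mult_2)
  then show "x = 0" using two_nz by simp
qed

lemma ns_elt_in_GH:
  assumes "\<epsilon> = 1 \<or> \<epsilon> = - 1" "\<epsilon> * (\<alpha>\<^sup>2 - \<Xi> * \<beta>\<^sup>2) \<in> H"
    shows "ns_elt \<Xi> \<epsilon> \<alpha> \<beta> \<in> GH"
proof -
  have "(\<alpha>, \<beta>) \<noteq> (0, 0)" using assms H(1) by auto
  then show ?thesis using assms unfolding det_in_def ns_normalizer_iff by (auto simp: det_ns_elt)
qed

lemma GH_mult: "g \<in> GH \<Longrightarrow> h \<in> GH \<Longrightarrow> g ** h \<in> GH"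
proof -
  assume g: "g \<in> GH" and h: "h \<in> GH"
  obtain \<epsilon> \<alpha> \<beta> \<epsilon>' \<alpha>' \<beta>' where e: "\<epsilon> = 1 \<or> \<epsilon> = - 1" "\<epsilon>' = 1 \<or> \<epsilon>' = - 1"
    and gh: "g = ns_elt \<Xi> \<epsilon> \<alpha> \<beta>" "h = ns_elt \<Xi> \<epsilon>' \<alpha>' \<beta>'"
    using g h unfolding det_in_def ns_normalizer_iff by blast
  have "det (g ** h) \<in> H" using g h H by (simp add: det_mul det_in_def)
  moreover have "\<epsilon>' * \<epsilon>' = 1" using e by auto
  ultimately show ?thesis 
    unfolding gh ns_elt_mult[OF \<open>\<epsilon>' * \<epsilon>' = 1\<close>] det_ns_elt using e
    by (intro ns_elt_in_GH) auto
qed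

lemma GH_inj: "g \<in> GH \<Longrightarrow> inj (\<lambda>a. a v* g)"
proof (rule injI)
  fix x y assume g: "g \<in> GH" and eq: "x v* g = y v* g"
  have d: "det g \<noteq> 0" using g H by (auto simp: det_in_def)
  have *: "z $ 1 = 0 \<and> z $ 2 = 0" if "z v* g = 0" for z :: "'p mod_ring^2"
  proof -
    have 1: "z$1 * g$1$1 + z$2 * g$2$1 = 0" and 2: "z$1 * g$1$2 + z$2 * g$2$2 = 0"
      using arg_cong[OF that, of "\<lambda>v. v $ 1"] arg_cong[OF that, of "\<lambda>v. v $ 2"] by simp_all
    have "det g * z$1 = g$2$2 * (z$1 * g$1$1 + z$2 * g$2$1) - g$2$1 * (z$1 * g$1$2 + z$2 * g$2$2)"
      by (simp add: det_2 algebra_simps)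
    moreover have "det g * z$2 = g$1$1 * (z$1 * g$1$2 + z$2 * g$2$2) - g$1$2 * (z$1 * g$1$1 + z$2 * g$2$1)"
      by (simp add: det_2 algebra_simps)
    ultimately show ?thesis using d unfolding 1 2 by simp
  qed
  have "(x - y) v* g = 0" 
    using arg_cong[OF eq, of "\<lambda>v. v $ 1"] arg_cong[OF eq, of "\<lambda>v. v $ 2"]
    by (intro vec2_eqI) (simp_all add: algebra_simps)
  from *[OF this] show "x = y" by (intro vec2_eqI) simp_all
qed

lemma Orb_finite: "finite Orb" by (rule finite_subset[of _ UNIV]) auto

lemma GH_preserves: assumes "g \<in> GH" shows "preserves g Orb"
proof -
  obtain a where a: "Orb = right_orbit GH a" using orbit by blast
  have "(\<lambda>b. b v* g) ` Orb \<subseteq> Orb"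
    unfolding a right_orbit_def using GH_mult[OF _ assms] by (auto simp: vector_matrix_mul_assoc)
  moreover have "inj_on (\<lambda>b. b v* g) Orb" using GH_inj[OF assms] by (rule inj_on_subset) simp
  ultimately show ?thesis unfolding bij_betw_def using endo_inj_surj Orb_finite by blast
qed

lemma Orb_nonzero: "a \<in> Orb \<Longrightarrow> a \<noteq> 0"
proof
  assume a: "a \<in> Orb" "a = 0"
  obtain b where b: "b \<noteq> 0" "Orb = right_orbit GH b" using orbit by blast
  then obtain g where g: "g \<in> GH" "b v* g = 0" using a by (auto simp: right_orbit_def)
  have "b v* g = 0 v* g" using g by simp
  then have "b = 0" by (rule injD[OF GH_inj[OF g(1)]])
  with b show False by simp
qed

lemma conj_in_GH: "mat2 1 0 0 (- 1) \<in> GH"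
proof -
  have "mat2 1 0 0 (- 1) = ns_elt \<Xi> (- 1) 1 0" by (rule mat2_eqI) simp_all
  then show ?thesis using ns_elt_in_GH[of "- 1" 1 0] H by simp
qed

lemma Orb_conj: "a \<in> Orb \<Longrightarrow> conj_vec a \<in> Orb"
  unfolding conj_vec_eq_vmult using GH_preserves[OF conj_in_GH] by (auto simp: bij_betw_def)

lemma Orb_even: "2 dvd card Orb"
proof (rule two_dvd_card[OF Orb_finite, where f = uminus])
  have "ns_elt \<Xi> 1 (- 1) 0 \<in> GH" using ns_elt_in_GH[of 1 "- 1" 0] H by simp
  moreover have "- a = a v* ns_elt \<Xi> 1 (- 1) 0" for a by (rule vec2_eqI) simp_all
  ultimately show "- a \<in> Orb" if "a \<in> Orb" for a
    using GH_preserves that unfolding bij_betw_def by blast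
  show "- a \<noteq> a" if "a \<in> Orb" for a
  proof
    assume eq: "- a = a"
    have "a $ i = 0" for i
    proof (rule eq_minus_imp_0)
      have "(- a) $ i = a $ i" by (simp only: eq)
      then show "a $ i = - (a $ i)" by simp
    qed
    then have "a = 0" by (simp add: vec_eq_iff)
    with Orb_nonzero[OF that] show False by simp
  qed
qed simp

text \<open>A matrix \<open>g\<close> with \<open>g\<^sup>2 + g + 1 = 0\<close> acts on nonzero vectors without fixed points and has order 3.  If 3
divides \<open>p + 1\<close>, such a matrix is \<open>- 1/2 + \<beta>\<surd>\<Xi>\<close> with \<open>4\<Xi>\<beta>\<^sup>2 = - 3\<close>, which has norm 1.  If 3 divides \<open>|H|\<close>, it is
a scalar matrix whose determinant lies in \<open>H\<close>.\<close>
lemma Orb_three: assumes "3 dvd (CARD('p) + 1) * card H" shows "3 dvd card Orb"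
proof -
  have *: "3 dvd card Orb" if g: "g \<in> GH" and q: "\<And>a. a v* g v* g + a v* g + a = 0" for g
  proof (rule three_dvd_card[OF Orb_finite, where f = "\<lambda>a. a v* g"])
    show "a v* g \<in> Orb" if "a \<in> Orb" for a using GH_preserves[OF g] that by (auto simp: bij_betw_def)
    show "a v* g v* g v* g = a" for a
    proof -
      have "a v* g v* g v* g = (a v* g v* g v* g + a v* g v* g + a v* g) + a - (a v* g v* g + a v* g + a)"
        by (simp only: algebra_simps)
      then show ?thesis unfolding q by simp
    qed
    show "a v* g \<noteq> a" if a: "a \<in> Orb" for a
    proof
      assume eq: "a v* g = a"
      have "3 * a $ i = 0" for i using arg_cong[OF q[of a], of "\<lambda>v. v $ i"] unfolding eq by simp
      then have "a = 0" using three_nz by (simp add: vec_eq_iff)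
      with Orb_nonzero[OF a] show False by simp
    qed
  qed
  have "prime (3::nat)" by simp
  then consider "3 dvd CARD('p) + 1" | "3 dvd card H" using assms prime_dvd_mult_iff by blast
  then show ?thesis
  proof cases
    case 1
    obtain z where z: "z\<^sup>2 = - 3 * \<Xi>"
      using nonsquare_mult[OF minus_three_nonsquare[OF p_ge_5 1] nonresidue] by blast
    have \<Xi>0: "\<Xi> \<noteq> 0" using nonresidue by auto
    define \<alpha> \<beta> where "\<alpha> = - 1 / (2 :: 'p mod_ring)" and "\<beta> = z / (2 * \<Xi>)"
    have \<alpha>: "2 * \<alpha> = - 1" using two_nz by (simp add: \<alpha>_def)
    have "\<Xi> * \<beta>\<^sup>2 = - 3 / 4" unfolding \<beta>_def power_divide z using \<Xi>0
      by (simp add: power2_eq_square)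
    moreover have "\<alpha>\<^sup>2 = 1 / 4" by (simp add: \<alpha>_def power_divide)
    moreover have four: "(4 :: 'p mod_ring) \<noteq> 0" using two_nz by (metis mult_eq_0_iff mult_2 numeral_Bit0 one_add_one)
    ultimately have "\<alpha>\<^sup>2 - \<Xi> * \<beta>\<^sup>2 = (1 - (- 3)) / 4" by (simp only: diff_divide_distrib)
    then have n: "\<alpha>\<^sup>2 - \<Xi> * \<beta>\<^sup>2 = 1" using four by simp
    show ?thesis
    proof (rule *)
      show "ns_elt \<Xi> 1 \<alpha> \<beta> \<in> GH" using n H by (intro ns_elt_in_GH) auto
      fix a
      have 1: "\<alpha> * \<alpha> + \<Xi> * (\<beta> * \<beta>) + \<alpha> + 1 = 0"
      proof -
        have "\<alpha> * \<alpha> + \<Xi> * (\<beta> * \<beta>) + \<alpha> + 1 = \<alpha> * (2 * \<alpha> + 1) - (\<alpha>\<^sup>2 - \<Xi> * \<beta>\<^sup>2) + 1"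
          by (simp add: power2_eq_square algebra_simps)
        then show ?thesis by (simp add: \<alpha> n)
      qed
      have 2: "\<alpha> * \<beta> + \<alpha> * \<beta> + \<beta> = 0"
      proof -
        have "\<alpha> * \<beta> + \<alpha> * \<beta> + \<beta> = (2 * \<alpha> + 1) * \<beta>" by (simp add: algebra_simps)
        then show ?thesis by (simp add: \<alpha>)
      qed
      show "a v* ns_elt \<Xi> 1 \<alpha> \<beta> v* ns_elt \<Xi> 1 \<alpha> \<beta> + a v* ns_elt \<Xi> 1 \<alpha> \<beta> + a = 0" (is "?v = 0")
      proof (rule vec2_eqI)
        have "?v $ 1 = a $ 1 * (\<alpha> * \<alpha> + \<Xi> * (\<beta> * \<beta>) + \<alpha> + 1) + a $ 2 * (\<alpha> * \<beta> + \<alpha> * \<beta> + \<beta>)"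
          by (simp add: algebra_simps)
        then show "?v $ 1 = 0 $ 1" unfolding 1 2 by simp
        have "?v $ 2 = a $ 2 * (\<alpha> * \<alpha> + \<Xi> * (\<beta> * \<beta>) + \<alpha> + 1) + \<Xi> * a $ 1 * (\<alpha> * \<beta> + \<alpha> * \<beta> + \<beta>)"
          by (simp add: algebra_simps)
        then show "?v $ 2 = 0 $ 2" unfolding 1 2 by simp
      qed
    qed
  next
    case 2
    obtain h where h: "h \<in> H" "h ^ 3 = 1" "h \<noteq> 1" using subgroup_order_three[OF H(1,2,3) 2] by blast
    define k where "k = h\<^sup>2"
    have "k\<^sup>2 = h ^ 3 * h" by (simp add: k_def power2_eq_square power3_eq_cube)
    then have kH: "k\<^sup>2 \<in> H" using h by simp
    have "(h - 1) * (h\<^sup>2 + h + 1) = h ^ 3 - 1" by (simp add: power2_eq_square power3_eq_cube algebra_simps)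
    then have "h\<^sup>2 + h + 1 = 0" using h by simp
    moreover have "k\<^sup>2 = h" using \<open>k\<^sup>2 = h ^ 3 * h\<close> h by simp
    ultimately have k: "k\<^sup>2 + k + 1 = 0" by (simp add: k_def add.commute)
    show ?thesis
    proof (rule *)
      show "ns_elt \<Xi> 1 k 0 \<in> GH" using kH by (intro ns_elt_in_GH) auto
      have "x * k * k + x * k + x = 0" for x
      proof -
        have "x * k * k + x * k + x = x * (k\<^sup>2 + k + 1)" by (simp add: power2_eq_square algebra_simps)
        then show ?thesis by (simp add: k)
      qed
      then show "a v* ns_elt \<Xi> 1 k 0 v* ns_elt \<Xi> 1 k 0 + a v* ns_elt \<Xi> 1 k 0 + a = 0" for a
        by (intro vec2_eqI) simp_all
    qed
  qed
qed

text \<open>The Gram matrix \<open>M\<close> of the orbit satisfies \<open>g\<^sup>T M g = M\<close> for all \<open>g\<close> in \<open>G\<^sub>H\<close>.  Complex conjugation makes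
it diagonal, a Cartan element of norm 1 outside the coordinate axes makes it a multiple of the
diagonal matrix with entries 1 and \<open>- \<Xi>\<close>, and a Cartan element of norm \<open>-1\<close> maps that matrix to its negative.\<close>
lemma Orb_second_moments: "second_moments_vanish Orb"
proof -
  define M where "M i j = (\<Sum>a\<in>Orb. a $ i * a $ j)" for i j :: 2
  have inv: "M i j = g$1$i * g$1$j * M 1 1 + (g$1$i * g$2$j + g$2$i * g$1$j) * M 1 2 + g$2$i * g$2$j * M 2 2"
    if "g \<in> GH" for g i j
  proof -
    have "M i j = (\<Sum>a\<in>Orb. (a v* g) $ i * (a v* g) $ j)"
      unfolding M_def by (rule sum.reindex_bij_betw[OF GH_preserves[OF that], symmetric])
    also have "\<dots> = (\<Sum>a\<in>Orb. g$1$i * g$1$j * (a$1 * a$1) + (g$1$i * g$2$j + g$2$i * g$1$j) * (a$1 * a$2)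
        + g$2$i * g$2$j * (a$2 * a$2))"
      by (intro sum.cong) (simp_all add: algebra_simps)
    also have "\<dots> = g$1$i * g$1$j * M 1 1 + (g$1$i * g$2$j + g$2$i * g$1$j) * M 1 2 + g$2$i * g$2$j * M 2 2"
      by (simp only: sum.distrib sum_distrib_left[symmetric] M_def)
    finally show ?thesis .
  qed
  have 12: "M 1 2 = 0" using inv[OF conj_in_GH, of 1 2] by (intro eq_minus_imp_0) simp
  obtain \<alpha> \<beta> where n1: "\<alpha>\<^sup>2 - \<Xi> * \<beta>\<^sup>2 = 1" "\<alpha> \<noteq> 0" "\<beta> \<noteq> 0"
    using norm_one_generic[OF p_ge_5 nonresidue] by blast
  have "ns_elt \<Xi> 1 \<alpha> \<beta> \<in> GH" using n1 H by (intro ns_elt_in_GH) auto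
  from inv[OF this, of 1 2] have "\<alpha> * \<beta> * (\<Xi> * M 1 1 + M 2 2) = 0" by (simp add: 12 algebra_simps)
  then have 22: "M 2 2 = - \<Xi> * M 1 1" using n1 by (simp add: add_eq_0_iff)
  obtain \<alpha> \<beta> where n: "\<alpha>\<^sup>2 - \<Xi> * \<beta>\<^sup>2 = - 1" using norm_minus_one[OF nonresidue]
    by blast
  have "ns_elt \<Xi> 1 \<alpha> \<beta> \<in> GH" using n H by (intro ns_elt_in_GH) auto
  from inv[OF this, of 1 1] have "M 1 1 = (\<alpha>\<^sup>2 - \<Xi> * \<beta>\<^sup>2) * M 1 1"
    by (simp add: 12 22 power2_eq_square algebra_simps)
  then have 11: "M 1 1 = 0" unfolding n by (intro eq_minus_imp_0) simp
  have 21: "M 2 1 = M 1 2" unfolding M_def by (simp add: mult.commute)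
  have "\<forall>i j. M i j = 0" unfolding forall_2 by (simp add: 11 12 21 22)
  then show ?thesis by (simp add: second_moments_vanish_def M_def)
qed

text \<open>Let \<open>c\<close> be the complex conjugation, \<open>\<sigma>\<close> a Cartan element of determinant \<open>\<delta>\<close> and \<open>\<tau> = c\<sigma>c\<close>.  Evaluating
the cocycle \<open>s\<close> on both sides of \<open>c\<sigma> = \<tau>c\<close> gives \<open>s(\<tau>) = - s(\<sigma>)\<close>, and \<open>\<sigma>\<tau> = \<tau>\<sigma>\<close> then gives
\<open>2(\<delta> - 1) s(\<sigma>) = 0\<close>.  For \<open>\<delta> = 1\<close>, multiply \<open>\<sigma>\<close>
  by a Cartan element of determinant \<open>-1\<close>: both
it and the product have already been dealt with.  The other coset consists of the products \<open>c\<sigma>\<close>.\<close>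
lemma lift_cocycle_vanishes:
  assumes N: "lifts_on Orb N" "conj_symmetric Orb N" and \<Gamma>: "map_matrix of_int \<Gamma> \<in> GH"
  shows "lift_cocycle Orb N \<Gamma> = 0"
proof -
  define s where "s \<sigma> = lift_cocycle Orb N (lift_matrix \<sigma>)" for \<sigma> :: "'p mod_ring^2^2"
  note cong = lift_cocycle_cong[OF N(1) _ _ Orb_second_moments]
  have s_eq: "lift_cocycle Orb N \<Delta> = s (map_matrix of_int \<Delta>)" if "map_matrix of_int \<Delta> \<in> GH"
    for \<Delta>
    unfolding s_def by (rule cong) (simp_all add: GH_preserves that)
  have s_mult: "s (\<sigma> ** \<tau>) = s \<tau> + det \<tau> * s \<sigma>" if "\<sigma> \<in> GH" "\<tau> \<in> GH"
    for \<sigma> \<tau>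
  proof -
    have "s (\<sigma> ** \<tau>) = lift_cocycle Orb N (lift_matrix \<sigma> ** lift_matrix \<tau>)"
      using s_eq[of "lift_matrix \<sigma> ** lift_matrix \<tau>"] GH_mult[OF that] by (simp add: map_matrix_mult2)
    also have "\<dots> = s \<tau> + of_int (det (lift_matrix \<tau>)) * s \<sigma>"
      unfolding s_def by (rule lift_cocycle_mult[OF N(1)]) (simp_all add: GH_preserves that)
    also have "of_int (det (lift_matrix \<tau>)) = det \<tau>"
      using det_map_matrix2[of "lift_matrix \<tau>", where 'a = "'p mod_ring"] by simp
    finally show ?thesis .
  qed
  let ?c = "mat2 1 0 0 (- 1) :: 'p mod_ring^2^2"
  have c_lift: "map_matrix of_int (mat2 1 0 0 (- 1)) = ?c" by (rule mat2_eqI) simp_all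
  have s_c: "s ?c = 0"
    using s_eq[of "mat2 1 0 0 (- 1)"] lift_cocycle_conj[OF N(2)] conj_in_GH by (simp add: c_lift)
  have det_c: "det ?c = - 1" by (simp add: det_2)
  have nontriv: "s (ns_elt \<Xi> 1 \<alpha> \<beta>) = 0"
    if d: "\<alpha>\<^sup>2 - \<Xi> * \<beta>\<^sup>2 \<in> H" "\<alpha>\<^sup>2 - \<Xi> * \<beta>\<^sup>2 \<noteq> 1"
      for \<alpha> \<beta>
  proof -
    define \<delta> where "\<delta> = \<alpha>\<^sup>2 - \<Xi> * \<beta>\<^sup>2"
    let ?s = "ns_elt \<Xi> 1 \<alpha> \<beta>" and ?t = "ns_elt \<Xi> 1 \<alpha> (- \<beta>)"
    have in_GH: "?s \<in> GH" "?t \<in> GH" using d by (auto intro!: ns_elt_in_GH)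
    have det: "det ?s = \<delta>" "det ?t = \<delta>" by (simp_all add: det_ns_elt \<delta>_def)
    have "?c ** ?s = ?t ** ?c" by (rule mat2_eqI) simp_all
    then have "s ?s + det ?s * s ?c = s ?c + det ?c * s ?t"
      using s_mult[OF conj_in_GH in_GH(1)] s_mult[OF in_GH(2) conj_in_GH] by simp
    then have st: "s ?t = - s ?s" by (simp add: s_c det_c)
    have "?s ** ?t = ?t ** ?s" by (rule mat2_eqI) (simp_all add: algebra_simps)
    then have "s ?t + \<delta> * s ?s = s ?s + \<delta> * s ?t"
      using s_mult[OF in_GH] s_mult[OF in_GH(2,1)] by (simp add: det)
    then have "2 * ((\<delta> - 1) * s ?s) = 0" by (simp add: st algebra_simps)
    then show ?thesis using d(2) two_nz by (simp add: \<delta>_def)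
  qed
  have cartan: "s (ns_elt \<Xi> 1 \<alpha> \<beta>) = 0" if d: "\<alpha>\<^sup>2 - \<Xi> * \<beta>\<^sup>2 \<in> H"
    for \<alpha> \<beta>
  proof (cases "\<alpha>\<^sup>2 - \<Xi> * \<beta>\<^sup>2 = 1")
    case True
    obtain \<alpha>' \<beta>' where n: "\<alpha>'\<^sup>2 - \<Xi> * \<beta>'\<^sup>2 = - 1"
      using norm_minus_one[OF nonresidue] by blast
    have ne: "(- 1 :: 'p mod_ring) \<noteq> 1" using eq_minus_imp_0[of 1] by auto
    let ?s = "ns_elt \<Xi> 1 \<alpha> \<beta>" and ?r = "ns_elt \<Xi> 1 \<alpha>' \<beta>'"
    have in_GH: "?s \<in> GH" "?r \<in> GH" using d n H by (auto intro!: ns_elt_in_GH)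
    define \<alpha>'' \<beta>'' where "\<alpha>'' = \<alpha> * \<alpha>' + \<Xi> * \<beta> * \<beta>'" and "\<beta>'' = \<alpha> * \<beta>' + \<beta> * \<alpha>'"
    have sr: "?s ** ?r = ns_elt \<Xi> 1 \<alpha>'' \<beta>''" by (simp add: ns_elt_mult \<alpha>''_def \<beta>''_def)
    have "det (?s ** ?r) = - 1" unfolding det_mul by (simp add: det_ns_elt True n)
    then have n'': "\<alpha>''\<^sup>2 - \<Xi> * \<beta>''\<^sup>2 = - 1" unfolding sr by (simp add: det_ns_elt)
    have "s (?s ** ?r) = 0" unfolding sr using nontriv[of \<alpha>'' \<beta>''] H ne by (simp add: n'')
    moreover have "s ?r = 0" using nontriv[of \<alpha>' \<beta>'] H ne by (simp add: n)
    ultimately show ?thesis using s_mult[OF in_GH] by (simp add: det_ns_elt n)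
  qed (rule nontriv[OF d])
  define g where "g = (map_matrix of_int \<Gamma> :: 'p mod_ring^2^2)"
  have g: "g \<in> GH" using \<Gamma> by (simp add: g_def)
  then obtain \<epsilon> \<alpha> \<beta> where e: "\<epsilon> = 1 \<or> \<epsilon> = - 1" "g = ns_elt \<Xi> \<epsilon> \<alpha> \<beta>"
    unfolding det_in_def ns_normalizer_iff by blast
  have dH: "\<epsilon> * (\<alpha>\<^sup>2 - \<Xi> * \<beta>\<^sup>2) \<in> H" using g e(2)
    by (simp add: det_in_def det_ns_elt)
  have "s g = 0"
  proof (cases "\<epsilon> = 1")
    case True
    then show ?thesis using cartan[of \<alpha> \<beta>] dH e by simp
  next
    case False
    then have \<epsilon>: "\<epsilon> = - 1" using e by simp
    have dH': "\<alpha>\<^sup>2 - \<Xi> * \<beta>\<^sup>2 \<in> H" using H(3)[OF dH H(4)] by (simp add: \<epsilon>)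
    have "g = ?c ** ns_elt \<Xi> 1 \<alpha> \<beta> " unfolding e(2) \<epsilon> by (rule mat2_eqI) simp_all
    moreover have "ns_elt \<Xi> 1 \<alpha> \<beta> \<in> GH" using dH' by (intro ns_elt_in_GH) auto
    ultimately show ?thesis using s_mult[OF conj_in_GH, of "ns_elt \<Xi> 1 \<alpha> \<beta>"] cartan[OF dH'] s_c by simp
  qed
  then show ?thesis using s_eq[of \<Gamma>] \<Gamma> by (simp add: g_def)
qed

end

section \<open>Galois theory of the cyclotomic field\<close>

abbreviation ipoly :: "int poly \<Rightarrow> 'a::comm_ring_1 \<Rightarrow> 'a" where
  "ipoly f z \<equiv> poly (map_poly of_int f) z"

text \<open>The cyclotomic polynomial for prime \<open>p\<close>.\<close>
definition Phi :: "nat \<Rightarrow> int poly" where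
  "Phi p = (\<Sum>i<p. monom 1 i)"

lemma ipoly_Phi: "ipoly (Phi p) z = (\<Sum>i<p. z ^ i)"
  by (simp add: Phi_def hom_distribs poly_sum poly_monom)

lemma Phi_times_linear: "[:-1, 1:] * Phi p = monom 1 p - 1"
proof -
  have "([:0, 1:] - 1) * (\<Sum>i<p. [:0, 1:] ^ i) = [:0, 1:] ^ p - (1 :: int poly)"
    by (rule power_diff_1_eq[symmetric])
  moreover have "[:0, 1:] - 1 = ([:-1, 1:] :: int poly)" by (simp add: one_pCons)
  ultimately show ?thesis by (simp add: Phi_def monom_altdef)
qed

lemma degree_Phi: assumes "p > 0" shows "degree (Phi p) = p - 1" "lead_coeff (Phi p) = 1"
proof -
  have c: "coeff (Phi p) n = (if n < p then 1 else 0)" for n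
    by (auto simp: Phi_def coeff_sum)
  have "degree (Phi p) \<le> p - 1" by (rule degree_le) (auto simp: c)
  moreover have "p - 1 \<le> degree (Phi p)" by (rule le_degree) (use assms in \<open>simp add: c\<close>)
  ultimately show "degree (Phi p) = p - 1" by simp
  then show "lead_coeff (Phi p) = 1" using assms by (simp add: c)
qed

text \<open>Modulo \<open>p\<close> the cyclotomic polynomial is \<open>(X - 1)\<^sup>p\<^sup>-\<^sup>1\<close>, so every nonconstant factor vanishes at 1 modulo \<open>p\<close>.\<close>
lemma dvd_Phi_value_at_1:
  fixes g h :: "int poly"
  assumes gh: "g * h = Phi CARD('p::prime_card)" and deg: "degree g > 0"
  shows "int CARD('p) dvd poly g 1"
proof (rule ccontr)
  assume not: "\<not> ?thesis"
  let ?p = "CARD('p)" and ?X = "[:-1, 1:] :: 'p mod_ring poly"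
  define G H :: "'p mod_ring poly" where "G = map_poly of_int g" and "H = map_poly of_int h"
  have p0: "?p > 0" by simp
  have nz: "g \<noteq> 0" "h \<noteq> 0" using gh degree_Phi(2)[OF p0] by auto
  have lead: "lead_coeff g * lead_coeff h = 1"
    using degree_Phi(2)[OF p0] by (simp add: gh[symmetric] lead_coeff_mult)
  then have lead': "of_int (lead_coeff g) * of_int (lead_coeff h) = (1 :: 'p mod_ring)"
    by (metis of_int_1 of_int_mult)
  have degG: "degree G = degree g" unfolding G_def
    by (rule degree_map_poly) (use lead' in auto)
  have degH: "degree H = degree h" unfolding H_def
    by (rule degree_map_poly) (use lead' in auto)
  have "degree g + degree h = ?p - 1" using degree_Phi(1)[OF p0] nz by (simp add: gh[symmetric] degree_mult_eq)
  have "?X * (G * H) = map_poly of_int ([:-1, 1:] * Phi ?p)"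
    by (simp add: G_def H_def gh[symmetric] hom_distribs)
  also have "\<dots> = [:0, 1:] ^ ?p - 1" unfolding Phi_times_linear by (simp add: hom_distribs monom_altdef)
  also have "\<dots> = ([:0, 1:] - 1) ^ ?p"
  proof -
    have "([:0, 1:] + (- 1 :: 'p mod_ring poly)) ^ ?p = [:0, 1:] ^ ?p + (- 1) ^ ?p"
      by (rule freshmans_dream) (simp_all add: prime_card)
    moreover have "(- 1 :: 'p mod_ring poly) ^ ?p = - (1 ^ ?p)"
      by (rule minus_power_prime_CHAR) (simp_all add: prime_card)
    ultimately show ?thesis by simp
  qed
  also have "[:0, 1:] - 1 = ?X" by (simp add: one_pCons)
  also have "?X ^ ?p = ?X * ?X ^ (?p - 1)" by (metis p0 power_eq_if neq0_conv)
  finally have GH: "G * H = ?X ^ (?p - 1)" by (subst (asm) mult_cancel_left) auto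
  have "poly G 1 = of_int (poly g 1)" unfolding G_def
    by (metis of_int_1 of_int_hom.poly_map_poly)
  then have "poly G 1 \<noteq> 0" using not by (simp add: of_int_eq_0_iff_char_dvd)
  then have "order 1 G = 0" by (simp add: order_root)
  moreover have "order 1 (G * H) = order 1 G + order 1 H"
    by (rule order_mult) (simp add: GH)
  moreover have "order 1 (G * H) = ?p - 1" unfolding GH by (rule order_power_n_n)
  moreover have "order 1 H \<le> degree H"
  proof (rule order_degree)
    have "coeff H (degree h) \<noteq> 0" using lead' by (auto simp: H_def)
    then show "H \<noteq> 0" by auto
  qed
  ultimately show False using degH \<open>degree g + degree h = ?p - 1\<close> deg by simp
qed

text \<open>This is the irreducibility of the cyclotomic polynomial \<open>\<Phi>\<close> in the form in which it is needed.  A primitive integer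
polynomial \<open>m\<close> of least degree with root \<open>z\<close> divides \<open>\<Phi>\<close>
  by Gauss' lemma.  If the cofactor were not constant,
then \<open>p\<^sup>2\<close> would divide \<open>\<Phi>(1) = p\<close>.  Hence \<open>m\<close> vanishes at \<open>w\<close>, and so does \<open>f\<close>, which \<open>m\<close>
divides over the rationals.\<close>
lemma Phi_minimal:
  fixes f :: "int poly" and z w :: complex
  assumes f: "ipoly f z = 0" and z: "ipoly (Phi CARD('p::prime_card)) z = 0" and w: "ipoly (Phi CARD('p)) w = 0"
  shows "ipoly f w = 0"
proof -
  let ?p = "CARD('p)" 
  have p0: "?p > 0" by simp
  define Q where "Q m \<longleftrightarrow> m \<noteq> 0 \<and> ipoly m z = 0" for m :: "int poly"
  have "Q (Phi ?p)" using z degree_Phi(2)[OF p0] by (auto simp: Q_def)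
  then obtain m0 where m0: "Q m0" "\<And>m. Q m \<Longrightarrow> degree m0 \<le> degree m"
    using ex_has_least_nat[of Q _ degree] by blast
  define m where "m = primitive_part m0"
  have m0_eq: "m0 = smult (content m0) m" by (simp add: m_def)
  have "content m0 \<noteq> 0" using m0 by (simp add: Q_def)
  have m: "Q m" "degree m = degree m0" "content m = 1"
  proof -
    have "ipoly m0 z = 0" using m0(1) by (simp add: Q_def)
    then have "ipoly (smult (content m0) m) z = 0" using m0_eq by metis
    then have "of_int (content m0) * ipoly m z = 0" by (simp only: hom_distribs poly_smult)
    then show "Q m" using m0(1) by (simp add: Q_def m_def)
    show "degree m = degree m0" by (simp add: m_def)
    show "content m = 1" using m0(1) by (simp add: m_def Q_def)
  qed
  have divides: "\<exists>a q. a \<noteq> 0 \<and> smult a g = m * q" if g: "ipoly g z = 0" for g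
  proof -
    define r where "r = pseudo_mod g m"
    have mnz: "m \<noteq> 0" using m by (simp add: Q_def)
    obtain a q where aq: "a \<noteq> 0" "smult a g = m * q + r" 
      using pseudo_mod(1)[OF mnz] unfolding r_def by blast
    have "ipoly (smult a g) z = ipoly (m * q + r) z" by (simp only: aq)
    then have "ipoly r z = 0" using g m(1) by (simp add: hom_distribs Q_def)
    then have "r = 0" using pseudo_mod(2)[OF mnz, of g] m0(2)[of r] m(2) unfolding r_def[symmetric] 
      by (metis Q_def leD)
    with aq show ?thesis by auto
  qed
  obtain a q where aq: "a \<noteq> 0" "smult a (Phi ?p) = m * q" using divides[OF z] by blast
  have "smult a (Phi ?p) = [:a:] * Phi ?p" by simp
  then have "[:a:] dvd m * q" unfolding aq(2)[symmetric] by (simp only: dvd_triv_left)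
  then have "a dvd content (m * q)" by (simp add: const_poly_dvd_iff_dvd_content)
  then have "[:a:] dvd q" by (simp add: content_mult m const_poly_dvd_iff_dvd_content)
  then obtain q' where q': "q = smult a q'" by (auto elim: dvdE)
  have Phi_eq: "m * q' = Phi ?p"
  proof -
    have "smult a (Phi ?p) = smult a (m * q')" by (simp add: aq(2) q')
    then show ?thesis using aq(1) smult_cancel by metis
  qed
  have degm: "degree m > 0"
  proof (rule ccontr)
    assume "\<not> degree m > 0"
    then obtain c where "m = [:c:]" using degree_eq_zeroE by blast
    then show False using m(1) by (simp add: Q_def hom_distribs)
  qed
  have "degree q' = 0"
  proof (rule ccontr)
    assume "degree q' \<noteq> 0"
    then have "int ?p dvd poly m 1" "int ?p dvd poly q' 1"
      using dvd_Phi_value_at_1[where 'p='p, OF Phi_eq degm] 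
        dvd_Phi_value_at_1[where 'p='p, of q' m] Phi_eq by (simp_all add: mult.commute)
    then have "int ?p * int ?p dvd poly m 1 * poly q' 1" by (rule mult_dvd_mono)
    also have "poly m 1 * poly q' 1 = int ?p" 
      unfolding poly_mult[symmetric] Phi_eq by (simp add: Phi_def poly_sum poly_monom)
    finally have "int ?p * int ?p \<le> int ?p" by (rule zdvd_imp_le) simp
    moreover have "?p > 1" using prime_card[where 'a='p] prime_gt_1_nat by blast
    ultimately show False by simp
  qed
  then obtain c where c: "q' = [:c:]" using degree_eq_zeroE by blast
  have "c \<noteq> 0" using Phi_eq c degree_Phi(2)[OF p0] by auto
  have "ipoly m w = 0"
  proof -
    have "ipoly (m * q') w = 0" unfolding Phi_eq by (rule w)
    then show ?thesis using \<open>c \<noteq> 0\<close> by (simp add: c hom_distribs)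
  qed
  moreover obtain b r where br: "b \<noteq> 0" "smult b f = m * r" using divides[OF f] by blast
  ultimately have "ipoly (smult b f) w = 0" by (simp add: br(2) hom_distribs)
  then show ?thesis using br(1) by (simp add: hom_distribs)
qed

lemma zeta_power: "zeta p ^ n = 1 \<longleftrightarrow> p dvd n" if "p > 0"
proof -
  have "zeta p ^ n = exp (2 * of_real pi * \<i> * of_nat n / of_nat p)"
    by (simp add: zeta_def exp_of_nat_mult[symmetric] mult_ac)
  also have "\<dots> = 1 \<longleftrightarrow> p dvd n" using that by (subst complex_root_unity_eq_1) auto
  finally show ?thesis .
qed

lemma Phi_zeta_power:
  assumes "\<not> CARD('p::prime_card) dvd k" 
  shows "ipoly (Phi CARD('p)) (zeta CARD('p) ^ k) = 0"
proof -
  let ?p = "CARD('p)" let ?w = "zeta ?p ^ k"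
  have "?w \<noteq> 1" using assms by (simp add: zeta_power)
  moreover have "?w ^ ?p = 1" by (simp add: power_mult[symmetric] zeta_power)
  moreover have "(?w - 1) * (\<Sum>i<?p. ?w ^ i) = ?w ^ ?p - 1" by (rule power_diff_1_eq[symmetric])
  ultimately show ?thesis by (simp add: ipoly_Phi)
qed

lemma ipoly_zeta_conjugate:
  assumes "\<not> CARD('p::prime_card) dvd k" "\<not> CARD('p) dvd l" 
    "ipoly f (zeta CARD('p) ^ k) = 0" 
  shows "ipoly f (zeta CARD('p) ^ l) = 0"
  using Phi_minimal[where 'p='p, OF assms(3)] Phi_zeta_power[OF assms(1)] Phi_zeta_power[OF assms(2)] by blast

lemma ipoly_zeta_power_eq_0_iff:
  assumes "\<not> CARD('p::prime_card) dvd k" 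
  shows "ipoly f (zeta CARD('p) ^ k) = 0 \<longleftrightarrow> ipoly f (zeta CARD('p)) = 0"
proof -
  have "\<not> CARD('p) dvd 1" using prime_card[where 'a='p] by auto
  then show ?thesis
    using ipoly_zeta_conjugate[where 'p='p, OF assms, of 1 f] ipoly_zeta_conjugate[where 'p='p, of 1, OF _ assms, of f]
      by auto
qed

lemma is_subfieldD:
  assumes "is_subfield F"
  shows "1 \<in> F" "0 \<in> F" "x \<in> F \<Longrightarrow> y \<in> F \<Longrightarrow> x - y \<in> F" "x \<in> F \<Longrightarrow> y \<in> F \<Longrightarrow> x * y \<in> F"
    "x \<in> F \<Longrightarrow> inverse x \<in> F" "x \<in> F \<Longrightarrow> - x \<in> F" "x \<in> F \<Longrightarrow> y \<in> F \<Longrightarrow> x + y \<in> F"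
proof -
  show 1: "1 \<in> F" and d: "\<And>x y. x \<in> F \<Longrightarrow> y \<in> F \<Longrightarrow> x - y \<in> F"
    and "x \<in> F \<Longrightarrow> y \<in> F \<Longrightarrow> x * y \<in> F" "x \<in> F \<Longrightarrow> inverse x \<in> F"
    using assms by (auto simp: is_subfield_def)
  show 0: "0 \<in> F" using d[OF 1 1] by simp
  show m: "\<And>x. x \<in> F \<Longrightarrow> - x \<in> F" using d[OF 0] by simp
  show "x \<in> F \<Longrightarrow> y \<in> F \<Longrightarrow> x + y \<in> F" using d[of x "- y"] m[of y] by simp
qed

lemma ipoly_in_subfield:
  assumes F: "is_subfield F" and z: "z \<in> F" shows "ipoly f z \<in> F"
proof -
  have nat: "of_nat n \<in> F" for n
    by (induction n) (use is_subfieldD[OF F] in auto)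
  have int: "of_int n \<in> F" for n
    using nat[of "nat n"] nat[of "nat (- n)"] is_subfieldD(6)[OF F] by (cases "n \<ge> 0") force+
  show ?thesis
  proof (induction f)
    case (pCons a f)
    then show ?case using is_subfieldD[OF F] z int by (simp add: hom_distribs)
  qed (use is_subfieldD(2)[OF F] in simp)
qed

text \<open>Allowing arbitrary quotients makes closure under inverses obvious.\<close>
lemma cyclotomic_field_eq:
  "cyclotomic_field p = {ipoly f (zeta p) / ipoly g (zeta p) |f g. ipoly g (zeta p) \<noteq> 0}" (is "_ = ?S")
proof
  let ?z = "zeta p"
  have sub: "is_subfield ?S"
    unfolding is_subfield_def
  proof (intro conjI ballI)
    show "1 \<in> ?S" by (auto intro!: exI[of _ 1])
    fix x assume "x \<in> ?S"
    then obtain f g where x: "x = ipoly f ?z / ipoly g ?z" "ipoly g ?z \<noteq> 0" by blast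
    show "inverse x \<in> ?S"
    proof (cases "ipoly f ?z = 0")
      case True
      then have "inverse x = ipoly 0 ?z / ipoly 1 ?z \<and> ipoly 1 ?z \<noteq> 0" by (simp add: x)
      then show ?thesis by blast
    next
      case False
      then have "inverse x = ipoly g ?z / ipoly f ?z" by (simp add: x)
      with False show ?thesis by blast
    qed
    fix y assume "y \<in> ?S"
    then obtain f' g' where y: "y = ipoly f' ?z / ipoly g' ?z" "ipoly g' ?z \<noteq> 0" by blast
    have "x - y = ipoly (f * g' - f' * g) ?z / ipoly (g * g') ?z \<and> ipoly (g * g') ?z \<noteq> 0"
      using x(2) y(2) by (simp add: x y hom_distribs diff_frac_eq)
    then show "x - y \<in> ?S" by blast
    have "x * y = ipoly (f * f') ?z / ipoly (g * g') ?z \<and> ipoly (g * g') ?z \<noteq> 0"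
      using x(2) y(2) by (simp add: x y hom_distribs)
    then show "x * y \<in> ?S" by blast
  qed
  have "?z = ipoly [:0, 1:] ?z / ipoly 1 ?z \<and> ipoly 1 ?z \<noteq> 0" by (simp add: hom_distribs)
  then have "?z \<in> ?S" by blast
  with sub show "cyclotomic_field p \<subseteq> ?S" unfolding cyclotomic_field_def by (intro hull_minimal) auto
  show "?S \<subseteq> cyclotomic_field p"
  proof
    fix x assume "x \<in> ?S"
    then obtain f g where x: "x = ipoly f ?z / ipoly g ?z" by blast
    have "x \<in> F" if "is_subfield F" "{?z} \<subseteq> F" for F
      using that ipoly_in_subfield[OF that(1), of ?z] is_subfieldD[OF that(1)] unfolding x divide_inverse by auto
    then show "x \<in> cyclotomic_field p" unfolding cyclotomic_field_def hull_def by blast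
  qed
qed

lemma ipoly_zeta_in_cyclotomic_field: "ipoly f (zeta p) \<in> cyclotomic_field p"
proof -
  have "ipoly f (zeta p) = ipoly f (zeta p) / ipoly 1 (zeta p) \<and> ipoly 1 (zeta p) \<noteq> 0" by simp
  then show ?thesis unfolding cyclotomic_field_eq by blast
qed

lemma ring_map_ipoly:
  fixes s :: "complex \<Rightarrow> complex"
  assumes add: "\<And>x y. x \<in> F \<Longrightarrow> y \<in> F \<Longrightarrow> s (x + y) = s x + s y"
    and mult: "\<And>x y. x \<in> F \<Longrightarrow> y \<in> F \<Longrightarrow> s (x * y) = s x * s y"
    and one: "s 1 = 1" and F: "is_subfield F" and z: "z \<in> F"
  shows "s (ipoly f z) = ipoly f (s z)"
proof -
  note sf = is_subfieldD[OF F]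
  have 0: "s 0 = 0" using add[OF sf(2,2)] by simp
  have nat_in: "of_nat n \<in> F" for n by (induction n) (use sf in auto)
  have nat: "s (of_nat n) = of_nat n" for n
    by (induction n) (use 0 one add[OF sf(1) nat_in] in auto)
  have neg: "s (- x) = - s x" if "x \<in> F" for x
    using add[OF that sf(6)[OF that]] 0 by (simp add: add_eq_0_iff)
  have int_in: "of_int n \<in> F" for n
    using nat_in[of "nat n"] nat_in[of "nat (- n)"] sf(6) by (cases "n \<ge> 0") force+
  have int: "s (of_int n) = of_int n" for n
  proof (cases "n \<ge> 0")
    case True
    then show ?thesis using nat[of "nat n"] by simp
  next
    case False
    then show ?thesis using nat[of "nat (- n)"] neg[OF nat_in[of "nat (- n)"]] by simp
  qed
  show ?thesis
  proof (induction f)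
    case 0
    then show ?case using \<open>s 0 = 0\<close> by simp
  next
    case (pCons a f)
    have "z * ipoly f z \<in> F" using sf(4)[OF z ipoly_in_subfield[OF F z]] .
    then have "s (of_int a + z * ipoly f z) = of_int a + s z * ipoly f (s z)"
      using add[OF int_in] mult[OF z ipoly_in_subfield[OF F z]] int pCons by simp
    then show ?case by (simp add: hom_distribs)
  qed
qed

lemma subfield_cyclotomic: "is_subfield (cyclotomic_field p)" and zeta_in_cyclotomic: "zeta p \<in> cyclotomic_field p"
proof -
  show "zeta p \<in> cyclotomic_field p" unfolding cyclotomic_field_def by (rule hull_inc) simp
  show "is_subfield (cyclotomic_field p)" unfolding cyclotomic_field_def
    by (rule hull_in) (auto simp: is_subfield_def)
qed

text \<open>Let \<open>k\<close> represent \<open>d\<close>.  By \<open>ipoly_zeta_power_eq_0_iff\<close>, the assignment \<open>f(\<zeta>)/g(\<zeta>) \<mapsto> f(\<zeta>\<^sup>k)/g(\<zeta>\<^sup>k)\<close> is a well-defined injection; it is onto because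
\<open>\<zeta>\<close> is a power of \<open>\<zeta>\<^sup>k\<close>.  So the automorphism described in \<open>cyclotomic_galois_def\<close> exists, and its values on
quotients determine it.\<close>
lemma cyclotomic_galois_ipoly:
  fixes d :: "'p::prime_card mod_ring"
  assumes d: "d \<noteq> 0"
  shows "cyclotomic_galois d (ipoly f (zeta CARD('p))) = ipoly f (zeta CARD('p) ^ nat (to_int_mod_ring d))"
proof -
  let ?z = "zeta CARD('p)" and ?F = "cyclotomic_field CARD('p)"
  define k where "k = nat (to_int_mod_ring d)"
  have k: "to_int_mod_ring d = int k" unfolding k_def 
    using range_to_int_mod_ring[where 'a='p] by (metis atLeastLessThan_iff int_nat_eq rangeI)
  have dk: "d = of_nat k" by (metis k of_int_of_nat_eq of_int_mod_ring_to_int_mod_ring of_int_of_int_mod_ring)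
  have nk: "\<not> CARD('p) dvd k"
    using d unfolding dk by (simp add: of_nat_eq_0_iff_char_dvd)
  note iff = ipoly_zeta_power_eq_0_iff[where 'p='p, OF nk]
  note F = subfield_cyclotomic[of "CARD('p)"] and zF = zeta_in_cyclotomic[of "CARD('p)"]
  define Q where "Q s \<longleftrightarrow> s \<in> extensional ?F \<and> bij_betw s ?F ?F \<and>
     (\<forall>x\<in>?F. \<forall>y\<in>?F. s (x + y) = s x + s y \<and> s (x * y) = s x * s y) \<and> s ?z = ?z powi to_int_mod_ring d" for s
  have ratio: "s (ipoly f ?z / ipoly g ?z) = ipoly f (?z ^ k) / ipoly g (?z ^ k)"
    if s: "Q s" and g: "ipoly g ?z \<noteq> 0" for s f g
  proof -
    have add: "\<And>x y. x \<in> ?F \<Longrightarrow> y \<in> ?F \<Longrightarrow> s (x + y) = s x + s y"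
      and mult: "\<And>x y. x \<in> ?F \<Longrightarrow> y \<in> ?F \<Longrightarrow> s (x * y) = s x * s y" and inj: "inj_on s ?F"
      using s by (auto simp: Q_def bij_betw_def)
    have s0: "s 0 = 0" using add[of 0 0] is_subfieldD(2)[OF F] by simp
    have "s 1 \<noteq> s 0" using inj_onD[OF inj, of 1 0] is_subfieldD(1,2)[OF F] by auto
    moreover have "s 1 * s 1 = s 1" using mult[of 1 1] is_subfieldD(1)[OF F] by simp
    ultimately have s1: "s 1 = 1" using s0 by simp
    have sz: "s ?z = ?z ^ k" using s by (simp add: Q_def k)
    note ev = ring_map_ipoly[OF add mult s1 F zF, unfolded sz]
    have in_F: "ipoly f ?z / ipoly g ?z \<in> ?F" unfolding cyclotomic_field_eq using g by blast
    have "s (ipoly f ?z / ipoly g ?z) * s (ipoly g ?z) = s (ipoly f ?z)"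
      using mult[OF in_F ipoly_in_subfield[OF F zF, of g]] g by simp
    then have "s (ipoly f ?z / ipoly g ?z) * ipoly g (?z ^ k) = ipoly f (?z ^ k)"
      using ev[of f] ev[of g] by metis
    moreover have "ipoly g (?z ^ k) \<noteq> 0" using g iff[of g] by simp
    ultimately show ?thesis by (metis nonzero_mult_div_cancel_right)
  qed
  have unique: "s = s'" if "Q s" "Q s'" for s s'
  proof (rule extensionalityI)
    show "s \<in> extensional ?F" "s' \<in> extensional ?F" using that by (auto simp: Q_def)
    show "s x = s' x" if "x \<in> ?F" for x
      using that ratio[OF \<open>Q s\<close>] ratio[OF \<open>Q s'\<close>] unfolding cyclotomic_field_eq by auto
  qed
  have exists: "\<exists>s. Q s"
  proof -
    \<comment> \<open>The graph of the automorphism.\<close>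
    define R where "R x y \<longleftrightarrow> (\<exists>f g. ipoly g ?z \<noteq> 0 \<and> x = ipoly f ?z / ipoly g ?z \<and> y = ipoly f (?z ^ k) / ipoly g (?z ^ k))" for x y
    have R_iff: "x = x' \<longleftrightarrow> y = y'" if R: "R x y" "R x' y'" for x x' y y'
    proof -
      obtain f g f' g' where *: "ipoly g ?z \<noteq> 0" "x = ipoly f ?z / ipoly g ?z" "y = ipoly f (?z ^ k) / ipoly g (?z ^ k)"
         "ipoly g' ?z \<noteq> 0" "x' = ipoly f' ?z / ipoly g' ?z" "y' = ipoly f' (?z ^ k) / ipoly g' (?z ^ k)"
        using R unfolding R_def by blast
      have "x = x' \<longleftrightarrow> ipoly (f * g' - f' * g) ?z = 0" using * by (simp add: hom_distribs frac_eq_eq)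
      also have "\<dots> \<longleftrightarrow> ipoly (f * g' - f' * g) (?z ^ k) = 0" by (rule iff[symmetric])
      also have "\<dots> \<longleftrightarrow> y = y'" using * iff[of g] iff[of g'] by (simp add: hom_distribs frac_eq_eq)
      finally show ?thesis .
    qed
    have R_ex: "\<exists>y. R x y" if "x \<in> ?F" for x using that unfolding cyclotomic_field_eq R_def by blast
    have R_in: "x \<in> ?F" "y \<in> ?F" if R: "R x y" for x y
    proof -
      obtain f g where *: "ipoly g ?z \<noteq> 0" "x = ipoly f ?z / ipoly g ?z" "y = ipoly f (?z ^ k) / ipoly g (?z ^ k)"
        using R unfolding R_def by blast
      show "x \<in> ?F" unfolding cyclotomic_field_eq * using *(1) by blast
      have "?z ^ k \<in> ?F"
      proof -
        have "?z ^ n \<in> ?F" for n by (induction n) (use is_subfieldD[OF F] zF in auto)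
        then show ?thesis .
      qed
      then show "y \<in> ?F" unfolding * divide_inverse
        by (intro is_subfieldD(4,5)[OF F] ipoly_in_subfield[OF F])
    qed
    have R_sur: "\<exists>x. R x y" if yF: "y \<in> ?F" for y
    proof -
      obtain f g where y: "y = ipoly f ?z / ipoly g ?z" "ipoly g ?z \<noteq> 0" using yF unfolding cyclotomic_field_eq
        by blast
      obtain l where l: "[k * l = 1] (mod CARD('p))"
        using cong_solve_coprime_nat[of k "CARD('p)"] prime_imp_coprime[OF prime_card nk] by (auto simp: coprime_commute)
      have zkl: "(?z ^ k) ^ l = ?z"
      proof -
        have "(k * l) mod CARD('p) = 1"
          using l prime_gt_1_nat[OF prime_card[where 'a='p]] by (simp add: cong_def)
        then have kl: "k * l = CARD('p) * (k * l div CARD('p)) + 1" by (metis mult_div_mod_eq)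
        have "(?z ^ k) ^ l = ?z ^ (CARD('p) * (k * l div CARD('p)) + 1)" 
          by (metis kl power_mult)
        also have "\<dots> = (?z ^ CARD('p)) ^ (k * l div CARD('p)) * ?z" by (simp add: power_mult)
        also have "?z ^ CARD('p) = 1" by (simp add: zeta_power)
        finally show ?thesis by simp
      qed
      have c: "ipoly (f \<circ>\<^sub>p monom 1 l) (?z ^ k) = ipoly f ?z" for f
      proof -
        have "ipoly (f \<circ>\<^sub>p monom 1 l) (?z ^ k) = ipoly f ((?z ^ k) ^ l)"
          by (simp add: of_int_hom.map_poly_pcompose poly_pcompose poly_monom)
        then show ?thesis by (simp add: zkl)
      qed
      have "ipoly (g \<circ>\<^sub>p monom 1 l) ?z \<noteq> 0" using iff[of "g \<circ>\<^sub>p monom 1 l"] c[of g] y(2)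
        by simp
      then have "R (ipoly (f \<circ>\<^sub>p monom 1 l) ?z / ipoly (g \<circ>\<^sub>p monom 1 l) ?z) y"
        unfolding R_def y(1) c[symmetric] by blast
      then show ?thesis by blast
    qed
    define s where "s = (\<lambda>x\<in>?F. SOME y. R x y)"
    have Rs: "R x (s x)" if "x \<in> ?F" for x using someI_ex[OF R_ex[OF that]] that by (simp add: s_def)
    have s_eq: "s x = y" if "R x y" for x y using R_iff[OF that Rs[OF R_in(1)[OF that]]] by simp
    have R_add: "R (x + x') (y + y')" and R_mult: "R (x * x') (y * y')" if xy: "R x y" "R x' y'" for x x' y y'
    proof -
      obtain f g f' g' where *: "ipoly g ?z \<noteq> 0" "x = ipoly f ?z / ipoly g ?z" "y = ipoly f (?z ^ k) / ipoly g (?z ^ k)"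
         "ipoly g' ?z \<noteq> 0" "x' = ipoly f' ?z / ipoly g' ?z" "y' = ipoly f' (?z ^ k) / ipoly g' (?z ^ k)"
        using xy unfolding R_def by blast
      have nz: "ipoly (g * g') ?z \<noteq> 0" "ipoly g (?z ^ k) \<noteq> 0" "ipoly g' (?z ^ k) \<noteq> 0" 
        using * iff[of g] iff[of g'] by (simp_all add: hom_distribs)
      have "x + x' = ipoly (f * g' + f' * g) ?z / ipoly (g * g') ?z"
        "y + y' = ipoly (f * g' + f' * g) (?z ^ k) / ipoly (g * g') (?z ^ k)"
        using * nz by (simp_all add: hom_distribs add_frac_eq)
      with nz(1) show "R (x + x') (y + y')" unfolding R_def by blast
      have "x * x' = ipoly (f * f') ?z / ipoly (g * g') ?z"
        "y * y' = ipoly (f * f') (?z ^ k) / ipoly (g * g') (?z ^ k)"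
        using * by (simp_all add: hom_distribs)
      with nz(1) show "R (x * x') (y * y')" unfolding R_def by blast
    qed
    have "Q s" unfolding Q_def
    proof (intro conjI ballI)
      show "s \<in> extensional ?F" by (simp add: s_def)
      show "bij_betw s ?F ?F" unfolding bij_betw_def
      proof
        show "inj_on s ?F" by (rule inj_onI) (metis R_iff Rs)
        show "s ` ?F = ?F"
        proof
          show "s ` ?F \<subseteq> ?F" using R_in(2) Rs by blast
          show "?F \<subseteq> s ` ?F"
          proof
            fix y assume "y \<in> ?F"
            then obtain x where "R x y" using R_sur by blast
            then show "y \<in> s ` ?F" using s_eq R_in(1) by blast
          qed
        qed
      qed
      show "s (x + y) = s x + s y" "s (x * y) = s x * s y" if "x \<in> ?F" "y \<in> ?F" for x y
        using s_eq[OF R_add[OF Rs[OF that(1)] Rs[OF that(2)]]] s_eq[OF R_mult[OF Rs[OF that(1)] Rs[OF that(2)]]] by auto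
      have "R ?z (?z ^ k)" unfolding R_def by (rule exI[of _ "[:0, 1:]"], rule exI[of _ 1]) (simp add: hom_distribs)
      then show "s ?z = ?z powi to_int_mod_ring d" using s_eq by (simp add: k)
    qed
    then show ?thesis by blast
  qed
  then obtain s where s: "Q s" by blast
  have "cyclotomic_galois d = s" unfolding cyclotomic_galois_def
    by (rule the_equality) (use s unique in \<open>auto simp: Q_def\<close>)
  then show ?thesis using ratio[OF s, of 1 f] by (simp add: k_def)
qed

section \<open>Power series whose coefficients are integer polynomials\<close>

text \<open>The same integer polynomials \<open>R k\<close> serve all \<open>\<omega>\<close>.  Consequently a Galois automorphism that maps \<open>\<zeta>\<close> to \<open>\<zeta>\<^sup>k\<close>
maps the coefficients of \<open>F \<zeta>\<close> to those of \<open>F (\<zeta> ^ k)\<close>.\<close>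
definition int_poly_coeffs :: "(complex \<Rightarrow> complex \<Rightarrow> complex) \<Rightarrow> (nat \<Rightarrow> int poly) \<Rightarrow> bool" where
  "int_poly_coeffs F R \<longleftrightarrow> (\<forall>\<omega>. F \<omega> has_fps_expansion Abs_fps (\<lambda>k. ipoly (R k) \<omega>))"

lemma int_poly_coeffs_1: "\<exists>R. int_poly_coeffs (\<lambda>\<omega> x. 1) R"
proof -
  have "Abs_fps (\<lambda>k. ipoly (if k = 0 then 1 else 0 :: int poly) \<omega>) = (1 :: complex fps)" for \<omega>
    by (rule fps_ext) simp
  then have "int_poly_coeffs (\<lambda>\<omega> x. 1) (\<lambda>k. if k = 0 then 1 else 0)"
    by (simp add: int_poly_coeffs_def)
  then show ?thesis by blast
qed

lemma int_poly_coeffs_mult: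
  assumes "\<exists>R. int_poly_coeffs F R" "\<exists>R. int_poly_coeffs G R"
  shows "\<exists>R. int_poly_coeffs (\<lambda>\<omega> x. F \<omega> x * G \<omega> x) R"
proof -
  obtain R S where RS: "int_poly_coeffs F R" "int_poly_coeffs G S" using assms by blast
  have eq: "Abs_fps (\<lambda>k. ipoly (R k) \<omega>) * Abs_fps (\<lambda>k. ipoly (S k) \<omega>)
      = Abs_fps (\<lambda>k. ipoly (\<Sum>j=0..k. R j * S (k - j)) \<omega>)" for \<omega> :: complex
    by (rule fps_ext) (simp add: fps_mult_nth hom_distribs poly_sum)
  have "int_poly_coeffs (\<lambda>\<omega> x. F \<omega> x * G \<omega> x) (\<lambda>k. \<Sum>j=0..k. R j * S (k - j))"
    unfolding int_poly_coeffs_def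
  proof
    fix \<omega>
    have "(\<lambda>x. F \<omega> x * G \<omega> x) has_fps_expansion Abs_fps (\<lambda>k. ipoly (R k) \<omega>) * Abs_fps (\<lambda>k. ipoly (S k) \<omega>)"
      using RS unfolding int_poly_coeffs_def by (intro has_fps_expansion_mult) simp_all
    then show "(\<lambda>x. F \<omega> x * G \<omega> x) has_fps_expansion Abs_fps (\<lambda>k. ipoly (\<Sum>j=0..k. R j * S (k - j)) \<omega>)"
      by (simp only: eq)
  qed
  then show ?thesis by blast
qed

lemma int_poly_coeffs_power:
  assumes "\<exists>R. int_poly_coeffs F R" shows "\<exists>R. int_poly_coeffs (\<lambda>\<omega> x. F \<omega> x ^ n) R"
  by (induction n) (use int_poly_coeffs_1 int_poly_coeffs_mult[OF assms] in auto)

lemma int_poly_coeffs_prod: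
  assumes "\<And>a. a \<in> A \<Longrightarrow> \<exists>R. int_poly_coeffs (F a) R"
  shows "\<exists>R. int_poly_coeffs (\<lambda>\<omega> x. \<Prod>a\<in>A. F a \<omega> x) R"
  using assms
  by (induction A rule: infinite_finite_induct)
    (auto simp: int_poly_coeffs_1 intro!: int_poly_coeffs_mult)

text \<open>The coefficient of \<open>x ^ k\<close> in the \<open>N\<close>-th partial product no longer changes once \<open>N > k\<close>, and by
uniform convergence it tends to the coefficient of the infinite product.\<close>
lemma int_poly_coeffs_qpoch:
  assumes p: "p > 0"
  shows "\<exists>R. int_poly_coeffs (\<lambda>\<omega> x. qpoch (x ^ i * \<omega> ^ e) (x ^ p)) R"
proof -
  define R :: "nat \<Rightarrow> nat \<Rightarrow> int poly" where
    "R = rec_nat (\<lambda>k. if k = 0 then 1 else 0)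
       (\<lambda>N r k. r k - (if k \<ge> i + p * N then monom 1 e * r (k - (i + p * N)) else 0))"
  have R_0: "R 0 k = (if k = 0 then 1 else 0)" for k by (simp add: R_def)
  have R_Suc: "R (Suc N) k = R N k - (if k \<ge> i + p * N then monom 1 e * R N (k - (i + p * N)) else 0)" for N k
    by (simp add: R_def)
  have stable: "R (Suc k + n) k = R (Suc k) k" for n k
  proof (induction n)
    case (Suc n)
    have "Suc k + n > k" by simp
    then have "p * (Suc k + n) > k" using p by (metis less_le_trans mult_le_mono1 nat_mult_1 Suc_leI One_nat_def)
    then show ?case using Suc R_Suc[of "Suc k + n" k] by simp
  qed simp
  have "(\<lambda>x. qpoch (x ^ i * \<omega> ^ e) (x ^ p)) has_fps_expansion Abs_fps (\<lambda>k. ipoly (R (Suc k) k) \<omega>)" for \<omega>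
  proof -
    define f where "f N x = (\<Prod>n<N. 1 - x ^ i * \<omega> ^ e * (x ^ p) ^ n)" for N and x :: complex
    have fN: "f N has_fps_expansion Abs_fps (\<lambda>k. ipoly (R N k) \<omega>)" for N
    proof (induction N)
      case 0
      have "Abs_fps (\<lambda>k. ipoly (R 0 k) \<omega>) = 1" by (rule fps_ext) (simp add: R_0)
      then show ?case by (simp add: f_def)
    next
      case (Suc N)
      have "(\<lambda>x. f N x * (1 - \<omega> ^ e * x ^ (i + p * N))) has_fps_expansion
         Abs_fps (\<lambda>k. ipoly (R N k) \<omega>) * (1 - fps_const (\<omega> ^ e) * fps_X ^ (i + p * N))"
        by (intro fps_expansion_intros Suc)
      also have "(\<lambda>x. f N x * (1 - \<omega> ^ e * x ^ (i + p * N))) = f (Suc N)"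
      proof
        fix x :: complex
        have "x ^ (i + p * N) = x ^ i * (x ^ p) ^ N" by (simp add: power_add power_mult)
        then show "f N x * (1 - \<omega> ^ e * x ^ (i + p * N)) = f (Suc N) x" by (simp add: f_def mult_ac)
      qed
      also have "Abs_fps (\<lambda>k. ipoly (R N k) \<omega>) * (1 - fps_const (\<omega> ^ e) * fps_X ^ (i + p * N))
         = Abs_fps (\<lambda>k. ipoly (R (Suc N) k) \<omega>)"
        by (rule fps_ext) (simp add: ring_distribs R_Suc hom_distribs poly_monom mult.assoc[symmetric] mult.commute[of _ "fps_const _"] fps_X_power_mult_right_nth)
      finally show ?case .
    qed
    have holf: "f N holomorphic_on S" for N S
      unfolding f_def[abs_def] by (intro holomorphic_intros)
    have hol: "(\<lambda>x. qpoch (x ^ i * \<omega> ^ e) (x ^ p)) holomorphic_on ball 0 1"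
      using p by (intro holomorphic_on_qpoch holomorphic_intros) (auto simp: norm_power power_less_one_iff)
    have "uniform_limit (cball 0 (1/2)) f (\<lambda>x. qpoch (x ^ i * \<omega> ^ e) (x ^ p)) sequentially"
      unfolding f_def using p by (intro uniform_limit_qpoch continuous_intros) (auto simp: norm_power power_less_one_iff)
    then have ul: "uniform_limit (ball 0 (1/2)) f (\<lambda>x. qpoch (x ^ i * \<omega> ^ e) (x ^ p)) sequentially"
      by (rule uniform_limit_on_subset) auto
    have "(deriv ^^ k) (\<lambda>x. qpoch (x ^ i * \<omega> ^ e) (x ^ p)) 0 = fact k * ipoly (R (Suc k) k) \<omega>" for k
    proof -
      have L: "(\<lambda>N. (deriv ^^ k) (f N) 0) \<longlonglongrightarrow> (deriv ^^ k) (\<lambda>x. qpoch (x ^ i * \<omega> ^ e) (x ^ p)) 0"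
        by (rule higher_deriv_complex_uniform_limit[OF ul])
          (auto intro!: always_eventually holf)
      have eq: "(\<lambda>N. (deriv ^^ k) (f N) 0) = (\<lambda>N. fact k * ipoly (R N k) \<omega>)"
      proof
        show "(deriv ^^ k) (f N) 0 = fact k * ipoly (R N k) \<omega>" for N
          using fps_nth_fps_expansion[OF fN[of N], of k] by simp
      qed
      have L': "(\<lambda>N. fact k * ipoly (R N k) \<omega>) \<longlonglongrightarrow> fact k * ipoly (R (Suc k) k) \<omega>"
      proof (rule tendsto_eventually)
        show "\<forall>\<^sub>F N in sequentially. fact k * ipoly (R N k) \<omega> = fact k * ipoly (R (Suc k) k) \<omega>"
          unfolding eventually_sequentially using stable[of k] by (metis le_add_diff_inverse)
      qed
      show ?thesis by (rule LIMSEQ_unique[OF L[unfolded eq] L'])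
    qed
    then have "fps_expansion (\<lambda>x. qpoch (x ^ i * \<omega> ^ e) (x ^ p)) 0 = Abs_fps (\<lambda>k. ipoly (R (Suc k) k) \<omega>)"
      by (simp add: fps_expansion_def)
    then show ?thesis using has_fps_expansion_fps_expansion[OF _ _ hol] by simp
  qed
  then show ?thesis unfolding int_poly_coeffs_def by (intro exI[of _ "\<lambda>k. R (Suc k) k"]) blast
qed

section \<open>Uniqueness of q-expansions\<close>

lemma filterlim_exp2pi_at_0:
  assumes "p > 0" shows "filterlim (\<lambda>\<tau>. exp2pi (\<tau> / of_nat p)) (at 0) (filtercomap Im at_top)"
  unfolding filterlim_at
proof
  have "filterlim (\<lambda>y. - (2 * pi / real p) * y) at_bot at_top"
    using assms by real_asymp
  then have "((\<lambda>y. exp (- (2 * pi / real p) * y)) \<longlongrightarrow> 0) at_top"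
    by (rule filterlim_compose[OF exp_at_bot])
  then have "((\<lambda>\<tau>. exp (- (2 * pi / real p) * Im \<tau>)) \<longlongrightarrow> 0) (filtercomap Im at_top)"
    by (rule filterlim_compose) (rule filterlim_filtercomap)
  then have "((\<lambda>\<tau>. norm (exp2pi (\<tau> / of_nat p))) \<longlongrightarrow> 0) (filtercomap Im at_top)"
    by (simp add: norm_exp2pi)
  then show "((\<lambda>\<tau>. exp2pi (\<tau> / of_nat p)) \<longlongrightarrow> 0) (filtercomap Im at_top)"
    by (rule tendsto_norm_zero_cancel)
qed simp

lemma eventually_Im_pos: "eventually (\<lambda>\<tau>. Im \<tau> > 0) (filtercomap Im at_top)"
  using eventually_filtercomapI[OF eventually_gt_at_top[of "0::real"]] .

lemma q_expansionI:
  assumes p: "p > 0" and g: "g has_laurent_expansion A" and f: "\<And>\<tau>. Im \<tau> > 0 \<Longrightarrow> f \<tau> = g (exp2pi (\<tau> / of_nat p))"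
  shows "has_q_expansion p f A"
proof -
  have "eventually (\<lambda>x. eval_fls A x = g x) (at 0)" and r: "fls_conv_radius A > 0"
    using g by (auto simp: has_laurent_expansion_def)
  then have "eventually (\<lambda>\<tau>. eval_fls A (exp2pi (\<tau> / of_nat p)) = g (exp2pi (\<tau> / of_nat p))) (filtercomap Im at_top)"
    using filterlim_exp2pi_at_0[OF p] unfolding filterlim_iff by blast
  then have "eventually (\<lambda>\<tau>. f \<tau> = eval_fls A (exp (2 * of_real pi * \<i> * \<tau> / of_nat p))) (filtercomap Im at_top)"
    using eventually_Im_pos by eventually_elim (simp add: f exp2pi_def)
  with r show ?thesis by (simp add: has_q_expansion_def)
qed

text \<open>Every small nonzero \<open>x\<close> has the form \<open>exp2pi (\<tau> / p)\<close> with large \<open>Im \<tau>\<close>, so the two Laurent series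
have the same sum in a punctured neighbourhood of 0.\<close>
lemma q_expansion_unique:
  assumes p: "p > 0" and A: "has_q_expansion p f A" and B: "has_q_expansion p f B"
  shows "A = B"
proof -
  have "eventually (\<lambda>\<tau>. eval_fls A (exp2pi (\<tau> / of_nat p)) = eval_fls B (exp2pi (\<tau> / of_nat p))) (filtercomap Im at_top)"
    using A B unfolding has_q_expansion_def exp2pi_def by (auto elim: eventually_elim2)
  then obtain Y where Y: "\<And>\<tau>. Im \<tau> \<ge> Y \<Longrightarrow> eval_fls A (exp2pi (\<tau> / of_nat p)) = eval_fls B (exp2pi (\<tau> / of_nat p))"
    unfolding eventually_filtercomap eventually_at_top_linorder by blast
  define r where "r = exp (- 2 * pi * Y / real p)"
  have "eval_fls A x = eval_fls B x" if x: "x \<noteq> 0" "norm x < r" for x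
  proof -
    define \<tau> where "\<tau> = of_nat p * (Ln x / (2 * of_real pi * \<i>))"
    have "exp2pi (\<tau> / of_nat p) = x" using p x by (simp add: \<tau>_def exp2pi_def)
    moreover have "Im \<tau> \<ge> Y"
    proof -
      have "norm (exp2pi (\<tau> / of_nat p)) < r" using x calculation by simp
      then have "- 2 * pi * Im \<tau> / real p < - 2 * pi * Y / real p" by (simp add: norm_exp2pi r_def)
      then show ?thesis using p by (simp add: divide_less_cancel)
    qed
    ultimately show ?thesis using Y by metis
  qed
  then have "eventually (\<lambda>x. eval_fls A x = eval_fls B x) (at 0)"
    unfolding eventually_at by (intro exI[of _ r]) (auto simp: r_def)
  moreover have "eval_fls A has_laurent_expansion A" "eval_fls B has_laurent_expansion B"
    using A B by (auto simp: has_q_expansion_def has_laurent_expansion_def)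
  ultimately show ?thesis using has_laurent_expansion_cong has_laurent_expansion_unique by blast
qed

lemma nicely_meromorphic_eqI:
  assumes f: "f nicely_meromorphic_on S" and g: "g nicely_meromorphic_on S" and S: "open S" "connected S"
    and U: "open U" "U \<noteq> {}" "U \<subseteq> S" "\<And>z. z \<in> U \<Longrightarrow> f z = g z" and z: "z \<in> S"
  shows "f z = g z"
proof -
  have mero: "f meromorphic_on S" "g meromorphic_on S" using f g by (auto simp: nicely_meromorphic_on_def)
  then have d: "(\<lambda>z. f z - g z) meromorphic_on S" by (intro meromorphic_intros)
  obtain u where u: "u \<in> U" using U(2) by blast
  have uS: "u \<in> S" using u U(3) by blast
  have "\<forall>\<^sub>F z in at u. z \<in> U" using U(1) u by (simp add: eventually_at_in_open')
  then have eq_u: "\<forall>\<^sub>F z in at u. f z - g z = 0" by eventually_elim (simp add: U(4))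
  have "eventually (\<lambda>z. f z - g z = 0) (cosparse S)"
  proof (rule ccontr)
    assume "\<not> ?thesis"
    then have "eventually (\<lambda>z. f z - g z \<noteq> 0) (cosparse S)"
      using meromorphic_imp_constant_or_avoid[OF d S, of 0] by blast
    then have "\<forall>\<^sub>F z in at u. f z - g z \<noteq> 0" using eventually_cosparse_imp_eventually_at uS by blast
    with eq_u have "\<forall>\<^sub>F z in at u. False" by eventually_elim simp
    then show False by (simp add: eventually_False)
  qed
  then have ev: "\<forall>\<^sub>F w in at z. f w = g w"
    using eventually_cosparse_imp_eventually_at z by (force elim: eventually_mono)
  have fz: "is_pole f z \<and> f z = 0 \<or> f \<midarrow>z\<rightarrow> f z" and gz: "is_pole g z \<and> g z = 0 \<or> g \<midarrow>z\<rightarrow> g z"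
    using f g z unfolding nicely_meromorphic_on_def by auto
  have pole: "is_pole f z \<longleftrightarrow> is_pole g z" by (rule is_pole_cong[OF ev refl])
  show ?thesis
  proof (cases "is_pole f z")
    case True
    then have "\<not> f \<midarrow>z\<rightarrow> f z" "\<not> g \<midarrow>z\<rightarrow> g z"
      using pole not_tendsto_and_filterlim_at_infinity[of "at z"]
      unfolding is_pole_def by auto
    then show ?thesis using fz gz by auto
  next
    case False
    then have "f \<midarrow>z\<rightarrow> f z" "g \<midarrow>z\<rightarrow> g z" using fz gz pole by auto
    then have "f \<midarrow>z\<rightarrow> g z" using tendsto_cong[OF ev] by blast
    with \<open>f \<midarrow>z\<rightarrow> f z\<close> show ?thesis by (rule LIM_unique)
  qed
qed

section \<open>Products of Siegel functions\<close>

definition csiegel_at :: "nat \<Rightarrow> int^2 \<Rightarrow> complex \<Rightarrow> complex" where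
  "csiegel_at p n \<tau> = csiegel (of_int (n $ 1) / of_nat p) (of_int (n $ 2) / of_nat p) \<tau>"

definition csiegel_prod :: "nat \<Rightarrow> nat \<Rightarrow> 'a set \<Rightarrow> ('a \<Rightarrow> int^2) \<Rightarrow> complex \<Rightarrow> complex" where
  "csiegel_prod p m A N \<tau> = (\<Prod>a\<in>A. csiegel_at p (N a) \<tau> ^ m)"

lemma csiegel_holomorphic: "(\<lambda>\<tau>. csiegel a b \<tau>) holomorphic_on {\<tau>. Im \<tau> > 0}"
  unfolding csiegel_def
  by (intro holomorphic_intros theta_holomorphic open_halfspace_Im_gt) auto

lemma csiegel_prod_holomorphic: "(\<lambda>\<tau>. csiegel_prod p m A N \<tau>) holomorphic_on {\<tau>. Im \<tau> > 0}"
  unfolding csiegel_prod_def csiegel_at_def by (intro holomorphic_intros csiegel_holomorphic)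

text \<open>If \<open>N' a = N a + p b\<close>, then \<open>(N a / p) \<and> b = (N a \<and> N' a) / p\<^sup>2\<close>.\<close>
lemma csiegel_prod_change_lift:
  fixes N N' :: "'a \<Rightarrow> int^2"
  assumes \<tau>: "Im \<tau> > 0" and red: "\<And>a. a \<in> A \<Longrightarrow> red (N a) = (red (N' a) :: 'p::prime_card mod_ring^2)"
    and m: "even m"
  shows "csiegel_prod CARD('p) m A N' \<tau>
    = exp2pi (of_nat (m div 2) * of_int (\<Sum>a\<in>A. wedge (N a) (N' a)) / of_nat (CARD('p) ^ 2)) * csiegel_prod CARD('p) m A N \<tau>"
proof -
  let ?p = "CARD('p)"
  have sq: "(csiegel_at ?p (N' a) \<tau>)\<^sup>2 = exp2pi (of_int (wedge (N a) (N' a)) / of_nat (?p ^ 2)) * (csiegel_at ?p (N a) \<tau>)\<^sup>2" if a: "a \<in> A" for a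
  proof -
    define b where "b i = (N' a $ i - N a $ i) div int ?p" for i
    have b: "N' a $ i = N a $ i + int ?p * b i" for i
    proof -
      have "red (N' a) $ i = (red (N a) :: 'p mod_ring^2) $ i" using red[OF a] by simp
      then have "int ?p dvd N' a $ i - N a $ i" by (simp add: of_int_mod_ring_eq_iff)
      then show ?thesis by (simp add: b_def)
    qed
    have "(csiegel_at ?p (N' a) \<tau>)\<^sup>2 = (csiegel (of_int (N a $ 1) / of_nat ?p + of_int (b 1)) (of_int (N a $ 2) / of_nat ?p + of_int (b 2)) \<tau>)\<^sup>2"
      unfolding csiegel_at_def b by (simp add: add_divide_distrib)
    also have "\<dots> = exp2pi (of_int (N a $ 1) / of_nat ?p * of_int (b 2) - of_int (N a $ 2) / of_nat ?p * of_int (b 1)) * (csiegel_at ?p (N a) \<tau>)\<^sup>2"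
      unfolding csiegel_square_add_int[OF \<tau>] csiegel_at_def by simp
    also have "of_int (N a $ 1) / of_nat ?p * of_int (b 2) - of_int (N a $ 2) / of_nat ?p * of_int (b 1)
        = (of_int (wedge (N a) (N' a)) / of_nat (?p ^ 2) :: complex)"
      unfolding wedge_def b by (simp add: field_simps power2_eq_square)
    finally show ?thesis .
  qed
  obtain k where k: "m = 2 * k" using m by blast
  have "csiegel_prod ?p m A N' \<tau> = (\<Prod>a\<in>A. exp2pi (of_int (wedge (N a) (N' a)) / of_nat (?p ^ 2)) ^ k * csiegel_at ?p (N a) \<tau> ^ m)"
    unfolding csiegel_prod_def by (intro prod.cong) (simp_all add: k power_mult sq power_mult_distrib)
  also have "\<dots> = (\<Prod>a\<in>A. exp2pi (of_nat k * (of_int (wedge (N a) (N' a)) / of_nat (?p ^ 2)))) * csiegel_prod ?p m A N \<tau>"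
    by (simp only: prod.distrib csiegel_prod_def exp2pi_power)
  also have "(\<Prod>a\<in>A. exp2pi (of_nat k * (of_int (wedge (N a) (N' a)) / of_nat (?p ^ 2))))
     = exp2pi (\<Sum>a\<in>A. of_nat k * (of_int (wedge (N a) (N' a)) / of_nat (?p ^ 2)))"
    by (induction A rule: infinite_finite_induct) (simp_all add: exp2pi_add)
  also have "(\<Sum>a\<in>A. of_nat k * (of_int (wedge (N a) (N' a)) / of_nat (?p ^ 2)))
     = (of_nat k * of_int (\<Sum>a\<in>A. wedge (N a) (N' a)) / of_nat (?p ^ 2) :: complex)"
    by (simp add: sum_distrib_left sum_divide_distrib)
  finally show ?thesis by (simp add: k)
qed

lemma csiegel_prod_change_lift_eq:
  fixes N N' :: "'a \<Rightarrow> int^2"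
  assumes "Im \<tau> > 0" and "\<And>a. a \<in> A \<Longrightarrow> red (N a) = (red (N' a) :: 'p::prime_card mod_ring^2)"
    and "even m" and dvd: "int CARD('p) ^ 2 dvd (\<Sum>a\<in>A. wedge (N a) (N' a))"
  shows "csiegel_prod CARD('p) m A N' \<tau> = csiegel_prod CARD('p) m A N \<tau>"
proof -
  obtain k where k: "(\<Sum>a\<in>A. wedge (N a) (N' a)) = int CARD('p) ^ 2 * k" using dvd by blast
  have "of_nat (m div 2) * of_int (\<Sum>a\<in>A. wedge (N a) (N' a)) / of_nat (CARD('p) ^ 2)
     = (of_int (int (m div 2) * k) :: complex)" unfolding k by simp
  moreover have "csiegel_prod CARD('p) m A N' \<tau>
    = exp2pi (of_nat (m div 2) * of_int (\<Sum>a\<in>A. wedge (N a) (N' a)) / of_nat (CARD('p) ^ 2)) * csiegel_prod CARD('p) m A N \<tau>"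
    by (rule csiegel_prod_change_lift) fact+
  ultimately show ?thesis by (simp only: exp2pi_of_int mult_1_left)
qed

lemma SL2Z_det: "\<gamma> \<in> SL2Z \<Longrightarrow> \<gamma>$1$1 * \<gamma>$2$2 - \<gamma>$1$2 * \<gamma>$2$1 = 1"
  by (simp add: SL2Z_def det_2)

lemma moebius_Im_pos: "\<gamma> \<in> SL2Z \<Longrightarrow> Im \<tau> > 0 \<Longrightarrow> Im (moebius \<gamma> \<tau>) > 0"
  unfolding moebius_def using moebius_entries_Im(2) SL2Z_det by blast

lemma csiegel_prod_moebius:
  assumes \<tau>: "Im \<tau> > 0" and \<gamma>: "\<gamma> \<in> SL2Z" and 12: "12 dvd m * card A"
  shows "csiegel_prod p m A N (moebius \<gamma> \<tau>) = csiegel_prod p m A (\<lambda>a. N a v* \<gamma>) \<tau>"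
proof -
  obtain C where C: "C ^ 12 = 1" "\<And>x y. csiegel x y (moebius \<gamma> \<tau>)
      = C * csiegel (x * of_int (\<gamma>$1$1) + y * of_int (\<gamma>$2$1)) (x * of_int (\<gamma>$1$2) + y * of_int (\<gamma>$2$2)) \<tau>"
    using csiegel_modular[OF \<tau> SL2Z_det[OF \<gamma>]] unfolding moebius_def by blast
  have "csiegel_at p n (moebius \<gamma> \<tau>) = C * csiegel_at p (n v* \<gamma>) \<tau>" for n
    unfolding csiegel_at_def C(2) by (simp add: add_divide_distrib)
  then have "csiegel_prod p m A N (moebius \<gamma> \<tau>) = (\<Prod>a\<in>A. C ^ m) * csiegel_prod p m A (\<lambda>a. N a v* \<gamma>) \<tau>"
    unfolding csiegel_prod_def by (simp add: power_mult_distrib prod.distrib)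
  also have "(\<Prod>a\<in>A. C ^ m) = C ^ (m * card A)" by (simp add: power_mult)
  also have "\<dots> = 1"
  proof -
    obtain k where "m * card A = 12 * k" using 12 by blast
    then show ?thesis using C(1) by (simp only: power_mult power_one)
  qed
  finally show ?thesis by simp
qed

section \<open>The q-expansion of a product\<close>

text \<open>With \<open>x = q\<^sup>1\<^sup>/\<^sup>p\<close> and \<open>\<omega> = \<zeta>\<^sub>p\<close> this is the theta function at \<open>(i \<tau> + e) / p\<close>; the exponent \<open>(p - 1) * e\<close>
stands for \<open>- e\<close>, which keeps the coefficients polynomial in \<open>\<omega>\<close>.\<close>
definition theta_factor :: "nat \<Rightarrow> nat \<Rightarrow> nat \<Rightarrow> complex \<Rightarrow> complex \<Rightarrow> complex" where
  "theta_factor p i e \<omega> x = qpoch (x ^ i * \<omega> ^ e) (x ^ p) * qpoch (x ^ (p - i) * \<omega> ^ ((p - 1) * e)) (x ^ p)"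

lemma zeta_eq_exp2pi: "zeta p = exp2pi (1 / of_nat p)"
  by (simp add: zeta_def exp2pi_def)

lemma theta_eq_theta_factor:
  assumes p: "p > 0" and n: "0 \<le> n1" "n1 < int p"
  shows "theta (of_int n1 / of_nat p * \<tau> + of_int n2 / of_nat p) \<tau>
     = theta_factor p (nat n1) (nat (n2 mod int p)) (zeta p) (exp2pi (\<tau> / of_nat p))"
proof -
  let ?X = "exp2pi (\<tau> / of_nat p)" and ?z = "zeta p"
  define e where "e = nat (n2 mod int p)"
  have zp: "?z ^ p = 1" using zeta_power[OF p, of p] by simp
  have Xp: "?X ^ p = exp2pi \<tau>" using p by (simp add: exp2pi_power)
  have ze: "?z ^ e = exp2pi (of_int n2 / of_nat p)"
  proof -
    \<comment> \<open>As \<open>zeta p\<close> has order \<open>p\<close>, the second coordinate matters only modulo \<open>p\<close>.\<close>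
    have n2: "n2 = int e + int p * (n2 div int p)" using p by (simp add: e_def)
    have "of_int n2 / of_nat p = (of_nat e / of_nat p + of_int (n2 div int p) :: complex)"
      using p by (subst n2) (simp add: add_divide_distrib)
    then show ?thesis unfolding zeta_eq_exp2pi exp2pi_power by (simp add: exp2pi_add)
  qed
  have Xi: "?X ^ nat n1 = exp2pi (of_int n1 / of_nat p * \<tau>)" using n by (simp add: exp2pi_power)
  have w: "exp2pi (of_int n1 / of_nat p * \<tau> + of_int n2 / of_nat p) = ?X ^ nat n1 * ?z ^ e"
    by (simp add: exp2pi_add ze Xi)
  have "?X ^ (p - nat n1) * ?X ^ nat n1 = ?X ^ p" using n by (simp add: power_add[symmetric])
  moreover have "?z ^ ((p - 1) * e) * ?z ^ e = 1"
  proof -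
    have "(p - 1) * e + e = p * e" using p by (cases p) simp_all
    then have "?z ^ ((p - 1) * e) * ?z ^ e = ?z ^ (p * e)" by (simp only: power_add[symmetric])
    then show ?thesis by (simp only: power_mult zp power_one)
  qed
  ultimately have "?X ^ (p - nat n1) * ?z ^ ((p - 1) * e) * (?X ^ nat n1 * ?z ^ e) = exp2pi \<tau>"
    by (simp add: Xp mult_ac)
  then have "exp2pi \<tau> / (?X ^ nat n1 * ?z ^ e) = ?X ^ (p - nat n1) * ?z ^ ((p - 1) * e)"
    using w by (metis exp2pi_nonzero nonzero_mult_div_cancel_right)
  then show ?thesis unfolding theta_def w theta_factor_def e_def[symmetric] Xp by simp
qed

definition theta_prod :: "nat \<Rightarrow> nat \<Rightarrow> 'a set \<Rightarrow> ('a \<Rightarrow> int^2) \<Rightarrow> complex \<Rightarrow> complex \<Rightarrow> complex" where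
  "theta_prod p m A N \<omega> x = (\<Prod>a\<in>A. theta_factor p (nat (N a $ 1)) (nat (N a $ 2 mod int p)) \<omega> x ^ m)"

text \<open>The exponent of \<open>q\<^sup>1\<^sup>/\<^sup>p\<close> contributed by the \<open>m\<close>-th powers of the factors \<open>q\<close> to the
\<open>B\<^sub>2(a\<^sub>1)/2\<close>.\<close>
definition leading_exponent :: "nat \<Rightarrow> nat \<Rightarrow> 'a set \<Rightarrow> ('a \<Rightarrow> int^2) \<Rightarrow> int" where
  "leading_exponent p m A N = int (m div 2) * ((\<Sum>a\<in>A. (N a $ 1)\<^sup>2) div int p - (\<Sum>a\<in>A. N a $ 1))
     + int p * int (m * card A div 12)"

text \<open>The product of the \<open>m\<close>-th powers of the constants \<open>exp(\<pi>i a\<^sub>2(a\<^sub>1 - 1))\<close>.\<close>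
definition leading_phase :: "nat \<Rightarrow> nat \<Rightarrow> 'a set \<Rightarrow> ('a \<Rightarrow> int^2) \<Rightarrow> complex" where
  "leading_phase p m A N = exp2pi (of_nat (m div 2) * (\<Sum>a\<in>A. of_int (N a $ 2) / of_nat p * (of_int (N a $ 1) / of_nat p - 1)))"

text \<open>The total exponent of \<open>q\<^sup>1\<^sup>/\<^sup>p\<close> is an integer: the squares of the first coordinates contribute
\<open>(m/2) \<Sum>N\<^sub>1\<^sup>2 / p\<close>, and the constant terms of \<open>B\<^sub>2\<close> contribute \<open>p m |A| / 12\<close>.\<close>
lemma csiegel_prod_expansion:
  assumes p: "p > 0" and m: "even m" and 12: "12 dvd m * card A"
    and range: "\<And>a. a \<in> A \<Longrightarrow> 0 \<le> N a $ 1 \<and> N a $ 1 < int p"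
    and dvd: "int p dvd (\<Sum>a\<in>A. (N a $ 1)\<^sup>2)"
  shows "csiegel_prod p m A N \<tau> = leading_phase p m A N
      * (theta_prod p m A N (zeta p) (exp2pi (\<tau> / of_nat p)) * exp2pi (\<tau> / of_nat p) powi leading_exponent p m A N)"
proof -
  let ?X = "exp2pi (\<tau> / of_nat p)"
  obtain k where k: "m = 2 * k" using m by blast
  define x y :: "'a \<Rightarrow> complex" where "x a = of_int (N a $ 1) / of_nat p" and "y a = of_int (N a $ 2) / of_nat p"
    for a
  define E where "E a = (\<tau> * ((x a)\<^sup>2 - x a + 1 / 6) + y a * (x a - 1)) / 2" for a
  have "csiegel_at p (N a) \<tau> ^ m = exp2pi (E a) ^ m * theta_factor p (nat (N a $ 1)) (nat (N a $ 2 mod int p)) (zeta p) ?X ^ m"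
    if a: "a \<in> A" for a
  proof -
    have "csiegel_at p (N a) \<tau> = - exp2pi (E a) * theta_factor p (nat (N a $ 1)) (nat (N a $ 2 mod int p)) (zeta p) ?X"
      using theta_eq_theta_factor[OF p, of "N a $ 1" \<tau> "N a $ 2"] range[OF a]
      unfolding csiegel_at_def csiegel_def E_def x_def y_def by simp
    then show ?thesis using m by (simp add: power_mult_distrib)
  qed
  then have "csiegel_prod p m A N \<tau> = (\<Prod>a\<in>A. exp2pi (E a) ^ m) * theta_prod p m A N (zeta p) ?X"
    unfolding csiegel_prod_def theta_prod_def prod.distrib[symmetric] by (intro prod.cong) auto
  also have "(\<Prod>a\<in>A. exp2pi (E a) ^ m) = exp2pi (\<Sum>a\<in>A. of_nat m * E a)"
    unfolding exp2pi_power by (induction A rule: infinite_finite_induct) (simp_all add: exp2pi_add)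
  also have "(\<Sum>a\<in>A. of_nat m * E a) = of_nat k * (\<Sum>a\<in>A. y a * (x a - 1))
      + \<tau> / of_nat p * of_int (leading_exponent p m A N)"
  proof -
    have "(\<Sum>a\<in>A. of_nat m * E a) = (\<Sum>a\<in>A. of_nat k * (y a * (x a - 1)) 
         + \<tau> * of_nat k * (x a)\<^sup>2 - \<tau> * of_nat k * x a + \<tau> * of_nat k / 6)"
      by (intro sum.cong) (simp_all add: E_def k field_simps)
    also have "\<dots> = of_nat k * (\<Sum>a\<in>A. y a * (x a - 1)) + \<tau> * of_nat k * (\<Sum>a\<in>A. (x a)\<^sup>2)
         - \<tau> * of_nat k * (\<Sum>a\<in>A. x a) + of_nat (card A) * (\<tau> * of_nat k / 6)"
      by (simp only: sum.distrib sum_subtractf sum_distrib_left sum_constant)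
    also have "(\<Sum>a\<in>A. (x a)\<^sup>2) = of_int ((\<Sum>a\<in>A. (N a $ 1)\<^sup>2) div int p) / of_nat p"
    proof -
      obtain j where j: "(\<Sum>a\<in>A. (N a $ 1)\<^sup>2) = int p * j" using dvd by blast
      have "(\<Sum>a\<in>A. (x a)\<^sup>2) = of_int (\<Sum>a\<in>A. (N a $ 1)\<^sup>2) / (of_nat p)\<^sup>2"
        by (simp add: x_def power_divide sum_divide_distrib)
      then show ?thesis unfolding j using p by (simp add: power2_eq_square)
    qed
    also have "(\<Sum>a\<in>A. x a) = of_int (\<Sum>a\<in>A. N a $ 1) / of_nat p"
      by (simp add: x_def sum_divide_distrib)
    also have "of_nat (card A) * (\<tau> * of_nat k / 6) = \<tau> * of_nat (m * card A div 12)"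
    proof -
      obtain j where j: "m * card A = 12 * j" using 12 by blast
      then have "k * card A = 6 * j" by (simp add: k)
      then have "of_nat k * of_nat (card A) = (6 * of_nat j :: complex)" by (metis of_nat_mult of_nat_numeral)
      then have "of_nat (card A) * (\<tau> * of_nat k / 6) = \<tau> * (6 * of_nat j) / 6" by (simp add: mult_ac)
      then show ?thesis by (simp add: j)
    qed
    also have "of_nat k * (\<Sum>a\<in>A. y a * (x a - 1))
         + \<tau> * of_nat k * (of_int ((\<Sum>a\<in>A. (N a $ 1)\<^sup>2) div int p) / of_nat p)
         - \<tau> * of_nat k * (of_int (\<Sum>a\<in>A. N a $ 1) / of_nat p) + \<tau> * of_nat (m * card A div 12)
       = of_nat k * (\<Sum>a\<in>A. y a * (x a - 1)) + \<tau> / of_nat p * of_int (leading_exponent p m A N)"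
      using p by (simp add: leading_exponent_def k field_simps)
    finally show ?thesis .
  qed
  also have "exp2pi (of_nat k * (\<Sum>a\<in>A. y a * (x a - 1)) + \<tau> / of_nat p * of_int (leading_exponent p m A N))
     = leading_phase p m A N * ?X powi leading_exponent p m A N"
  proof -
    have "exp2pi (z * of_int n) = exp2pi z powi n" for z n
      by (simp add: exp2pi_def exp_power_int mult_ac)
    then show ?thesis unfolding exp2pi_add by (simp only: leading_phase_def x_def y_def k) simp
  qed
  finally show ?thesis by (simp add: mult_ac)
qed

lemma leading_phase_conj_symmetric:
  assumes "conj_symmetric A N" shows "leading_phase p m A N = 1"
proof -
  let ?f = "\<lambda>a. of_int (N a $ 2) / of_nat p * (of_int (N a $ 1) / of_nat p - 1) :: complex"
  have "bij_betw conj_vec A A"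
    by (rule bij_betw_byWitness[where f' = conj_vec]) (use assms in \<open>auto simp: conj_symmetric_def\<close>)
  then have "(\<Sum>a\<in>A. ?f a) = (\<Sum>a\<in>A. ?f (conj_vec a))" by (rule sum.reindex_bij_betw[symmetric])
  also have "\<dots> = (\<Sum>a\<in>A. - ?f a)"
    using assms by (intro sum.cong) (auto simp: conj_symmetric_def)
  finally have "(\<Sum>a\<in>A. ?f a) = 0" by (simp add: sum_negf)
  then show ?thesis by (simp add: leading_phase_def)
qed

lemma theta_prod_int_poly_coeffs:
  assumes "p > 0" shows "\<exists>R. int_poly_coeffs (theta_prod p m A N) R"
proof -
  have 1: "\<exists>R. int_poly_coeffs (\<lambda>\<omega> x. theta_factor p i e \<omega> x) R" for i e
    unfolding theta_factor_def by (intro int_poly_coeffs_mult int_poly_coeffs_qpoch assms)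
  show ?thesis using int_poly_coeffs_prod[of A "\<lambda>a \<omega> x. theta_factor p (nat (N a $ 1)) (nat (N a $ 2 mod int p)) \<omega> x ^ m"]
      int_poly_coeffs_power[OF 1] by (simp add: theta_prod_def[abs_def])
qed

section \<open>Products over balanced sets are modular functions\<close>

definition siegel_fn :: "nat \<Rightarrow> nat \<Rightarrow> 'a set \<Rightarrow> ('a \<Rightarrow> int^2) \<Rightarrow> complex \<Rightarrow> complex" where
  "siegel_fn p m A N \<tau> = (if Im \<tau> > 0 then csiegel_prod p m A N \<tau> else 0)"

text \<open>Brings the first coordinate into the range for which the product has no negative exponents.  The
second coordinate stays as it is, so that the lift still respects conjugation.\<close>
definition reduce_first :: "nat \<Rightarrow> int^2 \<Rightarrow> int^2" where
  "reduce_first p n = (\<chi> i. if i = 1 then n $ 1 mod int p else n $ 2)"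

lemma reduce_first_nth [simp]: "reduce_first p n $ 1 = n $ 1 mod int p" "reduce_first p n $ 2 = n $ 2"
  by (simp_all add: reduce_first_def)

lemma red_reduce_first: "red (reduce_first CARD('p) n) = (red n :: 'p::prime_card mod_ring^2)"
proof (rule vec2_eqI)
  have "of_int (n $ 1 mod int CARD('p)) = (of_int (n $ 1) :: 'p mod_ring)"
    unfolding of_int_mod_ring_eq_iff by (simp add: mod_eq_dvd_iff[symmetric])
  then show "red (reduce_first CARD('p) n) $ 1 = (red n :: 'p::prime_card mod_ring^2) $ 1" by simp
qed simp

lemma reduce_first_sum_squares:
  "int p dvd (\<Sum>a\<in>A. (reduce_first p (N a) $ 1)\<^sup>2) \<longleftrightarrow> int p dvd (\<Sum>a\<in>A. (N a $ 1)\<^sup>2)"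
proof -
  have "(\<Sum>a\<in>A. (N a $ 1 mod int p)\<^sup>2) mod int p = (\<Sum>a\<in>A. (N a $ 1)\<^sup>2) mod int p"
    by (subst (1 2) mod_sum_eq[symmetric]) (simp add: power_mod)
  then show ?thesis by (simp add: dvd_eq_mod_eq_0)
qed

lemma csiegel_prod_laurent:
  fixes N :: "'a \<Rightarrow> int^2"
  assumes p: "p = CARD('p::prime_card)" and m: "even m" and 12: "12 dvd m * card A"
    and dvd: "int p dvd (\<Sum>a\<in>A. (N a $ 1)\<^sup>2)"
  shows "\<exists>g F. g has_laurent_expansion F \<and> (\<forall>\<tau>. Im \<tau> > 0 \<longrightarrow> csiegel_prod p m A N \<tau> = g (exp2pi (\<tau> / of_nat p)))"
proof -
  have p0: "p > 0" unfolding p by simp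
  define N0 where "N0 a = reduce_first p (N a)" for a
  define c where "c = exp2pi (of_nat (m div 2) * of_int (\<Sum>a\<in>A. wedge (N0 a) (N a)) / of_nat (p ^ 2))"
  define K where "K = leading_exponent p m A N0"
  obtain R where R: "int_poly_coeffs (theta_prod p m A N0) R" using theta_prod_int_poly_coeffs[OF p0] by blast
  define g where "g x = c * (leading_phase p m A N0 * (theta_prod p m A N0 (zeta p) x * x powi K))" for x
  have "theta_prod p m A N0 (zeta p) has_laurent_expansion fps_to_fls (Abs_fps (\<lambda>k. ipoly (R k) (zeta p)))"
    using R unfolding int_poly_coeffs_def by (intro has_laurent_expansion_fps) blast
  then have "g has_laurent_expansion fls_const c * (fls_const (leading_phase p m A N0) *
      fls_shift (- K) (fps_to_fls (Abs_fps (\<lambda>k. ipoly (R k) (zeta p)))))"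
    unfolding g_def by (intro laurent_expansion_intros)
  moreover have "csiegel_prod p m A N \<tau> = g (exp2pi (\<tau> / of_nat p))" if \<tau>: "Im \<tau> > 0" for \<tau>
  proof -
    have "csiegel_prod p m A N \<tau> = c * csiegel_prod p m A N0 \<tau>"
      unfolding c_def p by (rule csiegel_prod_change_lift[where 'p='p, OF \<tau> _ m]) (simp add: N0_def p red_reduce_first)
    also have "csiegel_prod p m A N0 \<tau> = leading_phase p m A N0
      * (theta_prod p m A N0 (zeta p) (exp2pi (\<tau> / of_nat p)) * exp2pi (\<tau> / of_nat p) powi K)"
      unfolding K_def
    proof (rule csiegel_prod_expansion[OF p0 m 12])
      show "int p dvd (\<Sum>a\<in>A. (N0 a $ 1)\<^sup>2)" unfolding N0_def reduce_first_sum_squares by (rule dvd)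
    qed (use p0 in \<open>simp add: N0_def\<close>)
    finally show ?thesis by (simp add: g_def)
  qed
  ultimately show ?thesis by blast
qed

text \<open>The conditions on \<open>A\<close>, \<open>N\<close> and \<open>m\<close> under which a product of Siegel functions is modular of level \<open>p\<close>.  They hold for
the orbits and are inherited by their images under \<open>diag2 1 d\<close>, which occur as Galois twists.\<close>
locale balanced_lift =
  fixes A :: "('p::prime_card mod_ring^2) set" and N :: "'p mod_ring^2 \<Rightarrow> int^2" and m :: nat
  assumes finA: "finite A" and moments: "second_moments_vanish A" and lift: "lifts_on A N"
    and conj_sym: "conj_symmetric A N" and m_even: "even m" and m12: "12 dvd m * card A"
begin

abbreviation "u \<equiv> siegel_fn CARD('p) m A N"
abbreviation "N0 \<equiv> \<lambda>a. reduce_first CARD('p) (N a)"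
abbreviation "K \<equiv> leading_exponent CARD('p) m A N0"

lemma sum_squares:
  fixes \<gamma> :: "int^2^2"
  shows "int CARD('p) dvd (\<Sum>a\<in>A. ((N a v* \<gamma>) $ j)\<^sup>2)"
proof -
  have "of_int (\<Sum>a\<in>A. ((N a v* \<gamma>) $ j)\<^sup>2) = (\<Sum>a\<in>A. (a v* map_matrix of_int \<gamma>) $ j * (a v* map_matrix of_int \<gamma>) $ j)"
    unfolding of_int_sum
  proof (rule sum.cong)
    fix a assume "a \<in> A"
    then have "red (N a v* \<gamma>) = a v* map_matrix of_int \<gamma>" using lift by (simp add: red_vmult lifts_on_def)
    then have "of_int ((N a v* \<gamma>) $ j) = (a v* map_matrix of_int \<gamma>) $ j" by (metis red_nth)
    then show "of_int (((N a v* \<gamma>) $ j)\<^sup>2) = (a v* map_matrix of_int \<gamma>) $ j * (a v* map_matrix of_int \<gamma>) $ j"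
      by (simp only: power2_eq_square of_int_mult)
  qed simp
  also have "\<dots> = 0" by (rule second_moments_vmult[OF moments])
  finally show ?thesis by (simp only: of_int_mod_ring_eq_0_iff)
qed

lemma sum_squares_1: "int CARD('p) dvd (\<Sum>a\<in>A. (N a $ 1)\<^sup>2)"
  using sum_squares[of "mat 1" 1] by (simp only: vector_matrix_mul_rid)

lemma holomorphic: "u holomorphic_on upper_half_plane"
  by (rule holomorphic_transform[OF csiegel_prod_holomorphic[of "CARD('p)" m A N, folded upper_half_plane_def]])
    (simp add: siegel_fn_def upper_half_plane_def)

text \<open>For \<open>\<gamma> = 1 + p X\<close> the sum that controls the change from \<open>N\<close> to \<open>N \<gamma>\<close> is \<open>p\<close> times the sum of the quadratic form
\<open>a \<and> a X\<close>.\<close>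
lemma invariant:
  assumes \<gamma>: "\<gamma> \<in> principal_congruence_subgroup CARD('p)" and \<tau>: "Im \<tau> > 0"
  shows "u (moebius \<gamma> \<tau>) = u \<tau>"
proof -
  have SL: "\<gamma> \<in> SL2Z" and cong: "\<And>i j. [\<gamma> $ i $ j = mat 1 $ i $ j] (mod int CARD('p))"
    using \<gamma> by (auto simp: principal_congruence_subgroup_def)
  define X :: "int^2^2" where "X = (\<chi> i j. (\<gamma> $ i $ j - mat 1 $ i $ j) div int CARD('p))"
  have X: "\<gamma> $ i $ j = mat 1 $ i $ j + int CARD('p) * X $ i $ j" for i j
    using cong[of i j] by (simp add: X_def cong_iff_dvd_diff)
  have Ng: "(N a v* \<gamma>) $ j = N a $ j + int CARD('p) * (N a v* X) $ j" for a j
    using exhaust_2[of j] by (auto simp: X mat_def algebra_simps)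
  have "csiegel_prod CARD('p) m A (\<lambda>a. N a v* \<gamma>) \<tau> = csiegel_prod CARD('p) m A N \<tau>"
  proof (rule csiegel_prod_change_lift_eq[OF \<tau> _ m_even])
    show "red (N a) = (red (N a v* \<gamma>) :: 'p mod_ring^2)" for a
      by (rule vec2_eqI) (simp_all add: Ng del: vmult2)
    have "(\<Sum>a\<in>A. wedge (N a) (N a v* \<gamma>)) = int CARD('p) * (\<Sum>a\<in>A. wedge (N a) (N a v* X))"
      unfolding sum_distrib_left wedge_def Ng by (intro sum.cong) (simp_all add: algebra_simps del: vmult2)
    moreover have "int CARD('p) dvd (\<Sum>a\<in>A. wedge (N a) (N a v* X))"
    proof -
      have "of_int (\<Sum>a\<in>A. wedge (N a) (N a v* X)) = (\<Sum>a\<in>A. wedge (a v* mat 1) (a v* map_matrix of_int X))"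
        unfolding of_int_sum
      proof (rule sum.cong)
        fix a assume "a \<in> A"
        then have a: "red (N a) = a" using lift by (simp add: lifts_on_def)
        have "of_int (wedge (N a) (N a v* X)) = wedge (red (N a)) (red (N a v* X) :: 'p mod_ring^2)"
          by (simp add: wedge_def del: vmult2)
        then show "of_int (wedge (N a) (N a v* X)) = wedge (a v* mat 1) (a v* map_matrix of_int X)"
          by (simp only: red_vmult a vector_matrix_mul_rid)
      qed simp
      also have "\<dots> = 0" by (rule second_moments_wedge[OF moments])
      finally show ?thesis by (simp only: of_int_mod_ring_eq_0_iff)
    qed
    ultimately show "int CARD('p) ^ 2 dvd (\<Sum>a\<in>A. wedge (N a) (N a v* \<gamma>))"
      by (simp add: power2_eq_square)
  qed
  then show ?thesis using csiegel_prod_moebius[OF \<tau> SL m12] moebius_Im_pos[OF SL \<tau>] \<tau>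
    by (simp add: siegel_fn_def)
qed

lemma meromorphic_at_cusps:
  assumes \<gamma>: "\<gamma> \<in> SL2Z" shows "\<exists>F. has_q_expansion CARD('p) (u \<circ> moebius \<gamma>) F"
proof -
  obtain g F where g: "g has_laurent_expansion F" 
      "\<And>\<tau>. Im \<tau> > 0 \<Longrightarrow> csiegel_prod CARD('p) m A (\<lambda>a. N a v* \<gamma>) \<tau> = g (exp2pi (\<tau> / of_nat CARD('p)))"
    using csiegel_prod_laurent[where 'p='p, OF refl m_even m12 sum_squares] by blast
  have "(u \<circ> moebius \<gamma>) \<tau> = g (exp2pi (\<tau> / of_nat CARD('p)))" if "Im \<tau> > 0" for \<tau>
    using g(2)[OF that] csiegel_prod_moebius[OF that \<gamma> m12] moebius_Im_pos[OF \<gamma> that]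
      by (simp add: siegel_fn_def)
  then show ?thesis using q_expansionI[OF _ g(1)] by (metis zero_less_card_finite)
qed

lemma q_expansion:
  assumes R: "int_poly_coeffs (theta_prod CARD('p) m A N0) R"
  shows "has_q_expansion CARD('p) u (fls_shift (- K) (fps_to_fls (Abs_fps (\<lambda>k. ipoly (R k) (zeta CARD('p))))))"
proof (rule q_expansionI)
  have "theta_prod CARD('p) m A N0 (zeta CARD('p)) has_laurent_expansion fps_to_fls (Abs_fps (\<lambda>k. ipoly (R k) (zeta CARD('p))))"
    using R unfolding int_poly_coeffs_def by (intro has_laurent_expansion_fps) blast
  then show "(\<lambda>x. theta_prod CARD('p) m A N0 (zeta CARD('p)) x * x powi K) has_laurent_expansion
      fls_shift (- K) (fps_to_fls (Abs_fps (\<lambda>k. ipoly (R k) (zeta CARD('p)))))"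
    by (rule has_laurent_expansion_shift)
  fix \<tau> assume \<tau>: "Im \<tau> > 0"
  have sym0: "conj_symmetric A N0"
    using conj_sym by (auto simp: conj_symmetric_def intro!: vec2_eqI)
  have "csiegel_prod CARD('p) m A N0 \<tau> = csiegel_prod CARD('p) m A N \<tau>"
    by (rule csiegel_prod_change_lift_eq[OF \<tau> _ m_even]) (simp_all add: red_reduce_first lift_sum_conj[OF conj_sym sym0])
  moreover have "csiegel_prod CARD('p) m A N0 \<tau> = leading_phase CARD('p) m A N0
      * (theta_prod CARD('p) m A N0 (zeta CARD('p)) (exp2pi (\<tau> / of_nat CARD('p))) * exp2pi (\<tau> / of_nat CARD('p)) powi K)"
    by (rule csiegel_prod_expansion[OF _ m_even m12]) (simp_all only: reduce_first_sum_squares sum_squares_1, simp_all)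
  ultimately show "u \<tau> = theta_prod CARD('p) m A N0 (zeta CARD('p)) (exp2pi (\<tau> / of_nat CARD('p))) * exp2pi (\<tau> / of_nat CARD('p)) powi K"
    using \<tau> by (simp add: siegel_fn_def leading_phase_conj_symmetric[OF sym0])
qed simp

lemma in_modular_function_field: "u \<in> modular_function_field CARD('p)"
  unfolding modular_function_field_def mem_Collect_eq
proof (intro conjI allI impI ballI)
  have "open upper_half_plane" unfolding upper_half_plane_def by (rule open_halfspace_Im_gt)
  then have "u analytic_on upper_half_plane" using holomorphic by (simp add: analytic_on_open)
  then show "u nicely_meromorphic_on upper_half_plane" by (rule analytic_on_imp_nicely_meromorphic_on)
  show "u \<tau> = 0" if "\<tau> \<notin> upper_half_plane" for \<tau> using that
    by (simp add: upper_half_plane_def siegel_fn_def)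
  show "u (moebius \<gamma> \<tau>) = u \<tau>"
    if "\<gamma> \<in> principal_congruence_subgroup CARD('p)" "\<tau> \<in> upper_half_plane" for \<gamma> \<tau>
    using invariant that by (simp add: upper_half_plane_def)
  show "\<exists>F. has_q_expansion CARD('p) (u \<circ> moebius \<gamma>) F" if "\<gamma> \<in> SL2Z" for \<gamma>
    using meromorphic_at_cusps[OF that] .
  obtain R where R: "int_poly_coeffs (theta_prod CARD('p) m A N0) R"
    using theta_prod_int_poly_coeffs[OF zero_less_card_finite[where 'a='p]] by blast
  have "0 \<in> cyclotomic_field CARD('p)" using is_subfieldD(2)[OF subfield_cyclotomic] .
  then have "fls_nth (fls_shift (- K) (fps_to_fls (Abs_fps (\<lambda>k. ipoly (R k) (zeta CARD('p)))))) n \<in> cyclotomic_field CARD('p)" for n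
    by (simp add: ipoly_zeta_in_cyclotomic_field)
  with q_expansion[OF R] show "\<exists>F. has_q_expansion CARD('p) u F \<and> (\<forall>n. fls_nth F n \<in> cyclotomic_field CARD('p))" by blast
qed

end

section \<open>The Galois action on products\<close>

lemma diag2_eq: "diag2 a d = mat2 a 0 0 d" by (simp add: diag2_def mat2_def)

lemma theta_factor_galois:
  assumes p: "p > 0"
  shows "theta_factor p i (nat ((int k * n) mod int p)) (zeta p) x = theta_factor p i (nat (n mod int p)) (zeta p ^ k) x"
proof -
  have zp: "zeta p ^ p = 1" using zeta_power[OF p, of p] by simp
  define e where "e = nat (n mod int p)"
  have "(int k * n) mod int p = int (k * e) mod int p"
    using p by (simp add: e_def mod_mult_right_eq)
  then have ke: "nat ((int k * n) mod int p) = (k * e) mod p" by (metis nat_int zmod_int)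
  have red: "zeta p ^ (j mod p) = zeta p ^ j" for j
    by (metis mult_div_mod_eq power_add power_mult power_one mult_1 zp)
  have "zeta p ^ ((p - 1) * (k * e mod p)) = (zeta p ^ (k * e mod p)) ^ (p - 1)"
    by (simp add: power_mult[symmetric] mult.commute)
  also have "\<dots> = (zeta p ^ k) ^ ((p - 1) * e)"
    unfolding red by (simp add: power_mult[symmetric] mult_ac)
  finally show ?thesis unfolding theta_factor_def e_def[symmetric] ke red by (simp add: power_mult)
qed

text \<open>The two functions agree where \<open>Im \<tau>\<close> is large, hence everywhere by the identity theorem; the
normalisation at the poles and off the half-plane leaves no further freedom.\<close>
lemma has_q_expansion_unique_function:
  assumes p: "p > 0" and v: "v \<in> modular_function_field p" "has_q_expansion p v B"
    and w: "w \<in> modular_function_field p" "has_q_expansion p w B"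
  shows "v = w"
proof
  fix z
  have "eventually (\<lambda>\<tau>. v \<tau> = w \<tau>) (filtercomap Im at_top)"
    using v(2) w(2) unfolding has_q_expansion_def by (auto elim: eventually_elim2)
  then obtain Y where Y: "\<And>\<tau>. Im \<tau> \<ge> Y \<Longrightarrow> v \<tau> = w \<tau>"
    unfolding eventually_filtercomap eventually_at_top_linorder by blast
  show "v z = w z"
  proof (cases "z \<in> upper_half_plane")
    case False
    then show ?thesis using v(1) w(1) by (simp add: modular_function_field_def)
  next
    case True
    let ?U = "{\<tau>. Im \<tau> > max Y 0}"
    show ?thesis
    proof (rule nicely_meromorphic_eqI[where f = v and g = w and z = z and U = ?U and S = upper_half_plane])
      show "v nicely_meromorphic_on upper_half_plane" "w nicely_meromorphic_on upper_half_plane"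
        using v(1) w(1) by (auto simp: modular_function_field_def)
      show "open upper_half_plane" unfolding upper_half_plane_def by (rule open_halfspace_Im_gt)
      show "connected upper_half_plane" unfolding upper_half_plane_def
        by (intro convex_connected convex_halfspace_Im_gt)
      show "open ?U" by (rule open_halfspace_Im_gt)
      have "Complex 0 (max Y 0 + 1) \<in> ?U" by (auto simp: max_def)
      then show "?U \<noteq> {}" by blast
    qed (use True Y in \<open>auto simp: upper_half_plane_def\<close>)
  qed
qed

context balanced_lift begin

context
  fixes d :: "'p mod_ring" assumes d: "d \<noteq> 0"
begin

definition "twisted_set = (\<lambda>a. a v* diag2 1 d) ` A"
definition "twisted_lift b = N (b v* diag2 1 (inverse d)) v* mat2 1 0 0 (to_int_mod_ring d)"

lemma diag2_inverse: "a v* diag2 1 d v* diag2 1 (inverse d) = a"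
  by (rule vec2_eqI) (simp_all add: diag2_eq d)

lemma inj_diag2: "inj_on (\<lambda>a. a v* diag2 1 d) A"
  by (rule inj_on_inverseI[where g = "\<lambda>a. a v* diag2 1 (inverse d)"]) (rule diag2_inverse)

lemma twisted_lift_diag2: "twisted_lift (a v* diag2 1 d) = N a v* mat2 1 0 0 (to_int_mod_ring d)"
  by (simp only: twisted_lift_def diag2_inverse)

lemma conj_diag2: "conj_vec (a v* diag2 1 d) = conj_vec a v* diag2 1 d"
  by (rule vec2_eqI) (simp_all add: diag2_eq)

text \<open>The Galois twist of a product is again a product over a balanced set, with the second coordinates
multiplied by \<open>d\<close>.\<close>
lemma balanced_lift_twisted: "balanced_lift twisted_set twisted_lift m"
proof
  show "finite twisted_set" using finA by (simp add: twisted_set_def)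
  show "second_moments_vanish twisted_set" unfolding twisted_set_def
    by (rule second_moments_vanish_vmult[OF moments inj_diag2])
  have D: "map_matrix of_int (mat2 1 0 0 (to_int_mod_ring d)) = diag2 1 d"
    by (rule mat2_eqI) (simp_all add: diag2_eq)
  show "lifts_on twisted_set twisted_lift"
    using lift by (auto simp: lifts_on_def twisted_set_def twisted_lift_diag2 red_vmult D simp del: vmult2)
  have "N (conj_vec a) v* mat2 1 0 0 (to_int_mod_ring d) = conj_vec (N a v* mat2 1 0 0 (to_int_mod_ring d))" if "a \<in> A"
    for a
    using conj_sym that by (intro vec2_eqI) (simp_all add: conj_symmetric_def)
  then show "conj_symmetric twisted_set twisted_lift"
    using conj_sym unfolding conj_symmetric_def twisted_set_def by (auto simp: conj_diag2 twisted_lift_diag2)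
  show "even m" by (rule m_even)
  show "12 dvd m * card twisted_set" using m12 by (simp add: twisted_set_def card_image[OF inj_diag2])
qed

text \<open>Multiplying the second coordinates by \<open>k\<close> and replacing \<open>\<zeta>\<close> by \<open>\<zeta> ^ k\<close> have the same effect on the
\<open>q\<close>-expansion.  So the product over the twisted set has the coefficients that the definition of the twist asks
for, and \<open>has_q_expansion_unique_function\<close> identifies the two.\<close>
lemma galois_twist_siegel_fn: "galois_twist d u = siegel_fn CARD('p) m twisted_set twisted_lift"
proof -
  interpret t: balanced_lift twisted_set twisted_lift m by (rule balanced_lift_twisted)
  define k where "k = nat (to_int_mod_ring d)"
  let ?z = "zeta CARD('p)"
  have p0: "CARD('p) > 0" by simp
  have k: "to_int_mod_ring d = int k" unfolding k_def
    using range_to_int_mod_ring[where 'a='p] by (metis atLeastLessThan_iff int_nat_eq rangeI)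
  obtain R where R: "int_poly_coeffs (theta_prod CARD('p) m A N0) R"
    using theta_prod_int_poly_coeffs[OF p0] by blast
  obtain R' where R': "int_poly_coeffs (theta_prod CARD('p) m twisted_set t.N0) R'"
    using theta_prod_int_poly_coeffs[OF p0] by blast
  have theta: "theta_prod CARD('p) m twisted_set t.N0 ?z x = theta_prod CARD('p) m A N0 (?z ^ k) x" for x
  proof -
    have "theta_prod CARD('p) m twisted_set t.N0 ?z x
        = (\<Prod>a\<in>A. theta_factor CARD('p) (nat (N a $ 1 mod int CARD('p))) (nat ((int k * N a $ 2) mod int CARD('p))) ?z x ^ m)"
      unfolding theta_prod_def twisted_set_def
      by (subst prod.reindex[OF inj_diag2]) (simp add: o_def twisted_lift_diag2 k mult.commute)
    then show ?thesis unfolding theta_factor_galois[OF p0] by (simp add: theta_prod_def)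
  qed
  have lead: "leading_exponent CARD('p) m twisted_set t.N0 = K"
    unfolding leading_exponent_def twisted_set_def card_image[OF inj_diag2]
    by (subst (1 2) sum.reindex[OF inj_diag2]) (simp add: o_def twisted_lift_diag2)
  have coeffs: "ipoly (R' n) ?z = ipoly (R n) (?z ^ k)" for n
  proof -
    have "theta_prod CARD('p) m A N0 (?z ^ k) has_fps_expansion Abs_fps (\<lambda>n. ipoly (R n) (?z ^ k))"
      using R unfolding int_poly_coeffs_def by blast
    moreover have "theta_prod CARD('p) m A N0 (?z ^ k) has_fps_expansion Abs_fps (\<lambda>n. ipoly (R' n) ?z)"
    proof -
      have "theta_prod CARD('p) m twisted_set t.N0 ?z = theta_prod CARD('p) m A N0 (?z ^ k)" by (rule ext) (rule theta)
      moreover have "theta_prod CARD('p) m twisted_set t.N0 ?z has_fps_expansion Abs_fps (\<lambda>n. ipoly (R' n) ?z)"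
        using R' unfolding int_poly_coeffs_def by blast
      ultimately show ?thesis by simp
    qed
    ultimately have "Abs_fps (\<lambda>n. ipoly (R n) (?z ^ k)) = Abs_fps (\<lambda>n. ipoly (R' n) ?z)"
      by (rule fps_expansion_unique_complex)
    then have "fps_nth (Abs_fps (\<lambda>n. ipoly (R n) (?z ^ k))) n = fps_nth (Abs_fps (\<lambda>n. ipoly (R' n) ?z)) n"
      by simp
    then show ?thesis by simp
  qed
  define F where "F = fls_shift (- K) (fps_to_fls (Abs_fps (\<lambda>n. ipoly (R n) ?z)))"
  define F' where "F' = fls_shift (- K) (fps_to_fls (Abs_fps (\<lambda>n. ipoly (R' n) ?z)))"
  have F: "has_q_expansion CARD('p) u F" unfolding F_def by (rule q_expansion[OF R])
  have F': "has_q_expansion CARD('p) t.u F'" using t.q_expansion[OF R'] unfolding lead F'_def .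
  have zero: "cyclotomic_galois d 0 = 0"
    using cyclotomic_galois_ipoly[OF d, of 0] by simp
  have gal: "fls_nth F' n = cyclotomic_galois d (fls_nth F n)" for n
    by (simp add: F_def F'_def zero coeffs cyclotomic_galois_ipoly[OF d] k)
  show ?thesis unfolding galois_twist_def
  proof (rule the_equality)
    show "t.u \<in> modular_function_field CARD('p) \<and> (\<exists>A B. has_q_expansion CARD('p) u A \<and> has_q_expansion CARD('p) t.u B \<and>
        (\<forall>n. fls_nth B n = cyclotomic_galois d (fls_nth A n)))"
      using t.in_modular_function_field F F' gal by blast
  next
    fix w assume w: "w \<in> modular_function_field CARD('p) \<and> (\<exists>A B. has_q_expansion CARD('p) u A \<and> has_q_expansion CARD('p) w B \<and>
        (\<forall>n. fls_nth B n = cyclotomic_galois d (fls_nth A n)))"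
    then obtain A B where AB: "has_q_expansion CARD('p) u A" "has_q_expansion CARD('p) w B"
      "\<And>n. fls_nth B n = cyclotomic_galois d (fls_nth A n)" by blast
    have "A = F" by (rule q_expansion_unique[OF p0 AB(1) F])
    then have "B = F'" using AB(3) gal by (simp add: fls_eq_iff)
    then show "w = t.u" using has_q_expansion_unique_function[OF p0] w AB(2) F' t.in_modular_function_field by blast
  qed
qed

end

end

section \<open>Lifting to SL2(Z)\<close>

lemma SL2Z_mult: "\<gamma> \<in> SL2Z \<Longrightarrow> \<delta> \<in> SL2Z \<Longrightarrow> \<gamma> ** \<delta> \<in> SL2Z"
  by (simp add: SL2Z_def det_mul)

text \<open>Over a field, a matrix of determinant 1 with nonzero lower left entry is a product of three elementary
matrices, and these lift.  A zero entry is first removed by a column operation.\<close>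
lemma SL2_lift_exists:
  fixes \<sigma> :: "'p::prime_card mod_ring^2^2"
  assumes "det \<sigma> = 1" shows "\<exists>\<gamma>. \<gamma> \<in> SL2Z \<and> map_matrix of_int \<gamma> = \<sigma>"
proof -
  define L where "L \<sigma> \<longleftrightarrow> (\<exists>\<gamma>. \<gamma> \<in> SL2Z \<and> map_matrix of_int \<gamma> = \<sigma>)" for \<sigma> :: "'p mod_ring^2^2"
  have mult: "L (\<sigma> ** \<tau>)" if "L \<sigma>" "L \<tau>" for \<sigma> \<tau>
    using that SL2Z_mult map_matrix_mult2 unfolding L_def by metis
  have upper: "L (mat2 1 x 0 1)" and lower: "L (mat2 1 0 x 1)" for x
  proof -
    have "mat2 1 (to_int_mod_ring x) 0 1 \<in> SL2Z" "mat2 1 0 (to_int_mod_ring x) 1 \<in> SL2Z"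
      by (simp_all add: SL2Z_def det_2)
    moreover have "map_matrix of_int (mat2 1 (to_int_mod_ring x) 0 1) = mat2 1 x 0 1"
      "map_matrix of_int (mat2 1 0 (to_int_mod_ring x) 1) = mat2 1 0 x 1"
      by (rule mat2_eqI; simp)+
    ultimately show "L (mat2 1 x 0 1)" "L (mat2 1 0 x 1)" unfolding L_def by blast+
  qed
  have generic: "L \<sigma>" if d: "det \<sigma> = 1" and c: "\<sigma> $ 2 $ 1 \<noteq> 0" for \<sigma>
  proof -
    let ?c = "\<sigma> $ 2 $ 1"
    have "\<sigma> $ 1 $ 2 * ?c = \<sigma> $ 1 $ 1 * \<sigma> $ 2 $ 2 - 1" using d by (simp add: det_2 algebra_simps)
    then have b: "\<sigma> $ 1 $ 2 = (\<sigma> $ 1 $ 1 * \<sigma> $ 2 $ 2 - 1) / ?c" using c by (simp add: field_simps)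
    have "\<sigma> = mat2 1 ((\<sigma> $ 1 $ 1 - 1) / ?c) 0 1 ** (mat2 1 0 ?c 1 ** mat2 1 ((\<sigma> $ 2 $ 2 - 1) / ?c) 0 1)"
      by (rule mat2_eqI) (use c in \<open>simp_all add: b field_simps\<close>)
    then show ?thesis using mult[OF upper mult[OF lower upper]] by metis
  qed
  have "L \<sigma>"
  proof (cases "\<sigma> $ 2 $ 1 = 0")
    case True
    let ?\<tau> = "\<sigma> ** mat2 1 0 1 1"
    have "det ?\<tau> = 1" using assms by (simp add: det_mul) (simp add: det_2)
    moreover have "?\<tau> $ 2 $ 1 \<noteq> 0" using assms True by (auto simp: det_2)
    ultimately have "L ?\<tau>" by (rule generic)
    moreover have "\<sigma> = ?\<tau> ** mat2 1 0 (- 1) 1" by (rule mat2_eqI) simp_all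
    ultimately show ?thesis using mult[OF _ lower] by metis
  qed (rule generic[OF assms])
  then show ?thesis by (simp add: L_def)
qed

lemma SL2_lift:
  assumes "det \<sigma> = 1" shows "SL2_lift \<sigma> \<in> SL2Z" "map_matrix of_int (SL2_lift \<sigma>) = \<sigma>"
  using someI_ex[OF SL2_lift_exists[OF assms]] unfolding SL2_lift_def by auto

lemma moebius_not_upper:
  assumes \<gamma>: "\<gamma> \<in> SL2Z" and \<tau>: "\<not> Im \<tau> > 0" shows "\<not> Im (moebius \<gamma> \<tau>) > 0"
proof -
  let ?d = "of_int (\<gamma>$2$1) * \<tau> + of_int (\<gamma>$2$2)"
  have "Im (moebius \<gamma> \<tau>) = of_int (\<gamma>$1$1 * \<gamma>$2$2 - \<gamma>$1$2 * \<gamma>$2$1) * Im \<tau> / (norm ?d)\<^sup>2"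
    unfolding moebius_def cmod_power2 Im_divide by (simp add: algebra_simps)
  then show ?thesis using \<tau> SL2Z_det[OF \<gamma>] by (simp add: zero_less_divide_iff not_less)
qed

section \<open>Invariance and the main theorem\<close>

text \<open>Twisting by the determinant and composing with \<open>\<gamma>\<close> replaces the lifts \<open>N a\<close> by \<open>N a v* \<Gamma>\<close>, where \<open>\<Gamma>\<close> reduces
to \<open>\<sigma>\<close>.  The lifts \<open>N (a v* \<sigma>)\<close> of the same vectors give the original product in a different order, and the
vanishing of the cocycle shows that the two products are equal.\<close>
lemma (in ns_orbit) GL2_act_invariant:
  assumes N: "balanced_lift Orb N m" and \<sigma>: "\<sigma> \<in> GH"
  shows "GL2_act (siegel_fn CARD('p) m Orb N) \<sigma> = siegel_fn CARD('p) m Orb N"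
proof -
  interpret b: balanced_lift Orb N m by (rule N)
  let ?p = "CARD('p)"
  define d where "d = det \<sigma>"
  have d: "d \<noteq> 0" using \<sigma> H by (auto simp: det_in_def d_def)
  define \<gamma> where "\<gamma> = SL2_lift (diag2 1 (inverse d) ** \<sigma>)"
  have "det (diag2 1 (inverse d) ** \<sigma>) = 1"
    unfolding det_mul d_def[symmetric] using d by (simp add: det_2 diag2_eq)
  from SL2_lift[OF this] have \<gamma>: "\<gamma> \<in> SL2Z" "map_matrix of_int \<gamma> = diag2 1 (inverse d) ** \<sigma>"
    by (simp_all add: \<gamma>_def)
  define A N' where "A = b.twisted_set d" and "N' = b.twisted_lift d"
  have t: "balanced_lift A N' m" unfolding A_def N'_def by (rule b.balanced_lift_twisted[OF d])
  have twist: "galois_twist d (siegel_fn ?p m Orb N) = siegel_fn ?p m A N'"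
    unfolding A_def N'_def by (rule b.galois_twist_siegel_fn[OF d])
  define \<Gamma> where "\<Gamma> = mat2 1 0 0 (to_int_mod_ring d) ** \<gamma>"
  have \<Gamma>: "map_matrix of_int \<Gamma> = \<sigma>"
  proof -
    have "map_matrix of_int (mat2 1 0 0 (to_int_mod_ring d)) = diag2 1 d"
      by (rule mat2_eqI) (simp_all add: diag2_eq)
    then have "map_matrix of_int \<Gamma> = diag2 1 d ** (diag2 1 (inverse d) ** \<sigma>)"
      unfolding \<Gamma>_def map_matrix_mult2 \<gamma>(2) by simp
    also have "\<dots> = \<sigma>" by (rule mat2_eqI) (simp_all add: diag2_eq d mult.assoc[symmetric])
    finally show ?thesis .
  qed
  have \<sigma>_pres: "preserves \<sigma> Orb" by (rule GH_preserves[OF \<sigma>])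
  have main: "siegel_fn ?p m A N' (moebius \<gamma> \<tau>) = siegel_fn ?p m Orb N \<tau>" if \<tau>: "Im \<tau> > 0"
    for \<tau>
  proof -
    have "siegel_fn ?p m A N' (moebius \<gamma> \<tau>) = csiegel_prod ?p m A (\<lambda>a. N' a v* \<gamma>) \<tau>"
      using csiegel_prod_moebius[OF \<tau> \<gamma>(1) balanced_lift.m12[OF t]] moebius_Im_pos[OF \<gamma>(1) \<tau>]
        by (simp add: siegel_fn_def)
    also have "\<dots> = csiegel_prod ?p m Orb (\<lambda>a. N a v* \<Gamma>) \<tau>"
      unfolding csiegel_prod_def A_def b.twisted_set_def[OF d] N'_def
      by (subst prod.reindex[OF b.inj_diag2[OF d]])
        (simp add: o_def b.twisted_lift_diag2[OF d] \<Gamma>_def vector_matrix_mul_assoc del: vmult2 mmult2)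
    also have "\<dots> = csiegel_prod ?p m Orb (\<lambda>a. N (a v* \<sigma>)) \<tau>"
    proof (rule csiegel_prod_change_lift_eq[OF \<tau> _ b.m_even])
      show "red (N (a v* \<sigma>)) = (red (N a v* \<Gamma>) :: 'p mod_ring^2)" if "a \<in> Orb" for a
      proof -
        have "a v* \<sigma> \<in> Orb" using \<sigma>_pres that by (auto simp: bij_betw_def)
        then show ?thesis using b.lift that by (simp add: lifts_on_def red_vmult \<Gamma> del: vmult2)
      qed
      have "lift_cocycle Orb N \<Gamma> = 0"
        by (rule lift_cocycle_vanishes[OF b.lift b.conj_sym]) (simp add: \<Gamma> \<sigma>)
      then show "int ?p ^ 2 dvd (\<Sum>a\<in>Orb. wedge (N (a v* \<sigma>)) (N a v* \<Gamma>))"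
        using p2_dvd_iff_lift_cocycle[OF b.lift, of \<Gamma>] \<sigma>_pres by (simp add: \<Gamma>)
    qed
    also have "\<dots> = csiegel_prod ?p m Orb N \<tau>" unfolding csiegel_prod_def
      by (rule prod.reindex_bij_betw[OF \<sigma>_pres])
    finally show ?thesis using \<tau> by (simp add: siegel_fn_def)
  qed
  have off: "siegel_fn ?p m A N' (moebius \<gamma> \<tau>) = siegel_fn ?p m Orb N \<tau>" if "\<not> Im \<tau> > 0"
    for \<tau>
    using moebius_not_upper[OF \<gamma>(1) that] that by (simp add: siegel_fn_def)
  show ?thesis unfolding GL2_act_def d_def[symmetric] twist \<gamma>_def[symmetric]
    using main off by (auto simp: fun_eq_iff)
qed

lemma conj_lifting_integral:
  fixes A :: "('p::prime_card mod_ring^2) set"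
  assumes L: "is_lifting A L" "respects_conjugation A L" and A: "\<And>a. a \<in> A \<Longrightarrow> conj_vec a \<in> A"
  shows "\<exists>N. lifts_on A N \<and> conj_symmetric A N \<and> (\<forall>a\<in>A. L a = (\<chi> i. of_int (N a $ i) / of_nat CARD('p)))"
proof -
  obtain N where N: "\<And>a. a \<in> A \<Longrightarrow> L a = (\<chi> i. of_int (N a $ i) / of_nat CARD('p)) \<and> a = (\<chi> i. of_int (N a $ i))"
    using L(1) unfolding is_lifting_def by metis
  have "N (conj_vec a) = conj_vec (N a)" if a: "a \<in> A" for a
  proof -
    have "L (conj_vec a) $ i = conj_vec (L a) $ i" for i
      using L(2) a by (simp add: respects_conjugation_def)
    from this[of 1] this[of 2]
    have "rat_of_int (N (conj_vec a) $ 1) / of_nat CARD('p) = of_int (N a $ 1) / of_nat CARD('p)"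
      "rat_of_int (N (conj_vec a) $ 2) / of_nat CARD('p) = of_int (- (N a $ 2)) / of_nat CARD('p)"
      using N[OF a] N[OF A[OF a]] by simp_all
    then have "N (conj_vec a) $ 1 = N a $ 1" "N (conj_vec a) $ 2 = - (N a $ 2)"
      unfolding divide_cancel_right of_int_eq_iff by simp_all
    then show ?thesis by (intro vec2_eqI) simp_all
  qed
  moreover have "red (N a) = a" if "a \<in> A" for a
    using N[OF that] by (simp add: red_def)
  ultimately show ?thesis using N A unfolding lifts_on_def conj_symmetric_def by blast
qed

theorem theorem6p1:
  fixes \<Xi> :: "'p::prime_card mod_ring"
    and H :: "'p mod_ring set"
    and G :: "('p mod_ring^2^2) set"
    and Orb :: "('p mod_ring^2) set"
    and m :: nat
  assumes p_ge_5: "CARD('p) \<ge> 5"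
    and nonresidue: "\<nexists>x. x\<^sup>2 = \<Xi>"
    and G_eq: "G = ns_normalizer \<Xi>"
    and H_subgroup: "0 \<notin> H" "1 \<in> H" "\<And>x y. x \<in> H \<Longrightarrow> y \<in> H \<Longrightarrow> x * y \<in> H"
      "\<And>x. x \<in> H \<Longrightarrow> inverse x \<in> H"
    and minus_one: "-1 \<in> H"
    and orbit: "\<exists>a. a \<noteq> 0 \<and> Orb = right_orbit (det_in G H) a"
    and m_eq: "m = (if 3 dvd (CARD('p) + 1) * card H then 2 else 6)"
  shows "(\<forall>L L'. is_lifting Orb L \<and> respects_conjugation Orb L \<and>
            is_lifting Orb L' \<and> respects_conjugation Orb L' \<longrightarrow>
            siegel_product m Orb L = siegel_product m Orb L') \<and>
         (\<forall>L. is_lifting Orb L \<and> respects_conjugation Orb L \<longrightarrow>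
            siegel_product m Orb L \<in> function_field_X G H)"
proof -
  let ?p = "CARD('p)"
  interpret ns_orbit \<Xi> H Orb
    using assms by unfold_locales auto
  have m_even: "even m" and m_pos: "m > 0" by (simp_all add: m_eq)
  have m12: "12 dvd m * card Orb"
  proof (cases "3 dvd (CARD('p) + 1) * card H")
    case True
    have "12 dvd 2 * card Orb" using Orb_three[OF True] Orb_even by presburger
    then show ?thesis using m_eq True by simp
  next
    case False
    have "12 dvd 6 * card Orb" using Orb_even by presburger
    then show ?thesis using m_eq False by simp
  qed
  have Orb_ne: "Orb \<noteq> {}"
  proof -
    have "ns_elt \<Xi> 1 1 0 \<in> GH" using ns_elt_in_GH[of 1 1 0] H by simp
    then show ?thesis using orbit unfolding G_eq right_orbit_def by blast
  qed
  have siegel_product_eq: "\<exists>N. balanced_lift Orb N m \<and> siegel_product m Orb L = siegel_fn ?p m Orb N"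
    if L: "is_lifting Orb L" "respects_conjugation Orb L" for L
  proof -
    obtain N where N: "lifts_on Orb N" "conj_symmetric Orb N"
      "\<And>a. a \<in> Orb \<Longrightarrow> L a = (\<chi> i. of_int (N a $ i) / of_nat ?p)"
      using conj_lifting_integral[OF L Orb_conj] by blast
    have "siegel_product m Orb L \<tau> = siegel_fn ?p m Orb N \<tau>" for \<tau>
    proof (cases "Im \<tau> > 0")
      case True
      then show ?thesis unfolding siegel_product_def siegel_fn_def csiegel_prod_def
        by (auto intro!: prod.cong simp: siegel_eq_csiegel[OF True] N(3) csiegel_at_def of_rat_divide)
    next
      case False
      have "siegel_product m Orb L \<tau> = (\<Prod>a\<in>Orb. 0)"
        unfolding siegel_product_def using False m_pos
        by (intro prod.cong) (simp_all add: siegel_def upper_half_plane_def)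
      also have "\<dots> = 0" using Orb_ne Orb_finite by (simp add: card_gt_0_iff)
      finally show ?thesis using False by (simp add: siegel_fn_def)
    qed
    moreover have "balanced_lift Orb N m"
      using N m_even m12 Orb_finite Orb_second_moments by unfold_locales auto
    ultimately show ?thesis by blast
  qed
  have "siegel_product m Orb L = siegel_product m Orb L'"
    if L: "is_lifting Orb L" "respects_conjugation Orb L" "is_lifting Orb L'" "respects_conjugation Orb L'" for L L'
  proof -
    obtain N N' where N: "balanced_lift Orb N m" "siegel_product m Orb L = siegel_fn ?p m Orb N"
      and N': "balanced_lift Orb N' m" "siegel_product m Orb L' = siegel_fn ?p m Orb N'"
      using siegel_product_eq L by meson
    have "csiegel_prod ?p m Orb N' \<tau> = csiegel_prod ?p m Orb N \<tau>" if "Im \<tau> > 0" for \<tau>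
      using N(1) N'(1) unfolding balanced_lift_def
      by (intro csiegel_prod_change_lift_eq[where 'p='p, OF that]) (auto simp: lifts_on_def lift_sum_conj)
    then show ?thesis unfolding N(2) N'(2) by (auto simp: siegel_fn_def)
  qed
  moreover have "siegel_product m Orb L \<in> function_field_X G H"
    if L: "is_lifting Orb L" "respects_conjugation Orb L" for L
  proof -
    obtain N where N: "balanced_lift Orb N m" "siegel_product m Orb L = siegel_fn ?p m Orb N"
      using siegel_product_eq L by meson
    show ?thesis unfolding function_field_X_def N(2) G_eq
      using balanced_lift.in_modular_function_field[OF N(1)] GL2_act_invariant[OF N(1)] by simp
  qed
  ultimately show ?thesis by blast
qed

end
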